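(* Let $s\in\{1,2,\dots\}$ be fixed and let $T_n=(\eta_{ij}a_{i-j})_{i,j=1}^n$ be a real or complex random Toeplitz band matrix with bandwidth $b_n$ satisfying the assumptions in the context (either the real or the complex case), where $b_n\to\infty$ and $b_n/n\to b\in[0,1]$ as $n\to\infty$. Set $$W_n^{(s)}=\frac{1}{b_n^s}(T_n^* )^sT_n^s .$$ For a given polynomial $Q(x)=\sum_{j=0}^pq_jx^j$ with degree $p\ge1$, there is a number $\hat\sigma_Q^2\ge0$ such that $$\frac{\sqrt{b_n}}{n}\left(\mathrm{tr}\,Q(W_n^{(s)})-\mathbb{E}[\mathrm{tr}\,Q(W_n^{(s)})]\right)\to N(0,\hat\sigma_Q^2)$$ in distribution as $n\to\infty$, where $\hat\sigma_Q^2$ denotes the variance.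
   Context: $(b_n)$ is a sequence of positive integers with $b_n<n$; $\eta_{ij}=1$ if $|i-j|\le b_n$ and $0$ otherwise; $T_n^*$ is the adjoint of $T_n$. No symmetry relation is imposed between $a_j$ and $a_{-j}$. Real case: $\{a_j:j\in\mathbb{Z}\}$ is a sequence of independent real random variables with $\mathbb{E}[a_j]=0$, $\mathbb{E}[|a_j|^2]=1$, $\mathbb{E}[|a_j|^4]=\kappa$ for all $j\in\mathbb{Z}$ ($\kappa$ independent of $j$), and $\sup_{j\in\mathbb{Z}}\mathbb{E}[|a_j|^k]=C_k<\infty$ for all $k\ge3$. Complex case: $\{\mathrm{Re}\,a_j,\mathrm{Im}\,a_j\}_{j\in\mathbb{Z}}$ is a sequence of independent real random variables with $\mathbb{E}[a_j]=0$, $\mathbb{E}[|a_j|^2]=1$, $\mathbb{E}[a_j^2]=0$, $\mathbb{E}[|a_j|^4]=\kappa$ for all $j\in\mathbb{Z}$ ($\kappa$ independent of $j$), and $\sup_{j\in\mathbb{Z}}\mathbb{E}[|a_j|^k]=C_k<\infty$ for all $k\in\mathbb{N}$. *)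

theory Defs
  imports
    "HOL-Probability.Probability"
    "Jordan_Normal_Form.Schur_Decomposition"
begin

text \<open>
  Both cases are read as complex-valued input sequences; the real case requires the values to be
  real. Integrability is stated explicitly because the expectation of a non-integrable function
  is \<open>0\<close> by convention; in each case the last clause says that
  \<open>sup\<^sub>j E |a\<^sub>j|\<^sup>k\<close> is finite.
\<close>

definition (in prob_space) real_toeplitz_input :: "(int \<Rightarrow> 'a \<Rightarrow> complex) \<Rightarrow> real \<Rightarrow> bool" where
  "real_toeplitz_input a \<kappa> \<longleftrightarrow>
     (\<forall>j. \<forall>\<omega>\<in>space M. a j \<omega> \<in> \<real>) \<and>
     indep_vars (\<lambda>_. borel) (\<lambda>j \<omega>. Re (a j \<omega>)) UNIV \<and>
     (\<forall>j. expectation (a j) = 0) \<and>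
     (\<forall>j. expectation (\<lambda>\<omega>. (cmod (a j \<omega>))\<^sup>2) = 1) \<and>
     (\<forall>j. expectation (\<lambda>\<omega>. cmod (a j \<omega>) ^ 4) = \<kappa>) \<and>
     (\<forall>k\<ge>3. (\<forall>j. integrable M (\<lambda>\<omega>. cmod (a j \<omega>) ^ k)) \<and>
       bdd_above (range (\<lambda>j. expectation (\<lambda>\<omega>. cmod (a j \<omega>) ^ k))))"

text \<open>The independent family is indexed by pairs: \<open>(j, False)\<close> stands for the real part of
  \<open>a\<^sub>j\<close>, \<open>(j, True)\<close> for its imaginary part.\<close>

definition (in prob_space) complex_toeplitz_input :: "(int \<Rightarrow> 'a \<Rightarrow> complex) \<Rightarrow> real \<Rightarrow> bool" where
  "complex_toeplitz_input a \<kappa> \<longleftrightarrow>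
     indep_vars (\<lambda>_. borel) (\<lambda>(j, im) \<omega>. if im then Im (a j \<omega>) else Re (a j \<omega>)) UNIV \<and>
     (\<forall>j. expectation (a j) = 0) \<and>
     (\<forall>j. expectation (\<lambda>\<omega>. (cmod (a j \<omega>))\<^sup>2) = 1) \<and>
     (\<forall>j. expectation (\<lambda>\<omega>. (a j \<omega>)\<^sup>2) = 0) \<and>
     (\<forall>j. expectation (\<lambda>\<omega>. cmod (a j \<omega>) ^ 4) = \<kappa>) \<and>
     (\<forall>k. (\<forall>j. integrable M (\<lambda>\<omega>. cmod (a j \<omega>) ^ k)) \<and>
       bdd_above (range (\<lambda>j. expectation (\<lambda>\<omega>. cmod (a j \<omega>) ^ k))))"

text \<open>The band Toeplitz matrix with symbol coefficients \<open>c\<close> and bandwidth \<open>h\<close>. Rows and columns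
  are numbered from \<open>0\<close>, which does not affect \<open>i - j\<close>.\<close>

definition toeplitz_band :: "nat \<Rightarrow> nat \<Rightarrow> (int \<Rightarrow> complex) \<Rightarrow> complex mat" where
  "toeplitz_band n h c =
     Matrix.mat n n (\<lambda>(i, j). (if \<bar>int i - int j\<bar> \<le> int h then 1 else 0) * c (int i - int j))"

definition W_mat :: "nat \<Rightarrow> nat \<Rightarrow> nat \<Rightarrow> (int \<Rightarrow> complex) \<Rightarrow> complex mat" where
  "W_mat s n h c =
     (1 / of_nat h ^ s) \<cdot>\<^sub>m
       (mat_adjoint (toeplitz_band n h c) ^\<^sub>m s * toeplitz_band n h c ^\<^sub>m s)"

definition mat_trace :: "'a :: comm_monoid_add mat \<Rightarrow> 'a" where
  "mat_trace A = (\<Sum>i<dim_row A. A $$ (i, i))"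

text \<open>Evaluation of a real polynomial at a square complex matrix, entry by entry:
  \<open>Q(A) = \<Sum>\<^sub>j q\<^sub>j A\<^sup>j\<close>.\<close>

definition poly_mat :: "real poly \<Rightarrow> complex mat \<Rightarrow> complex mat" where
  "poly_mat Q A = Matrix.mat (dim_row A) (dim_row A)
     (\<lambda>ij. \<Sum>k\<le>degree Q. of_real (coeff Q k) * (A ^\<^sub>m k) $$ ij)"

lemma mat_adjoint_index:
  assumes "i < dim_col A" "j < dim_row A"
  shows "mat_adjoint A $$ (i, j) = conjugate (A $$ (j, i))"
  using assms by (simp add: mat_adjoint_def mat_of_rows_index)

lemma mat_adjoint_dim [simp]:
  "dim_row (mat_adjoint A) = dim_col A" "dim_col (mat_adjoint A) = dim_row A"
  by (simp_all add: mat_adjoint_def)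

lemma mat_adjoint_carrier [simp]: "A \<in> carrier_mat m n \<Longrightarrow> mat_adjoint A \<in> carrier_mat n m"
  by (intro carrier_matI) auto

lemma mat_adjoint_mult_complex:
  fixes A B :: "complex mat"
  assumes "A \<in> carrier_mat m k" "B \<in> carrier_mat k n"
  shows "mat_adjoint (A * B) = mat_adjoint B * mat_adjoint A"
proof (rule eq_matI)
  fix i j assume "i < dim_row (mat_adjoint B * mat_adjoint A)" "j < dim_col (mat_adjoint B * mat_adjoint A)"
  with assms show "mat_adjoint (A * B) $$ (i, j) = (mat_adjoint B * mat_adjoint A) $$ (i, j)"
    by (auto simp: mat_adjoint_index scalar_prod_def mult.commute intro!: sum.cong)
qed (use assms in auto)

lemma mat_adjoint_pow_complex:
  fixes A :: "complex mat"
  assumes "A \<in> carrier_mat n n"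
  shows "mat_adjoint (A ^\<^sub>m k) = mat_adjoint A ^\<^sub>m k"
proof (induction k)
  case 0
  show ?case using assms by (intro eq_matI) (auto simp: mat_adjoint_index)
next
  case (Suc k)
  have comm: "B * B ^\<^sub>m k = B ^\<^sub>m k * B" if "B \<in> carrier_mat n n" for B :: "complex mat"
  proof (induction k)
    case (Suc k)
    then show ?case using that by (simp add: assoc_mult_mat [of _ n n _ n _ n, symmetric])
  qed (use that in auto)
  show ?case
    using assms Suc by (simp add: mat_adjoint_mult_complex [of _ n n _ n] comm)
qed

lemma toeplitz_band_carrier [simp]: "toeplitz_band n h c \<in> carrier_mat n n"
  by (simp add: toeplitz_band_def)

lemma W_mat_carrier [simp]: "W_mat s n h c \<in> carrier_mat n n"
  unfolding W_mat_def by (intro smult_carrier_mat mult_carrier_mat [of _ n n] pow_carrier_mat) simp_all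

lemma mat_adjoint_adjoint_complex: "mat_adjoint (mat_adjoint A) = (A :: complex mat)"
  by (rule eq_matI) (auto simp: mat_adjoint_index)

lemma W_mat_hermitian: "mat_adjoint (W_mat s n h c) = W_mat s n h c"
proof -
  let ?T = "toeplitz_band n h c"
  let ?H = "mat_adjoint ?T ^\<^sub>m s * ?T ^\<^sub>m s"
  have smult: "mat_adjoint (x \<cdot>\<^sub>m A) = cnj x \<cdot>\<^sub>m mat_adjoint A" for x and A :: "complex mat"
    by (rule eq_matI) (auto simp: mat_adjoint_index)
  have "mat_adjoint ?H = ?H"
    by (simp add: mat_adjoint_mult_complex [of _ n n _ n] mat_adjoint_pow_complex [of _ n]
        mat_adjoint_adjoint_complex)
  then show ?thesis
    by (simp add: W_mat_def smult)
qed

text \<open>Hence taking the real part of \<open>tr Q(W\<^sub>n)\<close> is merely a type conversion.\<close>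

lemma trace_poly_W_real: "mat_trace (poly_mat Q (W_mat s n h c)) \<in> \<real>"
proof -
  let ?W = "W_mat s n h c"
  have dim: "dim_row ?W = n" "dim_col ?W = n"
    using W_mat_carrier by blast+
  have "(?W ^\<^sub>m k) $$ (i, i) \<in> \<real>" if "i < n" for i k
  proof -
    have "mat_adjoint (?W ^\<^sub>m k) $$ (i, i) = (?W ^\<^sub>m k) $$ (i, i)"
      by (simp add: mat_adjoint_pow_complex [of _ n] W_mat_hermitian)
    then show ?thesis
      using that dim by (simp add: mat_adjoint_index Reals_cnj_iff)
  qed
  then show ?thesis
    by (auto simp: mat_trace_def poly_mat_def dim intro!: sum_in_Reals Reals_mult)
qed

definition normal_law :: "real \<Rightarrow> real \<Rightarrow> real measure" where
  "normal_law \<mu> v =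
     (if v = 0 then return borel \<mu> else density lborel (normal_density \<mu> (sqrt v)))"

end

theory Submission
  imports Defs
begin

text \<open>
Expanding the trace gives a polynomial in the entries. The product of the matrices is a sum over walks on the rows, and
a closed walk contributes a monomial given by its \<^emph>\<open>word\<close>, the list of the indices of its steps
together with conjugation flags. Since the matrix is Toeplitz, the monomial depends only on the word, so
the normalised trace is a sum over words \<open>u\<close> with total step \<open>0\<close> of a coefficient times the
monomial of \<open>u\<close> (\<open>trace_poly_W\<close>, \<open>sum_word_coeff\<close>). The coefficient counts the rows from which the walk
stays inside the matrix and, with \<open>b\<close> the bandwidth, is of order \<open>b\<close> to the power \<open>(1 - length u) / 2\<close>.

The statistic \<open>f\<close> is asymptotically normal by a version of Stein's method. Revealing the entries one after
the other decomposes \<open>f - E f\<close> into martingale increments \<open>\<phi>\<^sub>j\<close>. Let \<open>\<Delta>\<^sub>j\<close> be the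
difference between \<open>f\<close> and the value of \<open>f\<close> with \<open>a\<^sub>j\<close> replaced by \<open>0\<close>. As \<open>\<phi>\<^sub>j\<close> is orthogonal to all functions
of the other entries, \<open>E ((f - E f) exp (i t f))\<close> equals \<open>i t E (T exp (i t f))\<close> with \<open>T = \<Sum>\<^sub>j \<phi>\<^sub>j \<Delta>\<^sub>j\<close>, up to a
third-order term, and \<open>E T\<close> is the variance of \<open>f\<close> (\<open>stein_bound\<close>). Hence, as soon as \<open>T\<close>
concentrates, the characteristic function nearly satisfies the differential equation
\<open>\<psi>' = - t V \<psi>\<close> of a Gaussian (\<open>char_ode_bound\<close>). Both errors, the variance of \<open>T\<close> and the sums of the fourth moments of
the \<open>\<phi>\<^sub>j\<close> and \<open>\<Delta>\<^sub>j\<close>, are bounded by one sum over quadruples of words in which every index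
occurs at least twice and which are connected through common indices. Counting such quadruples is a
problem of linear algebra: pairing at least halves the number of free indices, and since the words are connected, the
four constraints that a word has total step \<open>0\<close> cost at least three more in comparison with this count.
This is \<open>circuit_dimension\<close>; it shows that the sum is \<open>O(1 / b)\<close> (\<open>Gn_le\<close>).

It remains to see that the variance converges (\<open>variance_convergent\<close>). It is a sum over pairs of words of a
covariance. Grouped by the pattern of coincidences among the indices, each group either
vanishes, or has too few free parameters to matter, or is a constant covariance times a lattice sum over a polytope.
The last kind converges to an integral after rescaling by the bandwidth
(\<open>riemann_sum_convergent\<close>). Only patterns of pairs, and patterns with one balanced quadruple, survive; for these the
covariance depends on the common second and fourth moments alone, which is why these are prescribed.

The real and the complex case are treated at once: they differ in the value of \<open>E a\<^sub>j\<^sup>2\<close>, which is \<open>1\<close> or \<open>0\<close>.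
\<close>

section \<open>Counting solutions of connected systems of signed sums\<close>

text \<open>A position \<open>p\<close> has a class \<open>\<rho> p\<close>, a circuit \<open>circ p\<close> and a sign \<open>sg p\<close>. The integer vectors that are
constant on classes and have zero signed sum round each circuit form a module, and
\<open>determines\<close> says that restriction to \<open>D\<close> is injective on it. Consequently at most \<open>N ^ card D\<close> such
vectors have all entries in a given set of size \<open>N\<close>, so bounds on \<open>card D\<close> are bounds on the
number of free parameters.\<close>

definition determines :: "'p set \<Rightarrow> ('p \<Rightarrow> 'v) \<Rightarrow> ('p \<Rightarrow> nat) \<Rightarrow> ('p \<Rightarrow> int) \<Rightarrow> 'p set \<Rightarrow> bool" where
  "determines P \<rho> circ sg D \<longleftrightarrow>
     (\<forall>z :: 'p \<Rightarrow> int. (\<forall>p\<in>P. \<forall>q\<in>P. \<rho> p = \<rho> q \<longrightarrow> z p = z q) \<longrightarrow>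
        (\<forall>i. (\<Sum>p | p \<in> P \<and> circ p = i. sg p * z p) = 0) \<longrightarrow>
        (\<forall>p\<in>D. z p = 0) \<longrightarrow> (\<forall>p\<in>P. z p = 0))"

lemma determinesI:
  assumes "\<And>z :: 'p \<Rightarrow> int. \<lbrakk>\<And>p q. p \<in> P \<Longrightarrow> q \<in> P \<Longrightarrow> \<rho> p = \<rho> q \<Longrightarrow> z p = z q;
      \<And>i. (\<Sum>p | p \<in> P \<and> circ p = i. sg p * z p) = 0; \<And>p. p \<in> D \<Longrightarrow> z p = 0\<rbrakk>
      \<Longrightarrow> \<forall>p\<in>P. z p = 0"
  shows "determines P \<rho> circ sg D"
  unfolding determines_def
proof (intro allI impI)
  fix z :: "'p \<Rightarrow> int"
  assume z: "\<forall>p\<in>P. \<forall>q\<in>P. \<rho> p = \<rho> q \<longrightarrow> z p = z q"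
    "\<forall>i. (\<Sum>p | p \<in> P \<and> circ p = i. sg p * z p) = 0" "\<forall>p\<in>D. z p = 0"
  show "\<forall>p\<in>P. z p = 0"
  proof (rule assms)
    show "z p = z q" if "p \<in> P" "q \<in> P" "\<rho> p = \<rho> q" for p q using z(1) that by blast
    show "(\<Sum>p | p \<in> P \<and> circ p = i. sg p * z p) = 0" for i using z(2) by blast
    show "z p = 0" if "p \<in> D" for p using z(3) that by blast
  qed
qed

lemma determinesD:
  assumes "determines P \<rho> circ sg D"
    and z: "\<And>p q. p \<in> P \<Longrightarrow> q \<in> P \<Longrightarrow> \<rho> p = \<rho> q \<Longrightarrow> z p = z q"
      "\<And>i. (\<Sum>p | p \<in> P \<and> circ p = i. sg p * z p) = 0"
      "\<And>p. p \<in> D \<Longrightarrow> z p = 0" and "p \<in> P"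
  shows "z p = (0::int)"
proof -
  have "(\<forall>p\<in>P. \<forall>q\<in>P. \<rho> p = \<rho> q \<longrightarrow> z p = z q) \<longrightarrow>
        (\<forall>i. (\<Sum>p | p \<in> P \<and> circ p = i. sg p * z p) = 0) \<longrightarrow>
        (\<forall>p\<in>D. z p = 0) \<longrightarrow> (\<forall>p\<in>P. z p = 0)"
    using assms(1) unfolding determines_def by (rule spec)
  moreover have "\<forall>p\<in>P. \<forall>q\<in>P. \<rho> p = \<rho> q \<longrightarrow> z p = z q" using z(1) by blast
  moreover have "\<forall>i. (\<Sum>p | p \<in> P \<and> circ p = i. sg p * z p) = 0" using z(2) by blast
  moreover have "\<forall>p\<in>D. z p = 0" using z(3) by blast
  ultimately show ?thesis using \<open>p \<in> P\<close> by blast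
qed

lemma card_fibres:
  assumes "finite P"
  shows "card P = (\<Sum>v\<in>f ` P. card {p\<in>P. f p = v})"
  using assms sum.image_gen[of P "\<lambda>_. 1::nat" f] by simp

lemma card_ge_two_partner:
  assumes "finite A" "p \<in> A" "q \<in> A" "p \<noteq> q"
  shows "2 \<le> card A"
  using assms card_mono[of A "{p,q}"] by simp

lemma even_partner:
  assumes "finite A" "even (card A)" "p \<in> A"
  shows "\<exists>q\<in>A. q \<noteq> p"
proof (rule ccontr)
  assume "\<not> ?thesis"
  then have "A = {p}" using assms(3) by blast
  then show False using assms(2) by simp
qed

text \<open>A pair of equal values joining two circuits can be eliminated: adding the two constraints, with the
signs of the second circuit flipped so that \<open>p\<close> and \<open>q\<close> cancel, gives one merged circuit on the
remaining positions, and the first constraint then returns the value at \<open>p\<close>. Two positions and one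
constraint disappear, and no free parameter is spent.\<close>

lemma determines_delete_cross_pair:
  assumes fin: "finite P" and sg: "\<And>r. r \<in> P \<Longrightarrow> \<bar>sg r\<bar> = 1"
    and pq: "p \<in> P" "q \<in> P" "\<rho> p = \<rho> q" "circ p \<noteq> circ q"
    and D: "determines (P - {p,q}) \<rho> (\<lambda>r. if circ r = circ q then circ p else circ r)
              (\<lambda>r. if circ r = circ q then - (sg p * sg q * sg r) else sg r) D"
  shows "determines P \<rho> circ sg D"
proof (rule determinesI)
  fix z :: "'a \<Rightarrow> int"
  assume c: "\<And>p q. p \<in> P \<Longrightarrow> q \<in> P \<Longrightarrow> \<rho> p = \<rho> q \<Longrightarrow> z p = z q"
    and s: "\<And>i. (\<Sum>p | p \<in> P \<and> circ p = i. sg p * z p) = 0"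
    and d: "\<And>p. p \<in> D \<Longrightarrow> z p = 0"
  let ?P = "P - {p,q}"
  let ?c = "\<lambda>r. if circ r = circ q then circ p else circ r"
  let ?s = "\<lambda>r. if circ r = circ q then - (sg p * sg q * sg r) else sg r"
  have sq: "sg p * sg p = 1" "sg q * sg q = 1"
    using sg[OF pq(1)] sg[OF pq(2)] by (auto simp: abs_if split: if_splits)
  have zq: "z q = z p" using c pq by metis
  have sp: "(\<Sum>r | r \<in> ?P \<and> circ r = circ p. sg r * z r) = - (sg p * z p)"
  proof -
    have "{r. r \<in> P \<and> circ r = circ p} = insert p {r. r \<in> ?P \<and> circ r = circ p}" using pq by auto
    then show ?thesis using s[of "circ p"] fin by simp
  qed
  have sQ: "(\<Sum>r | r \<in> ?P \<and> circ r = circ q. sg r * z r) = - (sg q * z q)"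
  proof -
    have "{r. r \<in> P \<and> circ r = circ q} = insert q {r. r \<in> ?P \<and> circ r = circ q}" using pq by auto
    then show ?thesis using s[of "circ q"] fin by simp
  qed
  have merged: "(\<Sum>r | r \<in> ?P \<and> ?c r = i. ?s r * z r) = 0" for i
  proof (cases "i = circ p")
    case True
    have "{r. r \<in> ?P \<and> ?c r = i} = {r. r \<in> ?P \<and> circ r = circ p} \<union> {r. r \<in> ?P \<and> circ r = circ q}"
      using True by auto
    then have "(\<Sum>r | r \<in> ?P \<and> ?c r = i. ?s r * z r) =
        (\<Sum>r\<in>{r. r \<in> ?P \<and> circ r = circ p} \<union> {r. r \<in> ?P \<and> circ r = circ q}. ?s r * z r)"
      by (simp only:)
    also have "\<dots> =
        (\<Sum>r | r \<in> ?P \<and> circ r = circ p. ?s r * z r) + (\<Sum>r | r \<in> ?P \<and> circ r = circ q. ?s r * z r)"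
      by (rule sum.union_disjoint) (use fin pq(4) in auto)
    also have "(\<Sum>r | r \<in> ?P \<and> circ r = circ p. ?s r * z r) = - (sg p * z p)"
      unfolding sp[symmetric] using pq by (intro sum.cong) auto
    also have "(\<Sum>r | r \<in> ?P \<and> circ r = circ q. ?s r * z r) =
        - (sg p * sg q) * (\<Sum>r | r \<in> ?P \<and> circ r = circ q. sg r * z r)"
      unfolding sum_distrib_left by (intro sum.cong) auto
    also have "\<dots> = sg p * (sg q * sg q) * z q" unfolding sQ by (simp add: mult_ac)
    finally show ?thesis by (simp add: sq zq)
  next
    case False
    show ?thesis
    proof (cases "i = circ q")
      case True
      then have "{r. r \<in> ?P \<and> ?c r = i} = {}" using pq by auto
      then show ?thesis by (simp only: sum.empty)
    next
      case F2: False
      have "(\<Sum>r | r \<in> ?P \<and> ?c r = i. ?s r * z r) = (\<Sum>r | r \<in> P \<and> circ r = i. sg r * z r)"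
        using False F2 by (intro sum.cong) auto
      then show ?thesis using s by simp
    qed
  qed
  have z0: "z r = 0" if "r \<in> ?P" for r
    by (rule determinesD[OF D _ merged _ that]) (use c d in auto)
  have "(\<Sum>r | r \<in> ?P \<and> circ r = circ p. sg r * z r) = 0" using z0 by (intro sum.neutral) auto
  then have "z p = 0" using sp sq by auto
  then show "\<forall>r\<in>P. z r = 0" using z0 zq by auto
qed

text \<open>When both positions of the pair lie on the same circuit their signed contributions may cancel, so
the common value is recorded as a free parameter.\<close>

lemma determines_delete_inner_pair:
  assumes fin: "finite P" and pq: "p \<in> P" "q \<in> P" "\<rho> p = \<rho> q"
    and D: "determines (P - {p,q}) \<rho> circ sg D"
  shows "determines P \<rho> circ sg (insert p D)"
proof (rule determinesI)
  fix z :: "'a \<Rightarrow> int"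
  assume c: "\<And>p q. p \<in> P \<Longrightarrow> q \<in> P \<Longrightarrow> \<rho> p = \<rho> q \<Longrightarrow> z p = z q"
    and s: "\<And>i. (\<Sum>p | p \<in> P \<and> circ p = i. sg p * z p) = 0"
    and d: "\<And>r. r \<in> insert p D \<Longrightarrow> z r = 0"
  have zp: "z p = 0" "z q = 0" using c[OF pq] d by auto
  have "(\<Sum>r | r \<in> P - {p,q} \<and> circ r = i. sg r * z r) = (\<Sum>r | r \<in> P \<and> circ r = i. sg r * z r)" for i
    using fin zp by (intro sum.mono_neutral_left) auto
  then have s': "(\<Sum>r | r \<in> P - {p,q} \<and> circ r = i. sg r * z r) = 0" for i using s by simp
  have "z r = 0" if "r \<in> P - {p,q}" for r
    by (rule determinesD[OF D _ s' _ that]) (use c d in blast)+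
  then show "\<forall>r\<in>P. z r = 0" using zp by auto
qed

lemma obtain_representatives:
  obtains D where "D \<subseteq> P" "inj_on \<rho> D" "\<rho> ` D = \<rho> ` P"
  using subset_image_inj[of "\<rho> ` P" \<rho> P] by auto

lemma odd_sum_signs:
  assumes "finite A" "\<And>r. r \<in> A \<Longrightarrow> \<bar>sg r\<bar> = (1::int)"
  shows "odd (\<Sum>r\<in>A. sg r) \<longleftrightarrow> odd (card A)"
  using assms
proof (induction A rule: finite_induct)
  case (insert x F)
  then have "\<bar>sg x\<bar> = 1" by blast
  then have "sg x = 1 \<or> sg x = -1" by linarith
  then have "odd (sg x)" by auto
  then show ?case using insert by simp
qed simp

text \<open>Classes of size two alone would give \<open>card P div 2\<close> parameters; the point is that every circuit
but one saves a parameter when the circuits are connected through shared classes. The proof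
is by induction on the number of positions. A class of size two is deleted by one of the two
preceding lemmas. If there is none, every class has at least three elements, so there are at most
\<open>card P div 3\<close> classes, and two possibilities remain. Either all multiplicities of
classes on circuits are even, and a pair joining two circuits can be deleted because partners of
its two members keep everything paired and connected. Or some class occurs an odd number of times on some
circuit; its signed multiplicity there is odd, hence nonzero, so this constraint expresses the
value of the class through the others, which saves one parameter. One is enough because there are
at most four circuits.\<close>

lemma circuit_dimension:
  fixes \<rho> :: "'p \<Rightarrow> 'v"
  assumes fin: "finite P" and sg: "\<And>r. r \<in> P \<Longrightarrow> \<bar>sg r\<bar> = 1"
    and blk: "\<And>p. p \<in> P \<Longrightarrow> \<exists>q\<in>P. q \<noteq> p \<and> \<rho> q = \<rho> p"
    and ev: "\<And>i. even (card {p\<in>P. circ p = i})"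
    and conn: "\<And>S. \<exists>p\<in>P. circ p \<in> S \<Longrightarrow> \<exists>p\<in>P. circ p \<notin> S \<Longrightarrow>
        \<exists>p\<in>P. \<exists>q\<in>P. \<rho> p = \<rho> q \<and> circ p \<in> S \<and> circ q \<notin> S"
    and four: "card (circ ` P) \<le> 4"
  shows "\<exists>D\<subseteq>P. 2 * card D + 2 * card (circ ` P) \<le> card P + 2 \<and> determines P \<rho> circ sg D"
  using assms
proof (induction "card P" arbitrary: P circ sg rule: less_induct)
  case (less P circ sg)
  note fin = less.prems(1) and sg = less.prems(2) and blk = less.prems(3) and ev = less.prems(4)
    and conn = less.prems(5) and four = less.prems(6)
  obtain R where R: "R \<subseteq> P" "inj_on \<rho> R" "\<rho> ` R = \<rho> ` P" by (rule obtain_representatives)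
  have cardR: "card R = card (\<rho> ` P)" using R card_image by metis
  have cardP: "card P = (\<Sum>v\<in>\<rho> ` P. card {p\<in>P. \<rho> p = v})" by (rule card_fibres[OF fin])
  have ge2: "2 \<le> card {p\<in>P. \<rho> p = v}" if v: "v \<in> \<rho> ` P" for v
  proof -
    obtain p where p: "p \<in> P" "\<rho> p = v" using v by auto
    obtain q where q: "q \<in> P" "q \<noteq> p" "\<rho> q = \<rho> p" using blk[OF p(1)] by auto
    show ?thesis using p q fin by (intro card_ge_two_partner[of _ p q]) auto
  qed
  have cardP2: "2 * card R \<le> card P"
    using sum_mono[of "\<rho> ` P" "\<lambda>_. 2" "\<lambda>v. card {p\<in>P. \<rho> p = v}"] ge2 cardP cardR by simp
  have cardPc: "2 * card (circ ` P) \<le> card P"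
  proof -
    have "2 \<le> card {p\<in>P. circ p = i}" if "i \<in> circ ` P" for i
    proof -
      have "card {p\<in>P. circ p = i} \<noteq> 0" using that fin by auto
      then show ?thesis using ev[of i] by (metis One_nat_def even_plus_one_iff less_2_cases_iff not_le odd_one)
    qed
    then show ?thesis
      using sum_mono[of "circ ` P" "\<lambda>_. 2" "\<lambda>v. card {p\<in>P. circ p = v}"] card_fibres[OF fin, of circ] by simp
  qed
  have evP: "even (card P)"
    unfolding card_fibres[OF fin, of circ] using ev by (intro dvd_sum) auto
  have zR: "z p = 0" if zc: "\<And>p q. p \<in> P \<Longrightarrow> q \<in> P \<Longrightarrow> \<rho> p = \<rho> q \<Longrightarrow> z p = z q"
      and pP: "p \<in> P" and z0: "\<And>r. r \<in> R \<Longrightarrow> \<rho> r = \<rho> p \<Longrightarrow> z r = 0" for z :: "'p \<Rightarrow> int" and p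
  proof -
    obtain r where r: "r \<in> R" "\<rho> r = \<rho> p" using R(3) pP by (metis imageE imageI)
    then have "z p = z r" using zc pP R(1) by (metis subsetD)
    then show ?thesis using z0 r by simp
  qed
  show ?case
  proof (cases "card (circ ` P) \<le> 1")
    case True
    have "determines P \<rho> circ sg R" by (rule determinesI) (use zR in blast)
    then show ?thesis using True cardP2 R by (intro exI[of _ R]) auto
  next
    case c2: False
    have split: "\<exists>p\<in>P. \<exists>q\<in>P. \<rho> p = \<rho> q \<and> circ p = i \<and> circ q \<noteq> i" if i: "i \<in> circ ` P" for i
    proof -
      have "\<exists>p\<in>P. circ p \<noteq> i"
      proof (rule ccontr)
        assume "\<not> ?thesis"
        then have "circ ` P \<subseteq> {i}" by auto
        then have "card (circ ` P) \<le> 1" using card_mono[of "{i}"] by simp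
        then show False using c2 by simp
      qed
      then show ?thesis using conn[of "{i}"] i by auto
    qed
    \<comment> \<open>The step for a pair joining two circuits. The condition \<open>rem\<close> keeps the merged system
      connected: the class of the pair either vanishes or still meets one of the two circuits.\<close>
    have cross: ?thesis if pq: "p \<in> P" "q \<in> P" "\<rho> p = \<rho> q" "circ p \<noteq> circ q"
      and blk': "\<And>r. r \<in> P - {p,q} \<Longrightarrow> \<exists>r'\<in>P - {p,q}. r' \<noteq> r \<and> \<rho> r' = \<rho> r"
      and rem: "(\<forall>r\<in>P. \<rho> r = \<rho> p \<longrightarrow> r \<in> {p,q}) \<or>
                (\<exists>r\<in>P - {p,q}. \<rho> r = \<rho> p \<and> circ r \<in> {circ p, circ q})" for p q
    proof -
      let ?P = "P - {p,q}"
      let ?c = "\<lambda>r. if circ r = circ q then circ p else circ r"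
      let ?s = "\<lambda>r. if circ r = circ q then - (sg p * sg q * sg r) else sg r"
      have pne: "p \<noteq> q" using pq by auto
      have card': "card ?P = card P - 2" "card P \<ge> 2"
        using pq fin pne card_ge_two_partner[of P p q] by (auto simp: card_Diff_subset)
      obtain p' where p': "p' \<in> P" "circ p' = circ p" "p' \<noteq> p"
        using even_partner[of "{r\<in>P. circ r = circ p}" p] ev fin pq by auto
      have p'P: "p' \<in> ?P" using p' pq by auto
      have im: "?c ` ?P = circ ` P - {circ q}"
      proof (intro equalityI subsetI)
        fix i assume "i \<in> ?c ` ?P"
        then show "i \<in> circ ` P - {circ q}" using pq by auto
      next
        fix i assume i: "i \<in> circ ` P - {circ q}"
        then obtain r where r: "r \<in> P" "circ r = i" by auto
        show "i \<in> ?c ` ?P"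
        proof (cases "r = p")
          case True
          then show ?thesis using p' p'P r i by (intro image_eqI[of _ _ p']) auto
        next
          case False
          then show ?thesis using r i by (intro image_eqI[of _ _ r]) auto
        qed
      qed
      then have cim: "card (?c ` ?P) = card (circ ` P) - 1" using pq fin by simp
      have ev': "even (card {r\<in>?P. ?c r = i})" for i
      proof -
        consider "i = circ q" | "i = circ p" | "i \<noteq> circ p" "i \<noteq> circ q" by blast
        then show ?thesis
        proof cases
          case 1
          then have "{r\<in>?P. ?c r = i} = {}" using pq by auto
          then show ?thesis by (simp only: card.empty even_zero)
        next
          case 2
          then have e: "{r\<in>?P. ?c r = i} = ({r\<in>P. circ r = circ p} \<union> {r\<in>P. circ r = circ q}) - {p,q}"
            by auto
          have "card ({r\<in>P. circ r = circ p} \<union> {r\<in>P. circ r = circ q}) =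
              card {r\<in>P. circ r = circ p} + card {r\<in>P. circ r = circ q}"
            using fin pq by (intro card_Un_disjoint) auto
          moreover have "card ({r\<in>P. circ r = circ p} \<union> {r\<in>P. circ r = circ q} - {p,q}) =
              card ({r\<in>P. circ r = circ p} \<union> {r\<in>P. circ r = circ q}) - card {p,q}"
            using fin pq by (intro card_Diff_subset) auto
          ultimately show ?thesis unfolding e using ev pne by simp
        next
          case 3
          then have "{r\<in>?P. ?c r = i} = {r\<in>P. circ r = i}" by auto
          then show ?thesis using ev by simp
        qed
      qed
      have conn': "\<exists>r\<in>?P. \<exists>r'\<in>?P. \<rho> r = \<rho> r' \<and> ?c r \<in> S \<and> ?c r' \<notin> S"
        if S: "\<exists>r\<in>?P. ?c r \<in> S" "\<exists>r\<in>?P. ?c r \<notin> S" for S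
      proof -
        define T where "T = {i. (if i = circ q then circ p else i) \<in> S}"
        have cT: "circ r \<in> T \<longleftrightarrow> ?c r \<in> S" for r by (auto simp: T_def)
        obtain r r' where r: "r \<in> P" "r' \<in> P" "\<rho> r = \<rho> r'" "circ r \<in> T" "circ r' \<notin> T"
          using conn[of T] S unfolding cT by auto
        have pqT: "circ p \<in> T \<longleftrightarrow> circ q \<in> T" by (auto simp: T_def)
        show ?thesis
        proof (cases "r \<in> {p,q} \<or> r' \<in> {p,q}")
          case False
          then have "r \<in> ?P" "r' \<in> ?P" using r by auto
          moreover have "?c r \<in> S" "?c r' \<notin> S" using r(4,5) cT by blast+
          ultimately show ?thesis using r(3) by blast
        next
          case True
          have nb: "\<not> (\<forall>r\<in>P. \<rho> r = \<rho> p \<longrightarrow> r \<in> {p,q})"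
            using True r pq pqT by (metis insert_iff singletonD)
          then obtain t where t: "t \<in> ?P" "\<rho> t = \<rho> p" "circ t \<in> {circ p, circ q}" using rem by blast
          have tT: "circ t \<in> T \<longleftrightarrow> circ p \<in> T" using t pqT by auto
          show ?thesis
          proof (cases "r \<in> {p,q}")
            case True
            then have "r' \<in> ?P" "\<rho> t = \<rho> r'" "circ t \<in> T" using r pqT tT t pq by auto
            moreover from this have "?c t \<in> S" "?c r' \<notin> S" using r(5) cT by blast+
            ultimately show ?thesis using t(1) by blast
          next
            case False
            then have "r' \<in> {p,q}" using True by blast
            then have "r \<in> ?P" "\<rho> t = \<rho> r" "circ t \<notin> T" using r pqT tT t pq False by auto
            moreover from this have "?c r \<in> S" "?c t \<notin> S" using r(4) cT by blast+
            ultimately show ?thesis using t(1) by metis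
          qed
        qed
      qed
      have sg': "\<bar>?s r\<bar> = 1" if "r \<in> ?P" for r using sg pq that by (auto simp: abs_mult)
      have "\<exists>D\<subseteq>?P. 2 * card D + 2 * card (?c ` ?P) \<le> card ?P + 2 \<and> determines ?P \<rho> ?c ?s D"
        using card' four cim by (intro less.hyps fin sg' blk' ev' conn') (auto simp: fin)
      then obtain D where D: "D \<subseteq> ?P" "2 * card D + 2 * card (?c ` ?P) \<le> card ?P + 2"
          "determines ?P \<rho> ?c ?s D" by blast
      have "determines P \<rho> circ sg D"
        by (rule determines_delete_cross_pair[OF fin sg pq D(3)])
      then show ?thesis using D card' cim c2 by (intro exI[of _ D]) auto
    qed
    show ?thesis
    proof (cases "\<exists>p\<in>P. \<exists>q\<in>P. p \<noteq> q \<and> {r\<in>P. \<rho> r = \<rho> p} = {p,q}")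
      case True
      then obtain p q where pq: "p \<in> P" "q \<in> P" "p \<noteq> q" and b: "{r\<in>P. \<rho> r = \<rho> p} = {p,q}" by blast
      have rq: "\<rho> p = \<rho> q" using b by (metis (mono_tags, lifting) insertI1 insert_commute mem_Collect_eq)
      have b': "r \<in> {p,q}" if "r \<in> P" "\<rho> r = \<rho> p" for r using b that by blast
      have blk': "\<exists>r'\<in>P - {p,q}. r' \<noteq> r \<and> \<rho> r' = \<rho> r" if r: "r \<in> P - {p,q}" for r
      proof -
        obtain r' where r': "r' \<in> P" "r' \<noteq> r" "\<rho> r' = \<rho> r" using blk r by blast
        moreover have "r' \<notin> {p,q}" using r(1) r'(3) rq b'[of r] by auto
        ultimately show ?thesis by blast
      qed
      show ?thesis
      proof (cases "circ p = circ q")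
        case False
        show ?thesis using cross[OF pq(1,2) rq False blk'] b' by blast
      next
        case same: True
        let ?P = "P - {p,q}"
        have card': "card ?P = card P - 2" "card P \<ge> 2"
          using pq fin card_ge_two_partner[of P p q] by (auto simp: card_Diff_subset)
        have cr: "r \<in> ?P" "r' \<in> ?P" if "r \<in> P" "r' \<in> P" "\<rho> r = \<rho> r'" "circ r \<noteq> circ r'" for r r'
        proof -
          have "r \<notin> {p,q}" "r' \<notin> {p,q}"
          proof -
            show "r \<notin> {p,q}"
            proof
              assume a: "r \<in> {p,q}"
              then have "\<rho> r = \<rho> p" using rq by (metis insertE singletonD)
              then have "r' \<in> {p,q}" using b'[of r'] that(2,3) by simp
              then show False using a same that(4) by (metis insertE singletonD)
            qed
            show "r' \<notin> {p,q}"
            proof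
              assume a: "r' \<in> {p,q}"
              then have "\<rho> r' = \<rho> p" using rq by (metis insertE singletonD)
              then have "r \<in> {p,q}" using b'[of r] that(1,3) by simp
              then show False using a same that(4) by (metis insertE singletonD)
            qed
          qed
          then show "r \<in> ?P" "r' \<in> ?P" using that by auto
        qed
        have "circ p \<in> circ ` P" using pq by blast
        from split[OF this] obtain p' r' where "p' \<in> P" "r' \<in> P" "\<rho> p' = \<rho> r'" "circ p' = circ p" "circ r' \<noteq> circ p"
          by blast
        then have p': "p' \<in> ?P" "circ p' = circ p" using cr(1)[of p' r'] by auto
        have im: "circ ` ?P = circ ` P"
        proof -
          have "circ p \<in> circ ` ?P" using p' by (metis imageI)
          have "circ r \<in> insert (circ p) (circ ` ?P)" if "r \<in> P" for r
          proof (cases "r \<in> {p,q}")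
            case True
            then have "circ r = circ p" using same by (metis insertE singletonD)
            then show ?thesis by blast
          next
            case False
            then show ?thesis using that by blast
          qed
          then have "circ ` P \<subseteq> insert (circ p) (circ ` ?P)" by (rule image_subsetI)
          moreover have "circ ` ?P \<subseteq> circ ` P" by (rule image_mono) (rule Diff_subset)
          ultimately show ?thesis using \<open>circ p \<in> circ ` ?P\<close> by (simp only: insert_absorb subset_antisym)
        qed
        have ev': "even (card {r\<in>?P. circ r = i})" for i
        proof (cases "i = circ p")
          case True
          then have e: "{r\<in>?P. circ r = i} = {r\<in>P. circ r = circ p} - {p,q}" by auto
          have "card ({r\<in>P. circ r = circ p} - {p,q}) = card {r\<in>P. circ r = circ p} - card {p,q}"
            using fin pq same by (intro card_Diff_subset) auto
          then show ?thesis unfolding e using ev pq by simp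
        next
          case False
          then have "{r\<in>?P. circ r = i} = {r\<in>P. circ r = i}" using same by auto
          then show ?thesis using ev by simp
        qed
        have conn': "\<exists>r\<in>?P. \<exists>r'\<in>?P. \<rho> r = \<rho> r' \<and> circ r \<in> S \<and> circ r' \<notin> S"
          if "\<exists>r\<in>?P. circ r \<in> S" "\<exists>r\<in>?P. circ r \<notin> S" for S
        proof -
          have "\<exists>r\<in>P. circ r \<in> S" "\<exists>r\<in>P. circ r \<notin> S" using that by auto
          from conn[OF this] obtain r r' where r: "r \<in> P" "r' \<in> P" "\<rho> r = \<rho> r'" "circ r \<in> S" "circ r' \<notin> S"
            by blast
          have "circ r \<noteq> circ r'" using r by auto
          then show ?thesis using cr[OF r(1-3)] r by blast
        qed
        have "\<exists>D\<subseteq>?P. 2 * card D + 2 * card (circ ` ?P) \<le> card ?P + 2 \<and> determines ?P \<rho> circ sg D"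
          using card' four im sg by (intro less.hyps blk' ev' conn') (auto simp: fin)
        then obtain D where D: "D \<subseteq> ?P" "2 * card D + 2 * card (circ ` ?P) \<le> card ?P + 2"
            "determines ?P \<rho> circ sg D" by blast
        have "determines P \<rho> circ sg (insert p D)"
          by (rule determines_delete_inner_pair[OF fin pq(1,2) rq D(3)])
        moreover have "card (insert p D) \<le> Suc (card D)" by (simp add: card_insert_le_m1)
        ultimately show ?thesis using D card' im pq by (intro exI[of _ "insert p D"]) auto
      qed
    next
      case no2: False
      have ge3: "3 \<le> card {p\<in>P. \<rho> p = v}" if v: "v \<in> \<rho> ` P" for v
      proof (rule ccontr)
        assume "\<not> ?thesis"
        then have "card {p\<in>P. \<rho> p = v} = 2" using ge2[OF v] by simp
        then obtain p q where "p \<noteq> q" and e: "{p\<in>P. \<rho> p = v} = {p,q}" by (metis card_2_iff)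
        moreover from e have "p \<in> P" "\<rho> p = v" "q \<in> P" by blast+
        ultimately show False using no2 by blast
      qed
      have cardP3: "3 * card R \<le> card P"
        using sum_mono[of "\<rho> ` P" "\<lambda>_. 3" "\<lambda>v. card {p\<in>P. \<rho> p = v}"] ge3 cardP cardR by simp
      show ?thesis
      proof (cases "\<exists>v i. odd (card {r\<in>P. \<rho> r = v \<and> circ r = i})")
        case True
        then obtain v i where vi: "odd (card {r\<in>P. \<rho> r = v \<and> circ r = i})" by blast
        let ?A = "{r\<in>P. \<rho> r = v \<and> circ r = i}"
        have "?A \<noteq> {}" using vi by (metis card.empty even_zero)
        then have "v \<in> \<rho> ` P" by blast
        then obtain r0 where r0: "r0 \<in> R" "\<rho> r0 = v" using R(3) by (metis imageE)
        have "determines P \<rho> circ sg (R - {r0})"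
        proof (rule determinesI)
          fix z :: "'p \<Rightarrow> int"
          assume c: "\<And>p q. p \<in> P \<Longrightarrow> q \<in> P \<Longrightarrow> \<rho> p = \<rho> q \<Longrightarrow> z p = z q"
            and s: "\<And>i. (\<Sum>p | p \<in> P \<and> circ p = i. sg p * z p) = 0"
            and d: "\<And>p. p \<in> R - {r0} \<Longrightarrow> z p = 0"
          have o: "z p = 0" if "p \<in> P" "\<rho> p \<noteq> v" for p
          proof (rule zR[OF c])
            show "z r = 0" if "r \<in> R" "\<rho> r = \<rho> p" for r
            proof -
              have "r \<noteq> r0" using r0(2) \<open>\<rho> r = \<rho> p\<close> \<open>\<rho> p \<noteq> v\<close> by metis
              then show ?thesis using d \<open>r \<in> R\<close> by simp
            qed
          qed (use that in auto)
          have "(\<Sum>p | p \<in> P \<and> circ p = i. sg p * z p) = (\<Sum>p\<in>?A. sg p * z p)"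
            using fin o by (intro sum.mono_neutral_right) auto
          also have "\<dots> = (\<Sum>p\<in>?A. sg p) * z r0"
            unfolding sum_distrib_right using c r0 R by (intro sum.cong) auto
          finally have "(\<Sum>p\<in>?A. sg p) * z r0 = 0" using s by simp
          moreover have "(\<Sum>p\<in>?A. sg p) \<noteq> 0"
            using odd_sum_signs[of ?A sg] fin sg vi by fastforce
          ultimately have "z r0 = 0" by simp
          then show "\<forall>p\<in>P. z p = 0" using o c r0 R by (metis subsetD)
        qed
        moreover have "card (R - {r0}) = card R - 1" "card R \<ge> 1"
          using r0 R fin by (auto simp: Suc_le_eq card_gt_0_iff intro: finite_subset)
        \<comment> \<open>With \<open>c\<close> circuits this follows from \<open>3 * card R \<le> card P\<close>, \<open>2 * c \<le> card P\<close> and \<open>c \<le> 4\<close>;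
          it fails for \<open>c = 5\<close>, \<open>card P = 10\<close>, \<open>card R = 3\<close>.\<close>
        moreover have "2 * (card R - 1) + 2 * card (circ ` P) \<le> card P + 2"
          using cardP3 cardPc evP four c2 \<open>card R \<ge> 1\<close> by presburger
        ultimately show ?thesis using R by (intro exI[of _ "R - {r0}"]) auto
      next
        case False
        then have even_mult: "even (card {r\<in>P. \<rho> r = v \<and> circ r = i})" for v i by blast
        have partner: "\<exists>r'\<in>P. r' \<noteq> r \<and> \<rho> r' = \<rho> r \<and> circ r' = circ r" if "r \<in> P" for r
          using even_partner[OF _ even_mult, of "\<rho> r" "circ r" r] fin that by auto
        obtain i where "i \<in> circ ` P" using c2 by (metis all_not_in_conv card.empty zero_le)
        then obtain p q where pq: "p \<in> P" "q \<in> P" "\<rho> p = \<rho> q" "circ p \<noteq> circ q" using split by metis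
        obtain p' where p': "p' \<in> P" "p' \<noteq> p" "\<rho> p' = \<rho> p" "circ p' = circ p" using partner pq by metis
        obtain q' where q': "q' \<in> P" "q' \<noteq> q" "\<rho> q' = \<rho> q" "circ q' = circ q" using partner pq by metis
        have P': "p' \<in> P - {p,q}" "q' \<in> P - {p,q}" "p' \<noteq> q'" using p' q' pq by auto
        have blk': "\<exists>r'\<in>P - {p,q}. r' \<noteq> r \<and> \<rho> r' = \<rho> r" if r: "r \<in> P - {p,q}" for r
        proof (cases "\<rho> r = \<rho> p")
          case True
          then show ?thesis using P' p' q' pq by metis
        next
          case False
          obtain r' where r': "r' \<in> P" "r' \<noteq> r" "\<rho> r' = \<rho> r" using blk r by blast
          then show ?thesis using False pq by (intro bexI[of _ r']) auto
        qed
        show ?thesis using cross[OF pq blk'] P' p' by blast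
      qed
    qed
  qed
qed

lemma card_determined_solutions_le:
  fixes I :: "int set"
  assumes "finite P" "finite I" and DP: "D \<subseteq> P" and D: "determines P \<rho> circ sg D"
  shows "card {u \<in> P \<rightarrow>\<^sub>E I. (\<forall>p\<in>P. \<forall>q\<in>P. u p = u q \<longleftrightarrow> \<rho> p = \<rho> q) \<and>
            (\<forall>i. (\<Sum>p | p \<in> P \<and> circ p = i. sg p * u p) = 0)} \<le> card I ^ card D"
    (is "card ?G \<le> _")
proof -
  have "inj_on (\<lambda>u. restrict u D) ?G"
  proof (rule inj_onI)
    fix u u' assume u: "u \<in> ?G" "u' \<in> ?G" and eq: "restrict u D = restrict u' D"
    have "u p - u' p = 0" if p: "p \<in> P" for p
    proof (rule determinesD[OF D _ _ _ p])
      show "u p - u' p = u q - u' q" if "p \<in> P" "q \<in> P" "\<rho> p = \<rho> q" for p q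
      proof -
        have "u p = u q" "u' p = u' q" using u that by blast+
        then show ?thesis by simp
      qed
      show "(\<Sum>p | p \<in> P \<and> circ p = i. sg p * (u p - u' p)) = 0" for i
        using u by (simp add: right_diff_distrib sum_subtractf)
      show "u p - u' p = 0" if "p \<in> D" for p
        using fun_cong[OF eq, of p] that by simp
    qed
    then show "u = u'" using u by (intro PiE_ext[of u P "\<lambda>_. I" u']) auto
  qed
  moreover have "(\<lambda>u. restrict u D) ` ?G \<subseteq> D \<rightarrow>\<^sub>E I"
    by (rule image_subsetI, rule restrict_PiE_iff[THEN iffD2]) (use DP in blast)
  ultimately have "card ?G \<le> card (D \<rightarrow>\<^sub>E I)"
    using assms by (intro card_inj_on_le finite_PiE) (auto intro: finite_subset)
  then show ?thesis using assms by (simp add: card_PiE finite_subset)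
qed

text \<open>The assignments are split according to their coincidence pattern, of which there are at most
\<open>2 ^ (card P * card P)\<close>. Within one pattern \<open>circuit_dimension\<close> leaves at most
\<open>card P div 2 - c\<close> free parameters.\<close>

lemma card_connected_solutions_le:
  fixes I :: "int set" and circ :: "'p \<Rightarrow> nat" and sg :: "'p \<Rightarrow> int"
  assumes fin: "finite P" "finite I" and sg: "\<And>r. r \<in> P \<Longrightarrow> \<bar>sg r\<bar> = 1"
    and ev: "\<And>i. even (card {p\<in>P. circ p = i})" and four: "card (circ ` P) = Suc c" "c \<le> 3"
  shows "card {u \<in> P \<rightarrow>\<^sub>E I. (\<forall>i. (\<Sum>p | p \<in> P \<and> circ p = i. sg p * u p) = 0) \<and>
            (\<forall>p\<in>P. \<exists>q\<in>P. q \<noteq> p \<and> u q = u p) \<and>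
            (\<forall>S. (\<exists>p\<in>P. circ p \<in> S) \<longrightarrow> (\<exists>p\<in>P. circ p \<notin> S) \<longrightarrow>
               (\<exists>p\<in>P. \<exists>q\<in>P. u p = u q \<and> circ p \<in> S \<and> circ q \<notin> S))} * card I ^ c
          \<le> 2 ^ (card P * card P) * card I ^ (card P div 2)"
    (is "card ?G * _ \<le> _")
proof -
  define ker where "ker u = {(p,q). p \<in> P \<and> q \<in> P \<and> u p = u q}" for u :: "'p \<Rightarrow> int"
  have finG: "finite ?G" using fin by (simp add: finite_PiE)
  have "?G = (\<Union>K\<in>Pow (P \<times> P). {u\<in>?G. ker u = K})" by (auto simp: ker_def)
  moreover have "card (\<Union>K\<in>Pow (P \<times> P). {u\<in>?G. ker u = K}) \<le> (\<Sum>K\<in>Pow (P \<times> P). card {u\<in>?G. ker u = K})"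
    using fin by (intro card_UN_le) auto
  ultimately have 1: "card ?G \<le> (\<Sum>K\<in>Pow (P \<times> P). card {u\<in>?G. ker u = K})" by (simp only:)
  have 2: "card {u\<in>?G. ker u = K} * card I ^ c \<le> card I ^ (card P div 2)" for K
  proof (cases "{u\<in>?G. ker u = K} = {}")
    case True
    then show ?thesis by (simp only: card.empty)
  next
    case False
    then obtain u0 where u0: "u0 \<in> ?G" and k0: "ker u0 = K" by blast
    have "\<exists>D\<subseteq>P. 2 * card D + 2 * card (circ ` P) \<le> card P + 2 \<and> determines P u0 circ sg D"
    proof (rule circuit_dimension[OF fin(1) sg _ ev])
      show "\<exists>q\<in>P. q \<noteq> p \<and> u0 q = u0 p" if "p \<in> P" for p using u0 that by blast
      show "\<exists>p\<in>P. \<exists>q\<in>P. u0 p = u0 q \<and> circ p \<in> S \<and> circ q \<notin> S"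
        if "\<exists>p\<in>P. circ p \<in> S" "\<exists>p\<in>P. circ p \<notin> S" for S using u0 that by blast
      show "card (circ ` P) \<le> 4" using four by simp
    qed
    then obtain D where D: "D \<subseteq> P" "2 * card D + 2 * card (circ ` P) \<le> card P + 2"
      "determines P u0 circ sg D" by blast
    have ker_eq: "u p = u q \<longleftrightarrow> u0 p = u0 q" if "ker u = K" "p \<in> P" "q \<in> P" for u p q
    proof -
      have "(p,q) \<in> ker u \<longleftrightarrow> (p,q) \<in> ker u0" using that k0 by simp
      then show ?thesis using that by (simp add: ker_def)
    qed
    have "{u\<in>?G. ker u = K} \<subseteq> {u \<in> P \<rightarrow>\<^sub>E I. (\<forall>p\<in>P. \<forall>q\<in>P. u p = u q \<longleftrightarrow> u0 p = u0 q) \<and>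
            (\<forall>i. (\<Sum>p | p \<in> P \<and> circ p = i. sg p * u p) = 0)}"
      using ker_eq by blast
    then have "card {u\<in>?G. ker u = K} \<le> card {u \<in> P \<rightarrow>\<^sub>E I. (\<forall>p\<in>P. \<forall>q\<in>P. u p = u q \<longleftrightarrow> u0 p = u0 q) \<and>
            (\<forall>i. (\<Sum>p | p \<in> P \<and> circ p = i. sg p * u p) = 0)}"
      using fin by (intro card_mono) (auto intro: finite_subset[of _ "P \<rightarrow>\<^sub>E I"] finite_PiE)
    also have "\<dots> \<le> card I ^ card D" by (rule card_determined_solutions_le[OF fin D(1,3)])
    finally have "card {u\<in>?G. ker u = K} * card I ^ c \<le> card I ^ card D * card I ^ c" by simp
    also have "\<dots> = card I ^ (card D + c)" by (simp add: power_add)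
    also have "\<dots> \<le> card I ^ (card P div 2)"
    proof (cases "card I = 0")
      case True
      then have "I = {}" using fin by simp
      have "P \<noteq> {}" using four by auto
      then have "P \<rightarrow>\<^sub>E I = {}" using \<open>I = {}\<close> by (auto simp: PiE_eq_empty_iff)
      then show ?thesis using u0 by blast
    next
      case False
      have "card D + c \<le> card P div 2" using D(2) four by linarith
      then show ?thesis using False by (intro power_increasing) auto
    qed
    finally show ?thesis .
  qed
  have "card ?G * card I ^ c \<le> (\<Sum>K\<in>Pow (P \<times> P). card {u\<in>?G. ker u = K} * card I ^ c)"
    using mult_right_mono[OF 1, of "card I ^ c"] by (simp add: sum_distrib_right)
  also have "\<dots> \<le> (\<Sum>K\<in>Pow (P \<times> P). card I ^ (card P div 2))" by (intro sum_mono 2)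
  also have "\<dots> = 2 ^ (card P * card P) * card I ^ (card P div 2)"
    using fin by (simp add: card_Pow card_cartesian_product)
  finally show ?thesis .
qed

section \<open>Monomials in independent entries\<close>

text \<open>A word lists the factors of a monomial in the entries: an index, and a flag telling
whether the entry is conjugated. Letters coming from an adjoint factor \<open>T\<^sub>n\<^sup>*\<close> are conjugated.\<close>

type_synonym word = "(int \<times> bool) list"

definition letter :: "(int \<Rightarrow> complex) \<Rightarrow> int \<times> bool \<Rightarrow> complex" where
  "letter c x = (if snd x then cnj (c (fst x)) else c (fst x))"

definition monom_of :: "(int \<Rightarrow> complex) \<Rightarrow> word \<Rightarrow> complex" where
  "monom_of c u = (\<Prod>x\<leftarrow>u. letter c x)"

abbreviation idx :: "word \<Rightarrow> int set" where "idx u \<equiv> fst ` set u"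

definition conj_word :: "word \<Rightarrow> word" where
  "conj_word u = map (\<lambda>x. (fst x, \<not> snd x)) u"

lemma monom_of_Nil [simp]: "monom_of c [] = 1" by (simp add: monom_of_def)

lemma monom_of_Cons [simp]: "monom_of c (x # u) = letter c x * monom_of c u"
  by (simp add: monom_of_def)

lemma monom_of_append [simp]: "monom_of c (u @ v) = monom_of c u * monom_of c v"
  by (simp add: monom_of_def)

lemma norm_letter [simp]: "norm (letter c x) = norm (c (fst x))" by (simp add: letter_def)

lemma conj_word_simps [simp]:
  "length (conj_word u) = length u" "idx (conj_word u) = idx u"
  by (auto simp: conj_word_def image_image)

lemma filter_conj_word: "filter (\<lambda>x. P (fst x)) (conj_word u) = conj_word (filter (\<lambda>x. P (fst x)) u)"
  by (simp add: conj_word_def filter_map o_def)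

lemma monom_of_conj_word: "monom_of c (conj_word u) = cnj (monom_of c u)"
  by (induction u) (auto simp: conj_word_def letter_def)

lemma monom_of_mset_cong:
  assumes "mset u = mset v"
  shows "monom_of c u = monom_of c v"
  unfolding monom_of_def prod_mset_prod_list[symmetric] mset_map using assms by simp

lemma monom_of_cong:
  assumes "\<And>j. j \<in> idx u \<Longrightarrow> c j = c' j"
  shows "monom_of c u = monom_of c' u"
  using assms by (induction u) (auto simp: letter_def)

lemma norm_monom_of: "norm (monom_of c u) = (\<Prod>x\<leftarrow>u. norm (c (fst x)))"
  by (induction u) (auto simp: norm_mult)

text \<open>The product is at most the largest factor to the power \<open>length u\<close>. This crude bound turns uniform
bounds for the moments of single entries into bounds for all monomials; the summand \<open>1\<close>
takes care of the empty word.\<close>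

lemma norm_monom_of_le:
  "norm (monom_of c u) \<le> 1 + (\<Sum>x\<leftarrow>u. norm (c (fst x)) ^ length u)"
proof (cases "u = []")
  case False
  define m where "m = Max ((\<lambda>x. norm (c (fst x))) ` set u)"
  have le: "norm (c (fst x)) \<le> m" if "x \<in> set u" for x using that by (simp add: m_def)
  have "m \<in> (\<lambda>x. norm (c (fst x))) ` set u" unfolding m_def using False by (intro Max_in) auto
  then obtain y where y: "y \<in> set u" "m = norm (c (fst y))" by auto
  have m0: "m \<ge> 0" using y by simp
  have "(\<Prod>x\<leftarrow>v. norm (c (fst x))) \<le> m ^ length v" if "set v \<subseteq> set u" for v
    using that by (induction v) (auto intro!: mult_mono le prod_list_nonneg m0)
  then have "norm (monom_of c u) \<le> m ^ length u" by (simp add: norm_monom_of)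
  also have "m ^ length u \<le> (\<Sum>x\<leftarrow>u. norm (c (fst x)) ^ length u)"
    unfolding y(2) using y(1) by (intro member_le_sum_list) auto
  finally show ?thesis by simp
qed simp

lemma measurable_cnj: "f \<in> borel_measurable N \<Longrightarrow> (\<lambda>x. cnj (f x)) \<in> borel_measurable N"
  by (rule measurable_compose[OF _ borel_measurable_continuous_onI]) (auto intro!: continuous_intros)

lemma measurable_letter:
  assumes "(\<lambda>x. f x (fst y)) \<in> borel_measurable N"
  shows "(\<lambda>x. letter (f x) y) \<in> borel_measurable N"
  using assms by (cases "snd y") (auto simp: letter_def intro: measurable_cnj)

lemma norm_power4: "complex_of_real (norm z ^ 4) = z * z * cnj z * cnj z"
proof -
  have "complex_of_real (norm z ^ 4) = (complex_of_real ((norm z)\<^sup>2))\<^sup>2" by (simp flip: power_mult)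
  also have "\<dots> = (z * cnj z)\<^sup>2" by (simp only: complex_norm_square)
  finally show ?thesis by (simp add: power2_eq_square mult_ac)
qed

text \<open>The real and the complex case differ only in \<open>\<tau> = E a\<^sub>j\<^sup>2\<close>, which is \<open>1\<close> and \<open>0\<close> respectively. Second
and fourth absolute moments that do not depend on \<open>j\<close>, together with \<open>\<tau>\<close>, suffice for the limit of
the variance; all other moments enter through the bounds \<open>CM\<close> only.\<close>

locale toeplitz_input = prob_space M for M :: "'a measure" +
  fixes a :: "int \<Rightarrow> 'a \<Rightarrow> complex" and \<kappa> \<tau> :: real and CM :: "nat \<Rightarrow> real"
  assumes indep: "indep_vars (\<lambda>_. borel) a UNIV"
    and mean_zero: "expectation (a j) = 0"
    and abs_square: "expectation (\<lambda>\<omega>. (cmod (a j \<omega>))\<^sup>2) = 1"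
    and square: "expectation (\<lambda>\<omega>. (a j \<omega>)\<^sup>2) = of_real \<tau>"
    and abs_fourth: "expectation (\<lambda>\<omega>. cmod (a j \<omega>) ^ 4) = \<kappa>"
    and integrable_abs: "integrable M (\<lambda>\<omega>. cmod (a j \<omega>) ^ k)"
    and moment_bound: "expectation (\<lambda>\<omega>. cmod (a j \<omega>) ^ k) \<le> CM k"
begin

definition A :: "word \<Rightarrow> 'a \<Rightarrow> complex" where
  "A u \<omega> = monom_of (\<lambda>j. a j \<omega>) u"

definition em :: "word \<Rightarrow> complex" where
  "em u = expectation (A u)"

lemma A_append: "A (u @ v) \<omega> = A u \<omega> * A v \<omega>" by (simp add: A_def)

lemma A_conj: "A (conj_word u) \<omega> = cnj (A u \<omega>)" by (simp add: A_def monom_of_conj_word)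

lemma measurable_a [measurable]: "a j \<in> borel_measurable M"
  using indep by (auto simp: indep_vars_def)

lemma measurable_A [measurable]: "A u \<in> borel_measurable M"
proof -
  have "(\<lambda>\<omega>. monom_of (\<lambda>j. a j \<omega>) u) \<in> borel_measurable M"
    by (induction u) (auto intro!: borel_measurable_times measurable_letter)
  then show ?thesis by (simp add: A_def[abs_def])
qed

lemma CM_nonneg: "CM k \<ge> 0"
  by (rule order_trans[OF _ moment_bound[of undefined k]]) (simp add: integral_nonneg_AE)

lemma A_dominated: "integrable M (\<lambda>\<omega>. 1 + (\<Sum>x\<leftarrow>u. cmod (a (fst x) \<omega>) ^ k))"
  "expectation (\<lambda>\<omega>. 1 + (\<Sum>x\<leftarrow>u. cmod (a (fst x) \<omega>) ^ k)) \<le> 1 + length u * CM k"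
proof -
  have "integrable M (\<lambda>\<omega>. \<Sum>x\<leftarrow>u. cmod (a (fst x) \<omega>) ^ k) \<and>
    expectation (\<lambda>\<omega>. \<Sum>x\<leftarrow>u. cmod (a (fst x) \<omega>) ^ k) \<le> length u * CM k"
  proof (induction u)
    case (Cons y u)
    then show ?case using moment_bound[of "fst y" k] integrable_abs[of "fst y" k]
      by (auto simp: algebra_simps)
  qed simp
  then show "integrable M (\<lambda>\<omega>. 1 + (\<Sum>x\<leftarrow>u. cmod (a (fst x) \<omega>) ^ k))"
    "expectation (\<lambda>\<omega>. 1 + (\<Sum>x\<leftarrow>u. cmod (a (fst x) \<omega>) ^ k)) \<le> 1 + length u * CM k"
    by (auto simp: prob_space)
qed

lemma integrable_A [simp]: "integrable M (A u)"
proof (rule Bochner_Integration.integrable_bound[OF A_dominated(1)[where u=u and k="length u"]])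
  show "AE \<omega> in M. norm (A u \<omega>) \<le> norm (1 + (\<Sum>x\<leftarrow>u. cmod (a (fst x) \<omega>) ^ length u))"
    unfolding A_def real_norm_def by (intro AE_I2 order_trans[OF norm_monom_of_le abs_ge_self])
qed simp

text \<open>A bound for the mean modulus of every monomial of length at most \<open>N\<close>; summing makes it monotone in
\<open>N\<close> and at least \<open>1\<close>, so that powers of it can be compared.\<close>

definition KM :: "nat \<Rightarrow> real" where "KM N = (\<Sum>i\<le>N. 1 + i * CM i)"

lemma KM_bound: "N \<le> N' \<Longrightarrow> 1 + N * CM N \<le> KM N'"
  unfolding KM_def using CM_nonneg by (intro member_le_sum[of N "{..N'}" "\<lambda>i. 1 + real i * CM i"]) auto

lemma KM_ge_1: "KM N \<ge> 1" using KM_bound[of 0 N] by simp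

lemma norm_expectation_A_le:
  assumes "length u \<le> N"
  shows "expectation (\<lambda>\<omega>. norm (A u \<omega>)) \<le> KM N"
proof -
  have "expectation (\<lambda>\<omega>. norm (A u \<omega>)) \<le> expectation (\<lambda>\<omega>. 1 + (\<Sum>x\<leftarrow>u. cmod (a (fst x) \<omega>) ^ length u))"
    using norm_monom_of_le[of "\<lambda>j. a j \<omega>" u for \<omega>]
    by (intro integral_mono integrable_norm integrable_A A_dominated(1)) (simp add: A_def)
  also have "\<dots> \<le> 1 + length u * CM (length u)" by (rule A_dominated(2))
  also have "\<dots> \<le> KM N" by (rule KM_bound[OF assms])
  finally show ?thesis .
qed

lemma norm_em_le: "length u \<le> N \<Longrightarrow> norm (em u) \<le> KM N"
  unfolding em_def by (rule order_trans[OF integral_norm_bound norm_expectation_A_le])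

lemma em_conj: "em (conj_word u) = cnj (em u)"
  unfolding em_def by (simp add: A_conj[abs_def])

lemma em_mset_cong: "mset u = mset v \<Longrightarrow> em u = em v"
  unfolding em_def A_def[abs_def] using monom_of_mset_cong by metis

lemma measurable_monom_of:
  assumes "idx u \<subseteq> J"
  shows "(\<lambda>c. monom_of c u) \<in> borel_measurable (Pi\<^sub>M J (\<lambda>_. borel))"
  using assms
proof (induction u)
  case (Cons x u)
  have [measurable]: "(\<lambda>c. c (fst x)) \<in> borel_measurable (Pi\<^sub>M J (\<lambda>_. borel))"
    using Cons.prems by (intro measurable_component_singleton) auto
  show ?case using Cons by (auto intro!: borel_measurable_times measurable_letter)
qed simp

text \<open>Independence in the form in which it is used throughout: a monomial factors out of the expectation
as soon as the other factor is a function of the entries with indices outside the monomial.\<close>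

lemma expectation_A_mult_indep:
  assumes G: "G \<in> borel_measurable (Pi\<^sub>M J (\<lambda>_. borel))" and J: "idx u \<inter> J = {}"
    and Y: "\<And>\<omega>. Y \<omega> = G (restrict (\<lambda>j. a j \<omega>) J)" and int: "integrable M Y"
  shows "expectation (\<lambda>\<omega>. A u \<omega> * Y \<omega>) = em u * expectation Y"
    and "integrable M (\<lambda>\<omega>. A u \<omega> * Y \<omega>)"
proof -
  have iv: "indep_var (Pi\<^sub>M (idx u) (\<lambda>_. borel)) (\<lambda>\<omega>. restrict (\<lambda>i. a i \<omega>) (idx u))
      (Pi\<^sub>M J (\<lambda>_. borel)) (\<lambda>\<omega>. restrict (\<lambda>i. a i \<omega>) J)"
    using indep J by (intro indep_var_restrict) auto
  have "indep_var borel ((\<lambda>c. monom_of c u) \<circ> (\<lambda>\<omega>. restrict (\<lambda>i. a i \<omega>) (idx u)))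
      borel (G \<circ> (\<lambda>\<omega>. restrict (\<lambda>i. a i \<omega>) J))"
    by (rule indep_var_compose[OF iv measurable_monom_of G]) simp
  moreover have "(\<lambda>c. monom_of c u) \<circ> (\<lambda>\<omega>. restrict (\<lambda>i. a i \<omega>) (idx u)) = A u"
    unfolding A_def[abs_def] o_def by (intro ext monom_of_cong) (simp only: restrict_apply if_True)
  moreover have "G \<circ> (\<lambda>\<omega>. restrict (\<lambda>i. a i \<omega>) J) = Y" using Y by (auto simp: fun_eq_iff)
  ultimately have "indep_var borel (A u) borel Y" by simp
  then show "expectation (\<lambda>\<omega>. A u \<omega> * Y \<omega>) = em u * expectation Y"
    "integrable M (\<lambda>\<omega>. A u \<omega> * Y \<omega>)"
    using int by (auto simp: em_def intro!: indep_var_lebesgue_integral indep_var_integrable)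
qed

lemma em_append_disjoint:
  assumes "idx u \<inter> idx v = {}"
  shows "em (u @ v) = em u * em v"
proof -
  have "expectation (\<lambda>\<omega>. A u \<omega> * A v \<omega>) = em u * expectation (A v)"
    by (rule expectation_A_mult_indep(1)[OF measurable_monom_of[OF order_refl] assms])
       (simp_all add: A_def cong: monom_of_cong flip: A_def)
  then show ?thesis by (simp add: em_def A_append[abs_def])
qed

lemma em_Nil [simp]: "em [] = 1" by (simp add: em_def A_def[abs_def] prob_space)

lemma em_singleton [simp]: "em [x] = 0"
  unfolding em_def A_def[abs_def] using mean_zero by (cases "snd x") (simp_all add: letter_def)

lemma mset_filter_split: "mset u = mset (filter P u @ filter (\<lambda>x. \<not> P x) u)"
  using multiset_partition[of "mset u" P] by simp

lemma em_filter_split: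
  "em u = em (filter (\<lambda>x. fst x \<in> S) u) * em (filter (\<lambda>x. fst x \<notin> S) u)"
  by (subst em_mset_cong[OF mset_filter_split[of u "\<lambda>x. fst x \<in> S"]], rule em_append_disjoint) auto

lemma em_unpaired:
  assumes "length (filter (\<lambda>x. fst x = j) u) = 1"
  shows "em u = 0"
proof -
  obtain y where "filter (\<lambda>x. fst x = j) u = [y]"
    using assms by (metis One_nat_def length_0_conv length_Suc_conv)
  then show ?thesis using em_filter_split[of u "{j}"] by simp
qed

end

section \<open>Conditional means of monomials and their products\<close>

lemma four_sums:
  fixes f g h k :: "'i \<Rightarrow> complex"
  shows "(\<Sum>x\<in>X. f x) * (\<Sum>y\<in>Y. g y) * (\<Sum>z\<in>Z. h z) * (\<Sum>w\<in>V. k w) =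
    (\<Sum>(x,y,z,w)\<in>X \<times> Y \<times> Z \<times> V. f x * g y * h z * k w)"
  by (simp add: sum.cartesian_product[symmetric] mult.assoc
      sum_distrib_left[symmetric] sum_distrib_right[symmetric])

lemma int_telescope:
  fixes g :: "int \<Rightarrow> complex"
  assumes "l \<le> h"
  shows "(\<Sum>j\<in>{l..h}. g j - g (j - 1)) = g h - g (l - 1)"
  using assms
proof (induction h rule: int_ge_induct)
  case (step i)
  have "{l..i+1} = insert (i+1) {l..i}" using step by auto
  then show ?case using step by simp
qed simp

text \<open>Young's inequality with a free scale \<open>s\<close>. It trades a mixed third-order term for fourth moments at the price of a
constant \<open>1 / s ^ 3\<close>; it will be summed over the indices in the band, and a scale of the order of the
square root of the bandwidth makes both parts small.\<close>

lemma mult_square_le_fourth: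
  fixes x y s :: real
  assumes "x \<ge> 0" "y \<ge> 0" "s > 0"
  shows "x * y\<^sup>2 \<le> s * (x ^ 4 + y ^ 4) + 1 / s ^ 3"
proof -
  define m where "m = max x y"
  have m: "x \<le> m" "y \<le> m" "0 \<le> m" using assms by (auto simp: m_def)
  have "x * y\<^sup>2 \<le> m * m\<^sup>2" using m assms by (intro mult_mono power_mono) auto
  also have "\<dots> \<le> s * m ^ 4 + 1 / s ^ 3"
  proof (cases "m * s \<ge> 1")
    case True
    have "m * m\<^sup>2 * 1 \<le> m * m\<^sup>2 * (m * s)" using True m by (intro mult_left_mono) auto
    also have "\<dots> = s * m ^ 4" by (simp add: eval_nat_numeral)
    finally show ?thesis using assms by (simp add: add_increasing2)
  next
    case False
    then have "m \<le> 1 / s" using assms by (simp add: field_simps)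
    then have "m ^ 3 \<le> (1 / s) ^ 3" using m by (intro power_mono) auto
    then have "m * m\<^sup>2 \<le> 1 / s ^ 3" by (simp add: eval_nat_numeral power_divide)
    then show ?thesis using assms m by (simp add: add_increasing)
  qed
  also have "m ^ 4 \<le> x ^ 4 + y ^ 4" using assms by (auto simp: m_def max_def)
  finally show ?thesis using assms by (simp add: mult_left_mono)
qed

context toeplitz_input
begin

text \<open>\<open>piece S u\<close> is the conditional expectation of the monomial \<open>u\<close> given the entries with indices in
\<open>S\<close>. Because the entries are independent it is explicit: letters with indices outside \<open>S\<close> are
replaced by their mean. Working with this formula avoids conditional expectations
and independent copies altogether.\<close>

definition piece :: "int set \<Rightarrow> word \<Rightarrow> 'a \<Rightarrow> complex" where
  "piece S u \<omega> = A (filter (\<lambda>x. fst x \<in> S) u) \<omega> * em (filter (\<lambda>x. fst x \<notin> S) u)"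

definition pieces :: "(int set \<times> word) list \<Rightarrow> 'a \<Rightarrow> complex" where
  "pieces xs \<omega> = (\<Prod>(S, u)\<leftarrow>xs. piece S u \<omega>)"

text \<open>A product of pieces is a constant, \<open>weight\<close>, times one longer monomial, whose word is \<open>seen\<close>.\<close>

definition seen :: "(int set \<times> word) list \<Rightarrow> word" where
  "seen xs = concat (map (\<lambda>(S, u). filter (\<lambda>x. fst x \<in> S) u) xs)"

definition weight :: "(int set \<times> word) list \<Rightarrow> complex" where
  "weight xs = (\<Prod>(S, u)\<leftarrow>xs. em (filter (\<lambda>x. fst x \<notin> S) u))"

abbreviation letters :: "(int set \<times> word) list \<Rightarrow> word" where
  "letters xs \<equiv> concat (map snd xs)"

lemma pieces_eq: "pieces xs \<omega> = weight xs * A (seen xs) \<omega>"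
proof (induction xs)
  case Nil
  then show ?case by (simp add: pieces_def weight_def seen_def A_def)
next
  case (Cons x xs)
  then show ?case
    by (cases x) (simp add: pieces_def weight_def seen_def piece_def A_append mult_ac)
qed

lemma pieces_Nil [simp]: "pieces [] \<omega> = 1" by (simp add: pieces_def)
lemma pieces_Cons [simp]: "pieces ((S, u) # xs) \<omega> = piece S u \<omega> * pieces xs \<omega>" by (simp add: pieces_def)
lemma pieces_append: "pieces (xs @ ys) \<omega> = pieces xs \<omega> * pieces ys \<omega>" by (simp add: pieces_def)

lemma piece_UNIV: "piece UNIV u \<omega> = A u \<omega>" by (simp add: piece_def)

lemma cnj_piece: "cnj (piece S u \<omega>) = piece S (conj_word u) \<omega>"
  using filter_conj_word[of "\<lambda>x. x \<in> S" u] filter_conj_word[of "\<lambda>x. x \<notin> S" u]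
  by (simp add: piece_def A_conj em_conj)

lemma measurable_piece [measurable]: "piece S u \<in> borel_measurable M"
  unfolding piece_def[abs_def] by simp

lemma integrable_pieces [simp]: "integrable M (pieces xs)"
  unfolding pieces_eq[abs_def] by simp

lemma expectation_pieces: "expectation (pieces xs) = weight xs * em (seen xs)"
  unfolding pieces_eq[abs_def] em_def by simp

lemma length_seen_le: "length (seen xs) \<le> length (letters xs)"
  by (induction xs) (auto simp: seen_def intro!: add_mono)

lemma idx_seen: "idx (seen xs) \<subseteq> idx (letters xs)"
  by (rule image_mono) (auto simp: seen_def)

lemma norm_weight_le: "length (letters xs) \<le> N \<Longrightarrow> norm (weight xs) \<le> KM N ^ length xs"
proof (induction xs)
  case (Cons x xs)
  obtain S u where x: "x = (S, u)" by (cases x)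
  have "length (filter (\<lambda>x. fst x \<notin> S) u) \<le> N"
    using Cons.prems by (intro order_trans[OF length_filter_le]) (simp add: x)
  then have "norm (em (filter (\<lambda>x. fst x \<notin> S) u)) \<le> KM N" by (rule norm_em_le)
  then show ?case using Cons KM_ge_1[of N] by (auto simp: weight_def x norm_mult intro!: mult_mono)
qed (simp add: weight_def)

lemma norm_expectation_pieces_le:
  assumes "length (letters xs) \<le> N"
  shows "norm (expectation (pieces xs)) \<le> KM N ^ Suc (length xs)"
  unfolding expectation_pieces norm_mult power_Suc2
  using assms length_seen_le[of xs] KM_ge_1[of N] by (intro mult_mono norm_weight_le norm_em_le) auto

text \<open>The letter with the unpaired index is alone with its index either in the monomial that remains or in one of the
means that have been taken out; in both cases centring of the entries gives a factor \<open>0\<close>.\<close>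

lemma expectation_pieces_unpaired:
  assumes "length (filter (\<lambda>x. fst x = j) (letters xs)) = 1"
  shows "expectation (pieces xs) = 0"
proof -
  have "length (filter (\<lambda>x. fst x = j) (seen xs)) = 1 \<or> weight xs = 0"
    if "length (filter (\<lambda>x. fst x = j) (letters xs)) = 1" for xs
    using that
  proof (induction xs)
    case (Cons x xs)
    obtain S u where x: "x = (S, u)" by (cases x)
    define m where "m = length (filter (\<lambda>x. fst x = j) u)"
    have seen0: "length (filter (\<lambda>x. fst x = j) (seen ys)) = 0"
      if "length (filter (\<lambda>x. fst x = j) (letters ys)) = 0" for ys
    proof -
      have "j \<notin> idx (letters ys)" using that by (auto simp: filter_empty_conv)
      then have "j \<notin> idx (seen ys)" using idx_seen by blast
      then show ?thesis by (auto simp: filter_empty_conv)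
    qed
    have sum: "m + length (filter (\<lambda>x. fst x = j) (letters xs)) = 1" using Cons.prems by (simp add: x m_def)
    show ?case
    proof (cases "m = 0")
      case True
      then have "length (filter (\<lambda>x. fst x = j) (filter (\<lambda>x. fst x \<in> S) u)) = 0"
        by (auto simp: m_def filter_empty_conv)
      then show ?thesis using Cons.IH sum True by (auto simp: x seen_def weight_def)
    next
      case False
      then have m1: "m = 1" and 0: "length (filter (\<lambda>x. fst x = j) (letters xs)) = 0" using sum by linarith+
      show ?thesis
      proof (cases "j \<in> S")
        case True
        then have "filter (\<lambda>x. fst x = j) (filter (\<lambda>x. fst x \<in> S) u) = filter (\<lambda>x. fst x = j) u"
          by (auto intro: filter_cong)
        then show ?thesis using seen0[OF 0] m1 by (simp add: x seen_def m_def)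
      next
        case False
        then have "filter (\<lambda>x. fst x = j) (filter (\<lambda>x. fst x \<notin> S) u) = filter (\<lambda>x. fst x = j) u"
          by (auto intro: filter_cong)
        then have "em (filter (\<lambda>x. fst x \<notin> S) u) = 0" using m1 by (intro em_unpaired[of j]) (simp add: m_def)
        then show ?thesis by (simp add: x weight_def)
      qed
    qed
  qed simp
  then show ?thesis using assms em_unpaired by (auto simp: expectation_pieces)
qed

lemma expectation_pieces_disjoint:
  assumes "idx (letters xs) \<inter> idx (letters ys) = {}"
  shows "expectation (pieces (xs @ ys)) = expectation (pieces xs) * expectation (pieces ys)"
proof -
  have "em (seen xs @ seen ys) = em (seen xs) * em (seen ys)"
    using assms idx_seen[of xs] idx_seen[of ys] by (intro em_append_disjoint) blast
  moreover have "seen (xs @ ys) = seen xs @ seen ys" "weight (xs @ ys) = weight xs * weight ys"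
    by (simp_all add: seen_def weight_def)
  ultimately show ?thesis by (simp add: expectation_pieces)
qed

end

section \<open>Polynomial statistics and sums over connected quadruples\<close>

text \<open>The pattern that a quadruple of words must show in order to contribute to the error terms. An index
that occurs exactly once makes all expectations vanish. The first two and the last two words
share an index because each pair comes from products of two terms that involve the same entry; the
two pairs share an index because otherwise they are independent and their covariance vanishes. The
four words thus form a connected system.\<close>

definition good :: "word \<Rightarrow> word \<Rightarrow> word \<Rightarrow> word \<Rightarrow> bool" where
  "good u1 u2 u3 u4 \<longleftrightarrow> (\<forall>j. length (filter (\<lambda>x. fst x = j) (u1 @ u2 @ u3 @ u4)) \<noteq> 1) \<and>
     idx u1 \<inter> idx u2 \<noteq> {} \<and> idx u3 \<inter> idx u4 \<noteq> {} \<and> (idx u1 \<union> idx u2) \<inter> (idx u3 \<union> idx u4) \<noteq> {}"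

lemma length_filter_conj_word:
  "length (filter (\<lambda>x. fst x = j) (conj_word u)) = length (filter (\<lambda>x. fst x = j) u)"
  using filter_conj_word[of "\<lambda>i. i = j" u] by simp

lemma card_idx_le: "card (idx u) \<le> length u"
  by (metis card_length card_image_le finite_set order_trans)

lemma monom_of_upd_zero:
  "monom_of (c(j := 0)) u = (if j \<in> idx u then 0 else monom_of c u)"
  by (induction u) (auto simp: letter_def)

text \<open>A real polynomial in the entries with indices in \<open>{l..h}\<close>, written as a sum of monomials
with real coefficients. That the sum is real is assumed for every input, not just almost surely, since
entries will be replaced by \<open>0\<close>.\<close>

locale toeplitz_statistic = toeplitz_input +
  fixes W :: "word set" and C :: "word \<Rightarrow> real" and l h :: int and Lm :: nat
  assumes finite_W: "finite W" and W_idx: "u \<in> W \<Longrightarrow> idx u \<subseteq> {l..h}" and lh: "l \<le> h"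
    and W_len: "u \<in> W \<Longrightarrow> length u \<le> Lm"
    and real_F: "(\<Sum>u\<in>W. of_real (C u) * monom_of c u) \<in> \<real>"
begin

definition F :: "(int \<Rightarrow> complex) \<Rightarrow> complex" where
  "F c = (\<Sum>u\<in>W. of_real (C u) * monom_of c u)"

definition f :: "'a \<Rightarrow> real" where "f \<omega> = Re (F (\<lambda>j. a j \<omega>))"

definition f_without :: "int \<Rightarrow> 'a \<Rightarrow> real" where
  "f_without j \<omega> = Re (F ((\<lambda>i. a i \<omega>)(j := 0)))"

text \<open>The part of the statistic that involves the entry \<open>a\<^sub>j\<close>, conditioned on the entries in \<open>S j\<close>. The
choices of interest are \<open>{..j}\<close> and \<open>{..<j}\<close>, whose difference is the martingale increment at \<open>j\<close>,
and \<open>UNIV\<close>, which gives the change of the statistic when \<open>a\<^sub>j\<close> is replaced by \<open>0\<close>.\<close>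

definition R :: "(int \<Rightarrow> int set) \<Rightarrow> int \<Rightarrow> 'a \<Rightarrow> complex" where
  "R S j \<omega> = (\<Sum>u\<in>{u\<in>W. j \<in> idx u}. of_real (C u) * piece (S j) u \<omega>)"

text \<open>The single quantity that controls all error terms of the normal approximation.\<close>

definition Gsum :: real where
  "Gsum = (\<Sum>(u1,u2,u3,u4)\<in>W \<times> W \<times> W \<times> W.
     if good u1 u2 u3 u4 then \<bar>C u1\<bar> * \<bar>C u2\<bar> * \<bar>C u3\<bar> * \<bar>C u4\<bar> else 0)"

definition K4 :: real where "K4 = KM (4 * Lm) ^ 6"

lemma K4_nonneg: "K4 \<ge> 0" unfolding K4_def using KM_ge_1[of "4 * Lm"] by simp

lemma Re_F: "of_real (Re (F c)) = F c"
  unfolding F_def by (rule of_real_Re[OF real_F])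

lemma f_eq: "complex_of_real (f \<omega>) = (\<Sum>u\<in>W. of_real (C u) * A u \<omega>)"
  unfolding f_def Re_F by (simp add: F_def A_def)

lemma f_without_eq:
  "complex_of_real (f_without j \<omega>) = (\<Sum>u\<in>{u\<in>W. j \<notin> idx u}. of_real (C u) * A u \<omega>)"
  unfolding f_without_def Re_F unfolding F_def using finite_W
  by (intro sum.mono_neutral_cong_right) (simp_all add: monom_of_upd_zero A_def subset_iff)

lemma R_UNIV: "R (\<lambda>_. UNIV) j \<omega> = of_real (f \<omega> - f_without j \<omega>)"
proof -
  have "(\<Sum>u\<in>W. of_real (C u) * A u \<omega>) =
      (\<Sum>u\<in>{u\<in>W. j \<in> idx u}. of_real (C u) * A u \<omega>) + (\<Sum>u\<in>{u\<in>W. j \<notin> idx u}. of_real (C u) * A u \<omega>)"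
    using finite_W by (subst sum.union_disjoint[symmetric]) (auto intro!: sum.cong)
  then show ?thesis by (simp add: R_def piece_UNIV f_eq f_without_eq)
qed

lemma norm_expectation_pieces4:
  assumes "length (letters xs) \<le> 4 * Lm" "length xs \<le> 4"
  shows "norm (expectation (pieces xs)) \<le> K4"
  unfolding K4_def using assms KM_ge_1[of "4 * Lm"]
  by (intro order_trans[OF norm_expectation_pieces_le[OF assms(1)]] power_increasing) auto

lemma measurable_R [measurable]: "R S j \<in> borel_measurable M"
  unfolding R_def[abs_def] by measurable

lemma four_R:
  "(\<Sum>u\<in>X. of_real (C u) * piece S u \<omega>) * (\<Sum>u\<in>X. of_real (C u) * piece S u \<omega>) *
   cnj (\<Sum>u\<in>X. of_real (C u) * piece S u \<omega>) * cnj (\<Sum>u\<in>X. of_real (C u) * piece S u \<omega>) =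
   (\<Sum>(u1,u2,u3,u4)\<in>X \<times> X \<times> X \<times> X. of_real (C u1 * C u2 * C u3 * C u4) *
      pieces [(S,u1),(S,u2),(S,conj_word u3),(S,conj_word u4)] \<omega>)"
  unfolding cnj_sum four_sums
  by (intro sum.cong) (auto simp: cnj_piece mult_ac)

lemma norm_R_power4:
  "complex_of_real (norm (R S j \<omega>) ^ 4) =
    (\<Sum>(u1,u2,u3,u4)\<in>{u\<in>W. j \<in> idx u} \<times> {u\<in>W. j \<in> idx u} \<times> {u\<in>W. j \<in> idx u} \<times> {u\<in>W. j \<in> idx u}.
      of_real (C u1 * C u2 * C u3 * C u4) *
      pieces [(S j,u1),(S j,u2),(S j,conj_word u3),(S j,conj_word u4)] \<omega>)"
  unfolding norm_power4 R_def four_R ..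

lemma integrable_R4: "integrable M (\<lambda>\<omega>. norm (R S j \<omega>) ^ 4)"
proof -
  have "integrable M (\<lambda>\<omega>. complex_of_real (norm (R S j \<omega>) ^ 4))"
    unfolding norm_R_power4 split_beta by (intro Bochner_Integration.integrable_sum integrable_mult_right integrable_pieces)
  then show ?thesis by (simp only: complex_of_real_integrable_eq)
qed

text \<open>The fourth power is expanded into products of four pieces. All four words contain \<open>j\<close>, so a
quadruple without an unpaired index is automatically connected.\<close>

lemma expectation_R4_le:
  "expectation (\<lambda>\<omega>. norm (R S j \<omega>) ^ 4) \<le> (\<Sum>(u1,u2,u3,u4)\<in>W \<times> W \<times> W \<times> W.
     if good u1 u2 u3 u4 \<and> j \<in> idx u1 then K4 * (\<bar>C u1\<bar> * \<bar>C u2\<bar> * \<bar>C u3\<bar> * \<bar>C u4\<bar>) else 0)"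
proof -
  let ?X = "{u\<in>W. j \<in> idx u}"
  let ?p = "\<lambda>u1 u2 u3 u4. [(S j,u1),(S j,u2),(S j,conj_word u3),(S j,conj_word u4)]"
  have "complex_of_real (expectation (\<lambda>\<omega>. norm (R S j \<omega>) ^ 4)) =
      expectation (\<lambda>\<omega>. complex_of_real (norm (R S j \<omega>) ^ 4))"
    by (rule integral_complex_of_real[symmetric])
  also have "\<dots> = (\<Sum>(u1,u2,u3,u4)\<in>?X \<times> ?X \<times> ?X \<times> ?X.
      of_real (C u1 * C u2 * C u3 * C u4) * expectation (pieces (?p u1 u2 u3 u4)))"
    unfolding norm_R_power4 split_beta
    by (subst Bochner_Integration.integral_sum) (auto simp del: of_real_mult pieces_Cons)
  finally have eq: "complex_of_real (expectation (\<lambda>\<omega>. norm (R S j \<omega>) ^ 4)) = \<dots>" .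
  have "expectation (\<lambda>\<omega>. norm (R S j \<omega>) ^ 4) = norm (complex_of_real (expectation (\<lambda>\<omega>. norm (R S j \<omega>) ^ 4)))"
    unfolding norm_of_real by (intro abs_of_nonneg[symmetric] Bochner_Integration.integral_nonneg) simp
  also have "\<dots> \<le> (\<Sum>(u1,u2,u3,u4)\<in>?X \<times> ?X \<times> ?X \<times> ?X.
      if good u1 u2 u3 u4 \<and> j \<in> idx u1 then K4 * (\<bar>C u1\<bar> * \<bar>C u2\<bar> * \<bar>C u3\<bar> * \<bar>C u4\<bar>) else 0)"
    unfolding eq
  proof (rule sum_norm_le, goal_cases)
    case (1 q)
    then obtain u1 u2 u3 u4 where q: "q = (u1,u2,u3,u4)" and u: "u1 \<in> W" "u2 \<in> W" "u3 \<in> W" "u4 \<in> W"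
      and j: "j \<in> idx u1" "j \<in> idx u2" "j \<in> idx u3" "j \<in> idx u4"
      by (cases q) blast
    let ?E = "expectation (pieces (?p u1 u2 u3 u4))"
    have "norm (of_real (C u1 * C u2 * C u3 * C u4) * ?E) \<le>
        (if good u1 u2 u3 u4 \<and> j \<in> idx u1 then K4 * (\<bar>C u1\<bar> * \<bar>C u2\<bar> * \<bar>C u3\<bar> * \<bar>C u4\<bar>) else 0)"
    proof (cases "good u1 u2 u3 u4")
      case True
      have "norm ?E \<le> K4" using u by (intro norm_expectation_pieces4) (auto dest!: W_len)
      then show ?thesis using True j(1)
        by (auto simp: norm_mult abs_mult mult.commute[of K4] intro!: mult_left_mono)
    next
      case False
      then obtain i where "length (filter (\<lambda>x. fst x = i) (u1 @ u2 @ u3 @ u4)) = 1"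
        using j unfolding good_def by blast
      then have "?E = 0" by (intro expectation_pieces_unpaired[of i]) (simp add: length_filter_conj_word)
      then show ?thesis using False by simp
    qed
    then show ?case by (simp only: q prod.case)
  qed
  also have "\<dots> \<le> (\<Sum>(u1,u2,u3,u4)\<in>W \<times> W \<times> W \<times> W.
      if good u1 u2 u3 u4 \<and> j \<in> idx u1 then K4 * (\<bar>C u1\<bar> * \<bar>C u2\<bar> * \<bar>C u3\<bar> * \<bar>C u4\<bar>) else 0)"
  proof (rule sum_mono2)
    show "0 \<le> (case q of (u1,u2,u3,u4) \<Rightarrow>
      if good u1 u2 u3 u4 \<and> j \<in> idx u1 then K4 * (\<bar>C u1\<bar> * \<bar>C u2\<bar> * \<bar>C u3\<bar> * \<bar>C u4\<bar>) else 0)" for q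
      using K4_nonneg by (cases q) simp
  qed (use finite_W in auto)
  finally show ?thesis .
qed

text \<open>Summing over \<open>j\<close> counts each quadruple once for every index of its first word, that is,
at most \<open>Lm\<close> times.\<close>

lemma sum_expectation_R4_le:
  "(\<Sum>j\<in>{l..h}. expectation (\<lambda>\<omega>. norm (R S j \<omega>) ^ 4)) \<le> K4 * Lm * Gsum"
proof -
  have "(\<Sum>j\<in>{l..h}. expectation (\<lambda>\<omega>. norm (R S j \<omega>) ^ 4)) \<le>
    (\<Sum>j\<in>{l..h}. \<Sum>(u1,u2,u3,u4)\<in>W \<times> W \<times> W \<times> W.
     if good u1 u2 u3 u4 \<and> j \<in> idx u1 then K4 * (\<bar>C u1\<bar> * \<bar>C u2\<bar> * \<bar>C u3\<bar> * \<bar>C u4\<bar>) else 0)"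
    by (intro sum_mono expectation_R4_le)
  also have "\<dots> = (\<Sum>(u1,u2,u3,u4)\<in>W \<times> W \<times> W \<times> W. \<Sum>j\<in>{l..h}.
     if good u1 u2 u3 u4 \<and> j \<in> idx u1 then K4 * (\<bar>C u1\<bar> * \<bar>C u2\<bar> * \<bar>C u3\<bar> * \<bar>C u4\<bar>) else 0)"
    unfolding split_beta by (rule sum.swap)
  also have "\<dots> \<le> (\<Sum>(u1,u2,u3,u4)\<in>W \<times> W \<times> W \<times> W. K4 * Lm *
     (if good u1 u2 u3 u4 then \<bar>C u1\<bar> * \<bar>C u2\<bar> * \<bar>C u3\<bar> * \<bar>C u4\<bar> else 0))"
  proof (rule sum_mono, goal_cases)
    case (1 q)
    then obtain u1 u2 u3 u4 where q: "q = (u1,u2,u3,u4)" and u: "u1 \<in> W" "u2 \<in> W" "u3 \<in> W" "u4 \<in> W"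
      by (cases q) blast
    let ?c = "\<bar>C u1\<bar> * \<bar>C u2\<bar> * \<bar>C u3\<bar> * \<bar>C u4\<bar>"
    have "(\<Sum>j\<in>{l..h}. if good u1 u2 u3 u4 \<and> j \<in> idx u1 then K4 * ?c else 0) =
        (\<Sum>j\<in>idx u1. if good u1 u2 u3 u4 then K4 * ?c else 0)"
      using W_idx[OF u(1)] by (intro sum.mono_neutral_cong_right) auto
    also have "\<dots> = real (card (idx u1)) * (if good u1 u2 u3 u4 then K4 * ?c else 0)" by simp
    also have "\<dots> \<le> real Lm * (if good u1 u2 u3 u4 then K4 * ?c else 0)"
      using card_idx_le[of u1] W_len[OF u(1)] K4_nonneg by (intro mult_right_mono) auto
    also have "\<dots> = K4 * Lm * (if good u1 u2 u3 u4 then ?c else 0)" by simp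
    finally show ?case by (simp only: q prod.case)
  qed
  also have "\<dots> = K4 * Lm * Gsum" unfolding Gsum_def sum_distrib_left split_beta ..
  finally show ?thesis .
qed

definition Ssum :: "(int \<Rightarrow> int set) \<Rightarrow> 'a \<Rightarrow> complex" where
  "Ssum S \<omega> = (\<Sum>j\<in>{l..h}. R S j \<omega> * R (\<lambda>_. UNIV) j \<omega>)"

definition triples :: "(int \<times> word \<times> word) set" where
  "triples = {(j,u,v). j \<in> {l..h} \<and> u \<in> W \<and> v \<in> W \<and> j \<in> idx u \<and> j \<in> idx v}"

lemma Ssum_eq: "Ssum S \<omega> = (\<Sum>(j,u,v)\<in>triples. of_real (C u * C v) * pieces [(S j, u), (UNIV, v)] \<omega>)"
proof -
  have t: "triples = Sigma {l..h} (\<lambda>j. {u\<in>W. j \<in> idx u} \<times> {u\<in>W. j \<in> idx u})"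
    by (auto simp: triples_def)
  have "R S j \<omega> * R (\<lambda>_. UNIV) j \<omega> = (\<Sum>(u,v)\<in>{u\<in>W. j \<in> idx u} \<times> {u\<in>W. j \<in> idx u}.
      of_real (C u * C v) * pieces [(S j, u), (UNIV, v)] \<omega>)" for j
    unfolding R_def sum_product sum.cartesian_product by (intro sum.cong) (auto simp: mult_ac)
  then show ?thesis unfolding Ssum_def t using finite_W
    by (subst sum.Sigma[symmetric]) auto
qed

lemma measurable_Ssum [measurable]: "Ssum S \<in> borel_measurable M"
  unfolding Ssum_def[abs_def] by measurable

lemma integrable_Ssum [simp]: "integrable M (Ssum S)"
  unfolding Ssum_eq[abs_def] split_beta by (intro Bochner_Integration.integrable_sum integrable_mult_right integrable_pieces)

text \<open>\<open>Ssum S\<close> is a sum over triples of an index and two words containing it, and its variance is a sum of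
covariances over pairs of triples. Such a covariance vanishes when the two pairs of words have no common
index, by independence, and when some index is unpaired; otherwise the four words form a good
quadruple, which arises from at most \<open>Lm\<^sup>2\<close> choices of the two indices.\<close>

lemma variance_Ssum_le:
  "integrable M (\<lambda>\<omega>. (norm (Ssum S \<omega> - expectation (Ssum S)))\<^sup>2)"
  "expectation (\<lambda>\<omega>. (norm (Ssum S \<omega> - expectation (Ssum S)))\<^sup>2) \<le> 2 * K4 * (real Lm)\<^sup>2 * Gsum"
proof -
  let ?p = "\<lambda>t. case t of (j,u,v) \<Rightarrow> [(S j, u), (UNIV, v)]"
  let ?q = "\<lambda>t. case t of (j,u,v) \<Rightarrow> [(S j, conj_word u), (UNIV, conj_word v)]"
  let ?c = "\<lambda>t. case t of (j :: int,u,v) \<Rightarrow> C u * C v"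
  have S: "Ssum S \<omega> = (\<Sum>t\<in>triples. of_real (?c t) * pieces (?p t) \<omega>)" for \<omega>
    unfolding Ssum_eq by (intro sum.cong) auto
  have cnj_pieces: "cnj (pieces (?p t) \<omega>) = pieces (?q t) \<omega>" for t \<omega>
    by (cases t) (simp add: cnj_piece)
  have ES: "expectation (Ssum S) = (\<Sum>t\<in>triples. of_real (?c t) * expectation (pieces (?p t)))"
    unfolding S[abs_def] by (subst Bochner_Integration.integral_sum) auto
  have cnjE: "cnj (expectation (pieces (?p t))) = expectation (pieces (?q t))" for t
  proof -
    have "(\<lambda>\<omega>. cnj (pieces (?p t) \<omega>)) = pieces (?q t)" using cnj_pieces by (rule ext)
    then show ?thesis using Bochner_Integration.integral_cnj[of M "pieces (?p t)"] by (simp only:)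
  qed
  have sq: "complex_of_real ((norm z)\<^sup>2) = z * cnj z" for z by (simp only: complex_norm_square)
  have dev: "Ssum S \<omega> - expectation (Ssum S) = (\<Sum>t\<in>triples. of_real (?c t) * (pieces (?p t) \<omega> - expectation (pieces (?p t))))" for \<omega>
    unfolding ES S by (simp add: sum_subtractf right_diff_distrib)
  have cnj_dev: "cnj (\<Sum>t\<in>triples. of_real (?c t) * (pieces (?p t) \<omega> - expectation (pieces (?p t)))) =
     (\<Sum>t\<in>triples. of_real (?c t) * (pieces (?q t) \<omega> - expectation (pieces (?q t))))" for \<omega>
    unfolding cnj_sum complex_cnj_mult complex_cnj_diff cnj_pieces cnjE by simp
  \<comment> \<open>The summands of the expanded square, arranged so that the expectation of each is a
    covariance.\<close>
  define X where "X t t' \<omega> = of_real (?c t * ?c t') *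
      (pieces (?p t @ ?q t') \<omega> - pieces (?p t) \<omega> * expectation (pieces (?q t')) -
       expectation (pieces (?p t)) * pieces (?q t') \<omega> + expectation (pieces (?p t)) * expectation (pieces (?q t')))" for t t' \<omega>
  have eq: "complex_of_real ((norm (Ssum S \<omega> - expectation (Ssum S)))\<^sup>2) = (\<Sum>t\<in>triples. \<Sum>t'\<in>triples. X t t' \<omega>)" for \<omega>
    unfolding sq dev cnj_dev sum_product X_def pieces_append
    by (intro sum.cong refl) (simp add: algebra_simps)
  have intX: "integrable M (X t t')" for t t' unfolding X_def[abs_def] by simp
  have EX: "expectation (X t t') = of_real (?c t * ?c t') *
      (expectation (pieces (?p t @ ?q t')) - expectation (pieces (?p t)) * expectation (pieces (?q t')))" for t t'
    unfolding X_def[abs_def] by (simp add: prob_space algebra_simps)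
  have int: "integrable M (\<lambda>\<omega>. complex_of_real ((norm (Ssum S \<omega> - expectation (Ssum S)))\<^sup>2))"
    unfolding eq by (intro Bochner_Integration.integrable_sum intX)
  then show int': "integrable M (\<lambda>\<omega>. (norm (Ssum S \<omega> - expectation (Ssum S)))\<^sup>2)"
    by (simp only: complex_of_real_integrable_eq)
  have E: "complex_of_real (expectation (\<lambda>\<omega>. (norm (Ssum S \<omega> - expectation (Ssum S)))\<^sup>2)) =
      (\<Sum>t\<in>triples. \<Sum>t'\<in>triples. expectation (X t t'))"
    unfolding integral_complex_of_real[symmetric] eq
    by (subst Bochner_Integration.integral_sum) (auto intro!: sum.cong Bochner_Integration.integral_sum Bochner_Integration.integrable_sum intX)
  define g where "g u v u' v' = (if good u v u' v' then \<bar>C u\<bar> * \<bar>C v\<bar> * \<bar>C u'\<bar> * \<bar>C v'\<bar> else 0)" for u v u' v'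
  have bnd: "norm (expectation (X (j,u,v) (j',u',v'))) \<le> 2 * K4 * g u v u' v'"
    if t: "(j,u,v) \<in> triples" "(j',u',v') \<in> triples" for j u v j' u' v'
  proof -
    let ?xs = "[(S j, u), (UNIV, v)]" and ?ys = "[(S j', conj_word u'), (UNIV, conj_word v')]"
    let ?cov = "expectation (pieces (?xs @ ?ys)) - expectation (pieces ?xs) * expectation (pieces ?ys)"
    have len: "length u \<le> Lm" "length v \<le> Lm" "length u' \<le> Lm" "length v' \<le> Lm"
      using t W_len by (auto simp: triples_def)
    have "norm ?cov \<le> 2 * K4"
    proof -
      have "norm (expectation (pieces (?xs @ ?ys))) \<le> K4" using len by (intro norm_expectation_pieces4) auto
      moreover have "norm (expectation (pieces ?xs)) \<le> KM (4 * Lm) ^ 3" "norm (expectation (pieces ?ys)) \<le> KM (4 * Lm) ^ 3"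
        using norm_expectation_pieces_le[of ?xs "4 * Lm"] norm_expectation_pieces_le[of ?ys "4 * Lm"] len
        by (simp_all add: eval_nat_numeral)
      then have "norm (expectation (pieces ?xs)) * norm (expectation (pieces ?ys)) \<le> KM (4 * Lm) ^ 3 * KM (4 * Lm) ^ 3"
        using KM_ge_1[of "4 * Lm"] by (intro mult_mono) auto
      then have "norm (expectation (pieces ?xs) * expectation (pieces ?ys)) \<le> K4"
        by (simp add: norm_mult K4_def flip: power_add)
      ultimately show ?thesis using norm_triangle_ineq4[of "expectation (pieces (?xs @ ?ys))" "expectation (pieces ?xs) * expectation (pieces ?ys)"]
        by linarith
    qed
    moreover have "?cov = 0" if ng: "\<not> good u v u' v'"
    proof (cases "(idx u \<union> idx v) \<inter> (idx u' \<union> idx v') = {}")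
      case True
      then have "idx (letters ?xs) \<inter> idx (letters ?ys) = {}"
        using conj_word_simps(2)[of u'] conj_word_simps(2)[of v'] by (auto simp del: conj_word_simps simp: image_Un)
      then show ?thesis by (simp only: expectation_pieces_disjoint) simp
    next
      case False
      have "idx u \<inter> idx v \<noteq> {}" "idx u' \<inter> idx v' \<noteq> {}" using t by (auto simp: triples_def)
      then obtain i where i: "length (filter (\<lambda>x. fst x = i) (u @ v @ u' @ v')) = 1"
        using ng False unfolding good_def by blast
      have "expectation (pieces (?xs @ ?ys)) = 0"
        using i by (intro expectation_pieces_unpaired[of i]) (simp add: length_filter_conj_word)
      moreover have "length (filter (\<lambda>x. fst x = i) (letters ?xs)) = 1 \<or> length (filter (\<lambda>x. fst x = i) (letters ?ys)) = 1"
        using i by (simp add: length_filter_conj_word) linarith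
      then have "expectation (pieces ?xs) = 0 \<or> expectation (pieces ?ys) = 0"
        using expectation_pieces_unpaired by blast
      ultimately show ?thesis by auto
    qed
    ultimately have "norm ?cov \<le> 2 * K4 * (if good u v u' v' then 1 else 0)" by auto
    then have "norm ?cov * (\<bar>C u\<bar> * \<bar>C v\<bar> * \<bar>C u'\<bar> * \<bar>C v'\<bar>) \<le>
       2 * K4 * (if good u v u' v' then 1 else 0) * (\<bar>C u\<bar> * \<bar>C v\<bar> * \<bar>C u'\<bar> * \<bar>C v'\<bar>)"
      by (intro mult_right_mono) auto
    moreover have "norm (expectation (X (j,u,v) (j',u',v'))) = norm ?cov * (\<bar>C u\<bar> * \<bar>C v\<bar> * \<bar>C u'\<bar> * \<bar>C v'\<bar>)"
      unfolding EX by (simp add: norm_mult abs_mult)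
    ultimately show ?thesis by (auto simp: g_def)
  qed
  have g0: "g u v u' v' \<ge> 0" for u v u' v' by (simp add: g_def)
  have "expectation (\<lambda>\<omega>. (norm (Ssum S \<omega> - expectation (Ssum S)))\<^sup>2) =
      norm (complex_of_real (expectation (\<lambda>\<omega>. (norm (Ssum S \<omega> - expectation (Ssum S)))\<^sup>2)))"
    unfolding norm_of_real by (intro abs_of_nonneg[symmetric] Bochner_Integration.integral_nonneg) simp
  also have "\<dots> \<le> (\<Sum>(j,u,v)\<in>triples. \<Sum>(j',u',v')\<in>triples. 2 * K4 * g u v u' v')"
    unfolding E by (intro sum_norm_le) (auto intro!: sum_norm_le bnd)
  also have "\<dots> = (\<Sum>(u,v)\<in>W \<times> W. \<Sum>(u',v')\<in>W \<times> W. 2 * K4 * g u v u' v' *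
      (real (card (idx u \<inter> idx v)) * real (card (idx u' \<inter> idx v'))))"
  proof -
    have WI: "l \<le> j \<and> j \<le> h" if "u \<in> W" "(j,c) \<in> set u" for u j c
      using W_idx[OF that(1)] that(2) by force
    have tr: "(\<Sum>(j,u,v)\<in>triples. H u v) = (\<Sum>(u,v)\<in>W \<times> W. real (card (idx u \<inter> idx v)) * H u v)" for H :: "word \<Rightarrow> word \<Rightarrow> real"
    proof -
      have "(\<Sum>(j,u,v)\<in>triples. H u v) = (\<Sum>((u,v),j)\<in>Sigma (W \<times> W) (\<lambda>(u,v). idx u \<inter> idx v). H u v)"
        by (rule sum.reindex_bij_witness[of _ "\<lambda>((u,v),j). (j,u,v)" "\<lambda>(j,u,v). ((u,v),j)"])
           (use WI in \<open>force simp: triples_def\<close>)+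
      also have "\<dots> = (\<Sum>(u,v)\<in>W \<times> W. real (card (idx u \<inter> idx v)) * H u v)"
        using finite_W by (subst sum.Sigma[symmetric]) (auto intro!: sum.cong)
      finally show ?thesis .
    qed
    show ?thesis unfolding tr by (simp add: tr sum_distrib_left split_beta mult_ac)
  qed
  also have "\<dots> \<le> (\<Sum>(u,v)\<in>W \<times> W. \<Sum>(u',v')\<in>W \<times> W. 2 * K4 * g u v u' v' * (real Lm * real Lm))"
  proof -
    have cd: "real (card (idx u \<inter> idx v)) \<le> real Lm" if "u \<in> W" for u v
      using card_idx_le[of u] W_len[OF that] card_mono[of "idx u" "idx u \<inter> idx v"] by simp
    show ?thesis
      unfolding split_beta using cd K4_nonneg g0 by (intro sum_mono mult_left_mono mult_mono) auto
  qed
  also have "\<dots> = 2 * K4 * (real Lm)\<^sup>2 * Gsum"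
  proof -
    have nest: "(\<Sum>(u,v)\<in>W \<times> W. \<Sum>(u',v')\<in>W \<times> W. H u v u' v') =
        (\<Sum>(u,v,u',v')\<in>W \<times> W \<times> W \<times> W. H u v u' v')" for H :: "word \<Rightarrow> word \<Rightarrow> word \<Rightarrow> word \<Rightarrow> real"
      by (simp add: sum.cartesian_product[symmetric])
    show ?thesis unfolding nest Gsum_def g_def sum_distrib_left
      by (intro sum.cong) (auto simp: power2_eq_square)
  qed
  finally show "expectation (\<lambda>\<omega>. (norm (Ssum S \<omega> - expectation (Ssum S)))\<^sup>2) \<le> 2 * K4 * (real Lm)\<^sup>2 * Gsum" .
qed

end

section \<open>A Stein bound from martingale increments\<close>

context toeplitz_input
begin

text \<open>The martingale increment of a monomial when \<open>a\<^sub>j\<close> is revealed, the entries being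
revealed in the order of their indices.\<close>

definition mdiff :: "word \<Rightarrow> int \<Rightarrow> 'a \<Rightarrow> complex" where
  "mdiff u j \<omega> = piece {..j} u \<omega> - piece {..<j} u \<omega>"

lemma piece_lessThan: "piece {..<j} u = piece {..j - 1} u"
proof -
  have "{..<j} = {..j - 1}" by auto
  then show ?thesis by simp
qed

lemma sum_mdiff:
  assumes "idx u \<subseteq> {l..h}" "l \<le> h"
  shows "(\<Sum>j\<in>{l..h}. mdiff u j \<omega>) = A u \<omega> - em u"
proof -
  have "(\<Sum>j\<in>{l..h}. mdiff u j \<omega>) = piece {..h} u \<omega> - piece {..l - 1} u \<omega>"
    unfolding mdiff_def piece_lessThan by (rule int_telescope[OF assms(2)])
  moreover have "l \<le> fst x" "fst x \<le> h" if "x \<in> set u" for x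
    using assms(1) imageI[OF that, of fst] by auto
  then have "filter (\<lambda>x. fst x \<in> {..h}) u = u" "filter (\<lambda>x. fst x \<notin> {..h}) u = []"
    "filter (\<lambda>x. fst x \<in> {..l - 1}) u = []" "filter (\<lambda>x. fst x \<notin> {..l - 1}) u = u"
    by (auto simp: filter_id_conv filter_empty_conv) fastforce+
  ultimately show ?thesis unfolding piece_def by (simp add: A_def)
qed

lemma mdiff_eq_0:
  assumes "j \<notin> idx u"
  shows "mdiff u j \<omega> = 0"
proof -
  have "fst x \<noteq> j" if "x \<in> set u" for x using assms imageI[OF that, of fst] by auto
  then have "filter (\<lambda>x. fst x \<in> {..j}) u = filter (\<lambda>x. fst x \<in> {..<j}) u"
    "filter (\<lambda>x. fst x \<notin> {..j}) u = filter (\<lambda>x. fst x \<notin> {..<j}) u"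
    by (intro filter_cong; force)+
  then show ?thesis by (simp add: mdiff_def piece_def)
qed

text \<open>The factor of the entry \<open>a\<^sub>j\<close> itself is centred and stands alone; this is what makes the
increment orthogonal to every function of the other entries.\<close>

lemma mdiff_eq:
  "mdiff u j \<omega> = em (filter (\<lambda>x. fst x > j) u) *
     (A (filter (\<lambda>x. fst x < j) u) \<omega> * (A (filter (\<lambda>x. fst x = j) u) \<omega> - em (filter (\<lambda>x. fst x = j) u)))"
proof -
  have 1: "A (filter (\<lambda>x. fst x \<le> j) u) \<omega> = A (filter (\<lambda>x. fst x < j) u) \<omega> * A (filter (\<lambda>x. fst x = j) u) \<omega>"
  proof -
    have "mset (filter (\<lambda>x. fst x \<le> j) u) = mset (filter (\<lambda>x. fst x < j) u @ filter (\<lambda>x. fst x = j) u)"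
      by (induction u) auto
    then show ?thesis unfolding A_def monom_of_append[symmetric] by (rule monom_of_mset_cong)
  qed
  have 2: "em (filter (\<lambda>x. fst x \<ge> j) u) = em (filter (\<lambda>x. fst x = j) u) * em (filter (\<lambda>x. fst x > j) u)"
  proof -
    have "mset (filter (\<lambda>x. fst x \<ge> j) u) = mset (filter (\<lambda>x. fst x = j) u @ filter (\<lambda>x. fst x > j) u)"
      by (induction u) auto
    then show ?thesis by (subst em_mset_cong, assumption, intro em_append_disjoint) auto
  qed
  show ?thesis
    unfolding mdiff_def piece_def using 1 2 by (simp add: not_le not_less algebra_simps)
qed

lemma measurable_mdiff [measurable]: "mdiff u j \<in> borel_measurable M"
  unfolding mdiff_def[abs_def] by measurable

lemma integrable_mdiff_mult:
  assumes "\<And>v. integrable M (\<lambda>\<omega>. A v \<omega> * Y \<omega>)"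
  shows "integrable M (\<lambda>\<omega>. mdiff u j \<omega> * Y \<omega>)"
proof -
  have "mdiff u j \<omega> * Y \<omega> =
      em (filter (\<lambda>x. fst x \<notin> {..j}) u) * (A (filter (\<lambda>x. fst x \<in> {..j}) u) \<omega> * Y \<omega>) -
      em (filter (\<lambda>x. fst x \<notin> {..<j}) u) * (A (filter (\<lambda>x. fst x \<in> {..<j}) u) \<omega> * Y \<omega>)" for \<omega>
    by (simp add: mdiff_def piece_def algebra_simps)
  then show ?thesis using assms by simp
qed

text \<open>Here \<open>Y\<close> may depend on entries with indices on both sides of \<open>j\<close>; this is more than the usual orthogonality
of martingale differences and holds because the entries are independent.\<close>

lemma expectation_mdiff_mult:
  assumes G: "G \<in> borel_measurable (Pi\<^sub>M (- {j}) (\<lambda>_. borel))"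
    and Y: "\<And>\<omega>. Y \<omega> = G (restrict (\<lambda>i. a i \<omega>) (- {j}))"
    and int: "\<And>v. integrable M (\<lambda>\<omega>. A v \<omega> * Y \<omega>)"
  shows "expectation (\<lambda>\<omega>. mdiff u j \<omega> * Y \<omega>) = 0"
proof -
  let ?l = "filter (\<lambda>x. fst x < j) u" and ?e = "filter (\<lambda>x. fst x = j) u" and ?g = "filter (\<lambda>x. fst x > j) u"
  have Gm: "(\<lambda>c. monom_of c ?l * G c) \<in> borel_measurable (Pi\<^sub>M (- {j}) (\<lambda>_. borel))"
    by (intro borel_measurable_times measurable_monom_of G) auto
  have Jd: "idx ?e \<inter> - {j} = {}" by auto
  have "monom_of (restrict (\<lambda>i. a i \<omega>) (- {j})) ?l = A ?l \<omega>" for \<omega>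
    unfolding A_def by (rule monom_of_cong) auto
  then have eq: "A ?l \<omega> * Y \<omega> = (\<lambda>c. monom_of c ?l * G c) (restrict (\<lambda>i. a i \<omega>) (- {j}))" for \<omega>
    by (simp add: Y)
  note indep = expectation_A_mult_indep[OF Gm Jd eq int]
  have "expectation (\<lambda>\<omega>. mdiff u j \<omega> * Y \<omega>) =
      expectation (\<lambda>\<omega>. em ?g * (A ?e \<omega> * (A ?l \<omega> * Y \<omega>) - em ?e * (A ?l \<omega> * Y \<omega>)))"
    unfolding mdiff_eq by (simp add: algebra_simps)
  also have "\<dots> = em ?g * (expectation (\<lambda>\<omega>. A ?e \<omega> * (A ?l \<omega> * Y \<omega>)) - expectation (\<lambda>\<omega>. em ?e * (A ?l \<omega> * Y \<omega>)))"
    using indep(2) int by (subst Bochner_Integration.integral_mult_right_zero, subst Bochner_Integration.integral_diff) auto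
  also have "\<dots> = 0" using indep(1) int by simp
  finally show ?thesis .
qed

lemma integrable_mult_iexp:
  assumes "integrable M X" "g \<in> borel_measurable M"
  shows "integrable M (\<lambda>\<omega>. X \<omega> * iexp (g \<omega>))"
proof (rule Bochner_Integration.integrable_bound[OF assms(1)])
  have [measurable]: "X \<in> borel_measurable M" "g \<in> borel_measurable M" using assms by auto
  show "(\<lambda>\<omega>. X \<omega> * iexp (g \<omega>)) \<in> borel_measurable M" by measurable
qed (simp add: norm_mult)

end

lemma norm_one_minus_iexp_le: "norm (1 - iexp (- y) - \<i> * of_real y) \<le> y\<^sup>2 / 2" for y :: real
proof -
  have "norm (iexp (- y) - (\<Sum>k\<le>1. (\<i> * of_real (- y)) ^ k / fact k)) \<le> \<bar>- y\<bar> ^ Suc 1 / fact (Suc 1)"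
    by (rule iexp_approx1)
  moreover have "iexp (- y) - (\<Sum>k\<le>1. (\<i> * of_real (- y)) ^ k / fact k) = - (1 - iexp (- y) - \<i> * of_real y)"
    by simp
  ultimately show ?thesis by (simp only: norm_minus_cancel) (simp add: power2_eq_square)
qed

context toeplitz_statistic
begin

definition \<phi> :: "int \<Rightarrow> 'a \<Rightarrow> complex" where
  "\<phi> j \<omega> = R (\<lambda>j. {..j}) j \<omega> - R (\<lambda>j. {..<j}) j \<omega>"

definition mean_f :: real where "mean_f = expectation f"

definition var_f :: real where "var_f = expectation (\<lambda>\<omega>. (f \<omega> - mean_f)\<^sup>2)"

lemma \<phi>_eq: "\<phi> j \<omega> = (\<Sum>u\<in>W. of_real (C u) * mdiff u j \<omega>)"
proof -
  have "\<phi> j \<omega> = (\<Sum>u\<in>{u\<in>W. j \<in> idx u}. of_real (C u) * mdiff u j \<omega>)"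
    by (simp add: \<phi>_def R_def mdiff_def sum_subtractf right_diff_distrib)
  also have "\<dots> = (\<Sum>u\<in>W. of_real (C u) * mdiff u j \<omega>)"
    using finite_W by (intro sum.mono_neutral_left) (auto simp: mdiff_eq_0 simp del: image_iff)
  finally show ?thesis .
qed

lemma integrable_f [simp]: "integrable M f"
proof -
  have "integrable M (\<lambda>\<omega>. complex_of_real (f \<omega>))" unfolding f_eq by simp
  then show ?thesis by (simp only: complex_of_real_integrable_eq)
qed

lemma measurable_f [measurable]: "f \<in> borel_measurable M"
  using integrable_f by (rule borel_measurable_integrable)

lemma mean_f_eq: "complex_of_real mean_f = (\<Sum>u\<in>W. of_real (C u) * em u)"
  unfolding mean_f_def integral_complex_of_real[symmetric] f_eq
  by (subst Bochner_Integration.integral_sum) (auto simp: em_def)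

lemma sum_\<phi>: "(\<Sum>j\<in>{l..h}. \<phi> j \<omega>) = complex_of_real (f \<omega> - mean_f)"
proof -
  have "(\<Sum>j\<in>{l..h}. \<phi> j \<omega>) = (\<Sum>u\<in>W. of_real (C u) * (\<Sum>j\<in>{l..h}. mdiff u j \<omega>))"
    unfolding \<phi>_eq sum_distrib_left by (rule sum.swap)
  also have "\<dots> = (\<Sum>u\<in>W. of_real (C u) * (A u \<omega> - em u))"
    using W_idx lh by (intro sum.cong) (auto simp: sum_mdiff)
  finally show ?thesis by (simp add: f_eq mean_f_eq right_diff_distrib sum_subtractf)
qed

lemma measurable_f_without [measurable]: "f_without j \<in> borel_measurable M"
proof -
  have "(\<lambda>\<omega>. Re (complex_of_real (f_without j \<omega>))) \<in> borel_measurable M"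
    unfolding f_without_eq by measurable
  then show ?thesis by simp
qed

lemma measurable_\<phi> [measurable]: "\<phi> j \<in> borel_measurable M"
  unfolding \<phi>_def[abs_def] by measurable

lemma integrable_\<phi>_mult:
  assumes "\<And>v. integrable M (\<lambda>\<omega>. A v \<omega> * Y \<omega>)"
  shows "integrable M (\<lambda>\<omega>. \<phi> j \<omega> * Y \<omega>)"
  unfolding \<phi>_eq sum_distrib_right mult.assoc using integrable_mdiff_mult[OF assms] by simp

lemma integrable_\<phi> [simp]: "integrable M (\<phi> j)"
  using integrable_\<phi>_mult[of "\<lambda>_. 1"] by simp

lemma expectation_\<phi>_mult_indep:
  assumes "G \<in> borel_measurable (Pi\<^sub>M (- {j}) (\<lambda>_. borel))" "\<And>\<omega>. Y \<omega> = G (restrict (\<lambda>i. a i \<omega>) (- {j}))"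
    and int: "\<And>v. integrable M (\<lambda>\<omega>. A v \<omega> * Y \<omega>)"
  shows "expectation (\<lambda>\<omega>. \<phi> j \<omega> * Y \<omega>) = 0"
proof -
  have "expectation (\<lambda>\<omega>. \<phi> j \<omega> * Y \<omega>) = (\<Sum>u\<in>W. of_real (C u) * expectation (\<lambda>\<omega>. mdiff u j \<omega> * Y \<omega>))"
    unfolding \<phi>_eq sum_distrib_right mult.assoc using integrable_mdiff_mult[OF int]
    by (subst Bochner_Integration.integral_sum) auto
  then show ?thesis using expectation_mdiff_mult[OF assms] by simp
qed

text \<open>Replacing \<open>a\<^sub>j\<close> by \<open>0\<close> leaves a function of the other entries, to which
the orthogonality of \<open>\<phi> j\<close> applies.\<close>

lemma f_without_as_function:
  defines "g j c \<equiv> (\<Sum>u\<in>{u\<in>W. j \<notin> idx u}. of_real (C u) * monom_of c u)"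
  shows "g j \<in> borel_measurable (Pi\<^sub>M (- {j}) (\<lambda>_. borel))"
    and "g j (restrict (\<lambda>i. a i \<omega>) (- {j})) = complex_of_real (f_without j \<omega>)"
proof -
  show "g j \<in> borel_measurable (Pi\<^sub>M (- {j}) (\<lambda>_. borel))" unfolding g_def
    by (intro borel_measurable_sum borel_measurable_times measurable_monom_of) auto
  show "g j (restrict (\<lambda>i. a i \<omega>) (- {j})) = complex_of_real (f_without j \<omega>)"
    unfolding g_def f_without_eq A_def
    by (intro sum.cong refl arg_cong2[of _ _ _ _ "(*)"] monom_of_cong) auto
qed

lemma integrable_A_mult_f_without: "integrable M (\<lambda>\<omega>. A v \<omega> * complex_of_real (f_without j \<omega>))"
proof -
  have "A v \<omega> * complex_of_real (f_without j \<omega>) = (\<Sum>u\<in>{u\<in>W. j \<notin> idx u}. of_real (C u) * A (v @ u) \<omega>)" for \<omega>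
    unfolding f_without_eq sum_distrib_left by (intro sum.cong) (auto simp: A_append)
  then show ?thesis by simp
qed

lemma expectation_\<phi>_f_without: "expectation (\<lambda>\<omega>. \<phi> j \<omega> * complex_of_real (f_without j \<omega>)) = 0"
  by (rule expectation_\<phi>_mult_indep[OF f_without_as_function(1) f_without_as_function(2)[symmetric]
      integrable_A_mult_f_without])

lemma expectation_\<phi>_iexp_f_without:
  "expectation (\<lambda>\<omega>. \<phi> j \<omega> * iexp (t * f_without j \<omega>)) = 0"
proof (rule expectation_\<phi>_mult_indep)
  let ?g = "\<lambda>c. \<Sum>u\<in>{u\<in>W. j \<notin> idx u}. of_real (C u) * monom_of c u"
  note [measurable] = f_without_as_function(1)[of j]
  show "(\<lambda>c. iexp (t * Re (?g c))) \<in> borel_measurable (Pi\<^sub>M (- {j}) (\<lambda>_. borel))" by measurable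
  show "iexp (t * f_without j \<omega>) = iexp (t * Re (?g (restrict (\<lambda>i. a i \<omega>) (- {j}))))" for \<omega>
    by (simp only: f_without_as_function(2) Re_complex_of_real)
  show "integrable M (\<lambda>\<omega>. A v \<omega> * iexp (t * f_without j \<omega>))" for v
    by (intro integrable_mult_iexp) (simp, measurable)
qed

lemma integrable_\<phi>_mult_R: "integrable M (\<lambda>\<omega>. \<phi> j \<omega> * R (\<lambda>_. UNIV) i \<omega>)"
proof (rule integrable_\<phi>_mult)
  have "A v \<omega> * R (\<lambda>_. UNIV) i \<omega> = (\<Sum>u\<in>{u\<in>W. i \<in> idx u}. of_real (C u) * A (v @ u) \<omega>)" for v \<omega>
    unfolding R_def piece_UNIV sum_distrib_left by (intro sum.cong) (auto simp: A_append)
  then show "integrable M (\<lambda>\<omega>. A v \<omega> * R (\<lambda>_. UNIV) i \<omega>)" for v by simp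
qed

lemma expectation_norm_le_sqrt:
  fixes X :: "'a \<Rightarrow> complex"
  assumes "integrable M X" "integrable M (\<lambda>\<omega>. (norm (X \<omega>))\<^sup>2)" "expectation (\<lambda>\<omega>. (norm (X \<omega>))\<^sup>2) \<le> c"
  shows "expectation (\<lambda>\<omega>. norm (X \<omega>)) \<le> sqrt c"
proof -
  have "0 \<le> variance (\<lambda>\<omega>. norm (X \<omega>))" by (rule variance_positive)
  also have "\<dots> = expectation (\<lambda>\<omega>. (norm (X \<omega>))\<^sup>2) - (expectation (\<lambda>\<omega>. norm (X \<omega>)))\<^sup>2"
    using assms by (intro variance_eq) auto
  finally have "(expectation (\<lambda>\<omega>. norm (X \<omega>)))\<^sup>2 \<le> c" using assms(3) by simp
  then show ?thesis by (rule real_le_rsqrt)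
qed

text \<open>The random variable whose mean is the variance of the statistic and whose concentration is
responsible for the Gaussian limit.\<close>

definition Tsum :: "'a \<Rightarrow> complex" where
  "Tsum \<omega> = (\<Sum>j\<in>{l..h}. \<phi> j \<omega> * R (\<lambda>_. UNIV) j \<omega>)"

lemma Tsum_eq: "Tsum \<omega> = Ssum (\<lambda>j. {..j}) \<omega> - Ssum (\<lambda>j. {..<j}) \<omega>"
  by (simp add: Tsum_def Ssum_def \<phi>_def left_diff_distrib sum_subtractf)

lemma integrable_Tsum [simp]: "integrable M Tsum"
  unfolding Tsum_eq[abs_def] by simp

lemma expectation_norm_Tsum_le:
  "expectation (\<lambda>\<omega>. norm (Tsum \<omega> - expectation Tsum)) \<le> 2 * sqrt (2 * K4 * (real Lm)\<^sup>2 * Gsum)"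
proof -
  let ?S = "Ssum (\<lambda>j. {..j})" and ?S' = "Ssum (\<lambda>j. {..<j})"
  have E: "expectation Tsum = expectation ?S - expectation ?S'"
    unfolding Tsum_eq[abs_def] by simp
  have "expectation (\<lambda>\<omega>. norm (Tsum \<omega> - expectation Tsum)) \<le>
     expectation (\<lambda>\<omega>. norm (?S \<omega> - expectation ?S) + norm (?S' \<omega> - expectation ?S'))"
  proof (rule integral_mono)
    show "norm (Tsum \<omega> - expectation Tsum) \<le> norm (?S \<omega> - expectation ?S) + norm (?S' \<omega> - expectation ?S')" for \<omega>
      unfolding E Tsum_eq
      using norm_triangle_ineq4[of "?S \<omega> - expectation ?S" "?S' \<omega> - expectation ?S'"] by (simp add: algebra_simps)
  qed auto
  also have "\<dots> = expectation (\<lambda>\<omega>. norm (?S \<omega> - expectation ?S)) + expectation (\<lambda>\<omega>. norm (?S' \<omega> - expectation ?S'))"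
    by (intro Bochner_Integration.integral_add) auto
  also have "expectation (\<lambda>\<omega>. norm (?S \<omega> - expectation ?S)) \<le> sqrt (2 * K4 * (real Lm)\<^sup>2 * Gsum)"
    by (intro expectation_norm_le_sqrt variance_Ssum_le) auto
  also have "expectation (\<lambda>\<omega>. norm (?S' \<omega> - expectation ?S')) \<le> sqrt (2 * K4 * (real Lm)\<^sup>2 * Gsum)"
    by (intro expectation_norm_le_sqrt variance_Ssum_le) auto
  finally show ?thesis by simp
qed

lemma integrable_f_square: "integrable M (\<lambda>\<omega>. (f \<omega>)\<^sup>2)"
proof -
  have "complex_of_real ((f \<omega>)\<^sup>2) = (\<Sum>(u,v)\<in>W \<times> W. of_real (C u * C v) * A (u @ v) \<omega>)" for \<omega>
    unfolding power2_eq_square of_real_mult f_eq sum_product sum.cartesian_product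
    by (intro sum.cong) (auto simp: A_append)
  then have "integrable M (\<lambda>\<omega>. complex_of_real ((f \<omega>)\<^sup>2))" by (simp add: split_beta)
  then show ?thesis by (simp only: complex_of_real_integrable_eq)
qed

text \<open>\<open>E (\<phi>\<^sub>j (f - f\<^sub>j)) = E (\<phi>\<^sub>j f)\<close> because \<open>\<phi>\<^sub>j\<close> is orthogonal to the statistic \<open>f\<^sub>j\<close> without the entry \<open>a\<^sub>j\<close>;
summing the increments gives \<open>E ((f - E f) f)\<close>.\<close>

lemma expectation_Tsum: "expectation Tsum = of_real var_f"
proof -
  have i1: "integrable M (\<lambda>\<omega>. \<phi> j \<omega> * complex_of_real (f_without j \<omega>))" for j
    by (rule integrable_\<phi>_mult[OF integrable_A_mult_f_without])
  have eq: "\<phi> j \<omega> * complex_of_real (f \<omega>) = \<phi> j \<omega> * R (\<lambda>_. UNIV) j \<omega> + \<phi> j \<omega> * complex_of_real (f_without j \<omega>)" for j \<omega>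
    by (simp add: R_UNIV algebra_simps)
  have i2: "integrable M (\<lambda>\<omega>. \<phi> j \<omega> * complex_of_real (f \<omega>))" for j
    unfolding eq using i1 integrable_\<phi>_mult_R by simp
  have "expectation (\<lambda>\<omega>. \<phi> j \<omega> * R (\<lambda>_. UNIV) j \<omega>) = expectation (\<lambda>\<omega>. \<phi> j \<omega> * complex_of_real (f \<omega>))" for j
    unfolding eq using i1 integrable_\<phi>_mult_R by (simp add: expectation_\<phi>_f_without)
  then have "expectation Tsum = (\<Sum>j\<in>{l..h}. expectation (\<lambda>\<omega>. \<phi> j \<omega> * complex_of_real (f \<omega>)))"
    unfolding Tsum_def[abs_def] using integrable_\<phi>_mult_R by (subst Bochner_Integration.integral_sum) auto
  also have "\<dots> = expectation (\<lambda>\<omega>. \<Sum>j\<in>{l..h}. \<phi> j \<omega> * complex_of_real (f \<omega>))"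
    using i2 by (subst Bochner_Integration.integral_sum) auto
  also have "\<dots> = expectation (\<lambda>\<omega>. complex_of_real ((f \<omega> - mean_f) * f \<omega>))"
    by (simp only: sum_distrib_right[symmetric] sum_\<phi> of_real_mult)
  also have "\<dots> = complex_of_real (expectation (\<lambda>\<omega>. (f \<omega> - mean_f) * f \<omega>))"
    by (rule integral_complex_of_real)
  also have "expectation (\<lambda>\<omega>. (f \<omega> - mean_f) * f \<omega>) = expectation (\<lambda>\<omega>. (f \<omega>)\<^sup>2 - mean_f * f \<omega>)"
    by (simp add: algebra_simps power2_eq_square)
  also have "\<dots> = expectation (\<lambda>\<omega>. (f \<omega>)\<^sup>2) - mean_f * mean_f"
    using integrable_f_square by (simp add: mean_f_def)
  also have "\<dots> = var_f"
    unfolding var_f_def mean_f_def using variance_eq[OF integrable_f integrable_f_square] by (simp add: power2_eq_square)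
  finally show ?thesis .
qed

lemma \<phi>_power4_le: "norm (\<phi> j \<omega>) ^ 4 \<le> 8 * (norm (R (\<lambda>j. {..j}) j \<omega>) ^ 4 + norm (R (\<lambda>j. {..<j}) j \<omega>) ^ 4)"
proof -
  have sq: "(x + y)\<^sup>2 \<le> 2 * (x\<^sup>2 + y\<^sup>2)" for x y :: real
    using sum_squares_bound[of x y] by (simp add: power2_sum)
  let ?x = "norm (R (\<lambda>j. {..j}) j \<omega>)" and ?y = "norm (R (\<lambda>j. {..<j}) j \<omega>)"
  have "norm (\<phi> j \<omega>) ^ 4 \<le> (?x + ?y) ^ 4"
    unfolding \<phi>_def by (intro power_mono norm_triangle_ineq4) auto
  also have "\<dots> = ((?x + ?y)\<^sup>2)\<^sup>2" by (simp flip: power_mult)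
  also have "\<dots> \<le> (2 * (?x\<^sup>2 + ?y\<^sup>2))\<^sup>2" by (intro power_mono sq) auto
  also have "\<dots> = 4 * (?x\<^sup>2 + ?y\<^sup>2)\<^sup>2" by (simp only: power_mult_distrib) simp
  also have "\<dots> \<le> 4 * (2 * ((?x\<^sup>2)\<^sup>2 + (?y\<^sup>2)\<^sup>2))" using sq[of "?x\<^sup>2" "?y\<^sup>2"] by (intro mult_left_mono) auto
  finally show ?thesis by (simp flip: power_mult)
qed

text \<open>\<open>mult_square_le_fourth\<close> is applied to each summand. The factor \<open>17 = 2 * 8 + 1\<close> counts the two conditioned
parts of the increment, with the constant \<open>8\<close> of \<open>\<phi>_power4_le\<close>, and the change of the statistic.\<close>

lemma third_order_le:
  assumes "s > 0"
  shows "integrable M (\<lambda>\<omega>. norm (\<phi> j \<omega>) * (f \<omega> - f_without j \<omega>)\<^sup>2)"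
    "(\<Sum>j\<in>{l..h}. expectation (\<lambda>\<omega>. norm (\<phi> j \<omega>) * (f \<omega> - f_without j \<omega>)\<^sup>2)) \<le>
       17 * s * K4 * Lm * Gsum + (h - l + 1) / s ^ 3"
proof -
  let ?B = "\<lambda>s j \<omega>. s * (8 * (norm (R (\<lambda>j. {..j}) j \<omega>) ^ 4 + norm (R (\<lambda>j. {..<j}) j \<omega>) ^ 4) +
      norm (R (\<lambda>_. UNIV) j \<omega>) ^ 4) + 1 / s ^ 3"
  have le: "norm (\<phi> j \<omega>) * (f \<omega> - f_without j \<omega>)\<^sup>2 \<le> ?B s j \<omega>" for j \<omega>
  proof -
    have "norm (\<phi> j \<omega>) * (f \<omega> - f_without j \<omega>)\<^sup>2 = norm (\<phi> j \<omega>) * (norm (R (\<lambda>_. UNIV) j \<omega>))\<^sup>2"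
      unfolding R_UNIV norm_of_real by simp
    also have "\<dots> \<le> s * (norm (\<phi> j \<omega>) ^ 4 + norm (R (\<lambda>_. UNIV) j \<omega>) ^ 4) + 1 / s ^ 3"
      using assms by (intro mult_square_le_fourth) auto
    also have "\<dots> \<le> ?B s j \<omega>" using assms \<phi>_power4_le[of j \<omega>] by simp
    finally show ?thesis .
  qed
  have intB: "integrable M (?B s j)" for j
    by (intro Bochner_Integration.integrable_add integrable_mult_right integrable_R4 integrable_const)
  show int: "integrable M (\<lambda>\<omega>. norm (\<phi> j \<omega>) * (f \<omega> - f_without j \<omega>)\<^sup>2)" for j
  proof (rule Bochner_Integration.integrable_bound[OF intB[of j]])
    show "AE \<omega> in M. norm (norm (\<phi> j \<omega>) * (f \<omega> - f_without j \<omega>)\<^sup>2) \<le> norm (?B s j \<omega>)"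
      using le by (intro AE_I2) (auto intro!: order_trans[OF _ abs_ge_self])
  qed measurable
  have "(\<Sum>j\<in>{l..h}. expectation (\<lambda>\<omega>. norm (\<phi> j \<omega>) * (f \<omega> - f_without j \<omega>)\<^sup>2)) \<le> (\<Sum>j\<in>{l..h}. expectation (?B s j))"
    using le int intB by (intro sum_mono integral_mono)
  also have "\<dots> = (\<Sum>j\<in>{l..h}. s * (8 * (expectation (\<lambda>\<omega>. norm (R (\<lambda>j. {..j}) j \<omega>) ^ 4) + expectation (\<lambda>\<omega>. norm (R (\<lambda>j. {..<j}) j \<omega>) ^ 4)) +
      expectation (\<lambda>\<omega>. norm (R (\<lambda>_. UNIV) j \<omega>) ^ 4)) + 1 / s ^ 3)"
    using integrable_R4 by (simp add: prob_space)
  also have "\<dots> = s * (8 * ((\<Sum>j\<in>{l..h}. expectation (\<lambda>\<omega>. norm (R (\<lambda>j. {..j}) j \<omega>) ^ 4)) + (\<Sum>j\<in>{l..h}. expectation (\<lambda>\<omega>. norm (R (\<lambda>j. {..<j}) j \<omega>) ^ 4))) +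
      (\<Sum>j\<in>{l..h}. expectation (\<lambda>\<omega>. norm (R (\<lambda>_. UNIV) j \<omega>) ^ 4))) + (h - l + 1) / s ^ 3"
    using lh by (simp add: sum.distrib sum_distrib_left[symmetric])
  also have "\<dots> \<le> s * (8 * (K4 * Lm * Gsum + K4 * Lm * Gsum) + K4 * Lm * Gsum) + (h - l + 1) / s ^ 3"
    using assms by (intro add_right_mono mult_left_mono add_mono sum_expectation_R4_le) auto
  finally show "(\<Sum>j\<in>{l..h}. expectation (\<lambda>\<omega>. norm (\<phi> j \<omega>) * (f \<omega> - f_without j \<omega>)\<^sup>2)) \<le>
       17 * s * K4 * Lm * Gsum + (h - l + 1) / s ^ 3"
    by (simp add: algebra_simps)
qed

text \<open>An approximate form of the identity \<open>E ((f - E f) g (f)) = Var f E (g' (f))\<close>, which is exact for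
Gaussian \<open>f\<close>, for \<open>g (x) = exp (i t x)\<close>. With \<open>f - E f = \<Sum>\<^sub>j \<phi>\<^sub>j\<close> and \<open>f\<^sub>j\<close> the statistic without \<open>a\<^sub>j\<close>,
the term \<open>E (\<phi>\<^sub>j exp (i t f\<^sub>j))\<close> is zero, so only the increment of the exponential between \<open>f\<^sub>j\<close> and \<open>f\<close>
matters. Its linear part sums to \<open>i t E (T exp (i t f))\<close> with \<open>T = Tsum\<close>, and \<open>T\<close> may be replaced
by its mean \<open>Var f\<close> since it is concentrated; its quadratic remainder is a third-order term.\<close>

lemma stein_bound:
  assumes s: "s > 0"
  shows "norm (expectation (\<lambda>\<omega>. of_real (f \<omega> - mean_f) * iexp (t * f \<omega>)) -
           \<i> * of_real (t * var_f) * expectation (\<lambda>\<omega>. iexp (t * f \<omega>))) \<le>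
    \<bar>t\<bar> * (2 * sqrt (2 * K4 * (real Lm)\<^sup>2 * Gsum)) + t\<^sup>2 / 2 * (17 * s * K4 * Lm * Gsum + (h - l + 1) / s ^ 3)"
proof -
  let ?D = "\<lambda>j \<omega>. f \<omega> - f_without j \<omega>"
  let ?e = "\<lambda>\<omega>. iexp (t * f \<omega>)"
  define \<rho> where "\<rho> j \<omega> = \<phi> j \<omega> * ?e \<omega> * (1 - iexp (- (t * ?D j \<omega>)) - \<i> * of_real (t * ?D j \<omega>))" for j \<omega>
  have tf: "(\<lambda>\<omega>. t * f \<omega>) \<in> borel_measurable M" "(\<lambda>\<omega>. t * f_without j \<omega>) \<in> borel_measurable M" for j
    by measurable
  have i1: "integrable M (\<lambda>\<omega>. \<phi> j \<omega> * ?e \<omega>)" for j by (intro integrable_mult_iexp tf) simp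
  have i2: "integrable M (\<lambda>\<omega>. \<phi> j \<omega> * iexp (t * f_without j \<omega>))" for j by (intro integrable_mult_iexp tf) simp
  have i3: "integrable M (\<lambda>\<omega>. \<phi> j \<omega> * R (\<lambda>_. UNIV) j \<omega> * ?e \<omega>)" for j
    by (intro integrable_mult_iexp tf integrable_\<phi>_mult_R)
  \<comment> \<open>\<open>\<rho> j\<close> is the second-order Taylor remainder of the exponential between the statistic
    without \<open>a\<^sub>j\<close> and the full statistic.\<close>
  have split: "\<phi> j \<omega> * ?e \<omega> = \<phi> j \<omega> * iexp (t * f_without j \<omega>) + \<i> * of_real t * (\<phi> j \<omega> * R (\<lambda>_. UNIV) j \<omega> * ?e \<omega>) + \<rho> j \<omega>" for j \<omega>
  proof -
    have "iexp (t * f_without j \<omega>) = ?e \<omega> * iexp (- (t * ?D j \<omega>))"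
      by (simp add: exp_add[symmetric] algebra_simps)
    then show ?thesis by (simp only: \<rho>_def R_UNIV) (simp add: algebra_simps)
  qed
  have \<rho>: "\<rho> j = (\<lambda>\<omega>. \<phi> j \<omega> * ?e \<omega> - \<phi> j \<omega> * iexp (t * f_without j \<omega>) - \<i> * of_real t * (\<phi> j \<omega> * R (\<lambda>_. UNIV) j \<omega> * ?e \<omega>))" for j
    using split[of j] by (auto simp: fun_eq_iff)
  have i\<rho>: "integrable M (\<rho> j)" for j unfolding \<rho> using i1 i2 i3 by auto
  have E\<rho>: "norm (expectation (\<rho> j)) \<le> t\<^sup>2 / 2 * expectation (\<lambda>\<omega>. norm (\<phi> j \<omega>) * (?D j \<omega>)\<^sup>2)" for j
  proof -
    have "norm (expectation (\<rho> j)) \<le> expectation (\<lambda>\<omega>. t\<^sup>2 / 2 * (norm (\<phi> j \<omega>) * (?D j \<omega>)\<^sup>2))"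
    proof (rule order_trans[OF integral_norm_bound integral_mono])
      show "integrable M (\<lambda>\<omega>. t\<^sup>2 / 2 * (norm (\<phi> j \<omega>) * (?D j \<omega>)\<^sup>2))"
        by (intro integrable_mult_right third_order_le(1)[OF s])
      fix \<omega>
      have "norm (\<rho> j \<omega>) = norm (\<phi> j \<omega>) * norm (1 - iexp (- (t * ?D j \<omega>)) - \<i> * of_real (t * ?D j \<omega>))"
        unfolding \<rho>_def norm_mult by simp
      also have "\<dots> \<le> norm (\<phi> j \<omega>) * ((t * ?D j \<omega>)\<^sup>2 / 2)"
        by (intro mult_left_mono norm_one_minus_iexp_le) auto
      finally show "norm (\<rho> j \<omega>) \<le> t\<^sup>2 / 2 * (norm (\<phi> j \<omega>) * (?D j \<omega>)\<^sup>2)"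
        by (simp add: power_mult_distrib mult_ac)
    qed (use i\<rho> in auto)
    then show ?thesis by simp
  qed
  have Ej: "expectation (\<lambda>\<omega>. \<phi> j \<omega> * ?e \<omega>) = \<i> * of_real t * expectation (\<lambda>\<omega>. \<phi> j \<omega> * R (\<lambda>_. UNIV) j \<omega> * ?e \<omega>) + expectation (\<rho> j)" for j
    unfolding split using i2 i3 i\<rho> expectation_\<phi>_iexp_f_without[of j t] by simp
  have "expectation (\<lambda>\<omega>. of_real (f \<omega> - mean_f) * ?e \<omega>) = expectation (\<lambda>\<omega>. \<Sum>j\<in>{l..h}. \<phi> j \<omega> * ?e \<omega>)"
    by (simp only: sum_\<phi>[symmetric] sum_distrib_right)
  also have "\<dots> = (\<Sum>j\<in>{l..h}. expectation (\<lambda>\<omega>. \<phi> j \<omega> * ?e \<omega>))"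
    using i1 by (subst Bochner_Integration.integral_sum) auto
  also have "\<dots> = \<i> * of_real t * (\<Sum>j\<in>{l..h}. expectation (\<lambda>\<omega>. \<phi> j \<omega> * R (\<lambda>_. UNIV) j \<omega> * ?e \<omega>)) + (\<Sum>j\<in>{l..h}. expectation (\<rho> j))"
    unfolding Ej by (simp add: sum.distrib sum_distrib_left)
  also have "(\<Sum>j\<in>{l..h}. expectation (\<lambda>\<omega>. \<phi> j \<omega> * R (\<lambda>_. UNIV) j \<omega> * ?e \<omega>)) = expectation (\<lambda>\<omega>. Tsum \<omega> * ?e \<omega>)"
    unfolding Tsum_def sum_distrib_right using i3 by (subst Bochner_Integration.integral_sum) auto
  also have "\<dots> = expectation (\<lambda>\<omega>. (Tsum \<omega> - expectation Tsum) * ?e \<omega>) + expectation Tsum * expectation ?e"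
  proof -
    have "integrable M (\<lambda>\<omega>. (Tsum \<omega> - expectation Tsum) * ?e \<omega>)" by (intro integrable_mult_iexp tf) simp
    moreover have "integrable M (\<lambda>\<omega>. expectation Tsum * ?e \<omega>)" by (intro integrable_mult_iexp tf) simp
    ultimately have "expectation (\<lambda>\<omega>. (Tsum \<omega> - expectation Tsum) * ?e \<omega>) + expectation (\<lambda>\<omega>. expectation Tsum * ?e \<omega>) =
       expectation (\<lambda>\<omega>. (Tsum \<omega> - expectation Tsum) * ?e \<omega> + expectation Tsum * ?e \<omega>)"
      by (rule Bochner_Integration.integral_add[symmetric])
    then show ?thesis by (simp add: algebra_simps)
  qed
  finally have main: "expectation (\<lambda>\<omega>. of_real (f \<omega> - mean_f) * ?e \<omega>) - \<i> * of_real (t * var_f) * expectation ?e =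
      \<i> * of_real t * expectation (\<lambda>\<omega>. (Tsum \<omega> - expectation Tsum) * ?e \<omega>) + (\<Sum>j\<in>{l..h}. expectation (\<rho> j))"
    by (simp add: expectation_Tsum algebra_simps)
  have "norm (expectation (\<lambda>\<omega>. (Tsum \<omega> - expectation Tsum) * ?e \<omega>)) \<le> expectation (\<lambda>\<omega>. norm ((Tsum \<omega> - expectation Tsum) * ?e \<omega>))"
    by (rule integral_norm_bound)
  also have "\<dots> = expectation (\<lambda>\<omega>. norm (Tsum \<omega> - expectation Tsum))" by (simp add: norm_mult)
  also have "\<dots> \<le> 2 * sqrt (2 * K4 * (real Lm)\<^sup>2 * Gsum)" by (rule expectation_norm_Tsum_le)
  finally have b1: "norm (\<i> * of_real t * expectation (\<lambda>\<omega>. (Tsum \<omega> - expectation Tsum) * ?e \<omega>)) \<le> \<bar>t\<bar> * (2 * sqrt (2 * K4 * (real Lm)\<^sup>2 * Gsum))"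
    unfolding norm_mult by (auto intro!: mult_left_mono)
  have "norm (\<Sum>j\<in>{l..h}. expectation (\<rho> j)) \<le> (\<Sum>j\<in>{l..h}. t\<^sup>2 / 2 * expectation (\<lambda>\<omega>. norm (\<phi> j \<omega>) * (?D j \<omega>)\<^sup>2))"
    by (intro sum_norm_le E\<rho>)
  also have "\<dots> = t\<^sup>2 / 2 * (\<Sum>j\<in>{l..h}. expectation (\<lambda>\<omega>. norm (\<phi> j \<omega>) * (?D j \<omega>)\<^sup>2))" by (rule sum_distrib_left[symmetric])
  also have "\<dots> \<le> t\<^sup>2 / 2 * (17 * s * K4 * Lm * Gsum + (h - l + 1) / s ^ 3)"
    by (intro mult_left_mono third_order_le(2)[OF s]) auto
  finally show ?thesis unfolding main using b1 by (intro order_trans[OF norm_triangle_ineq] add_mono)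
qed

end

section \<open>Gaussian characteristic functions\<close>

text \<open>The quadratic bound comes for free from a finite second moment and replaces differentiation under
the integral sign.\<close>

lemma has_vector_derivative_quadraticI:
  fixes \<psi> :: "real \<Rightarrow> 'b :: real_normed_vector"
  assumes "\<And>x. norm (\<psi> x - \<psi> t - (x - t) *\<^sub>R D) \<le> c * (x - t)\<^sup>2"
  shows "(\<psi> has_vector_derivative D) (at t)"
  unfolding has_vector_derivative_def has_derivative_at_alt
proof (intro conjI allI impI)
  show "bounded_linear (\<lambda>x. x *\<^sub>R D)" by (rule bounded_linear_scaleR_left)
  fix e :: real assume e: "e > 0"
  define k where "k = \<bar>c\<bar> + 1"
  have k: "k > 0" "c \<le> k" by (auto simp: k_def)
  show "\<exists>d>0. \<forall>y. norm (y - t) < d \<longrightarrow> norm (\<psi> y - \<psi> t - (y - t) *\<^sub>R D) \<le> e * norm (y - t)"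
  proof (intro exI[of _ "e / k"] conjI allI impI)
    fix y assume y: "norm (y - t) < e / k"
    have "norm (\<psi> y - \<psi> t - (y - t) *\<^sub>R D) \<le> c * (y - t)\<^sup>2" by (rule assms)
    also have "\<dots> \<le> k * (y - t)\<^sup>2" using k by (intro mult_right_mono) auto
    also have "\<dots> = (k * norm (y - t)) * norm (y - t)" by (simp add: power2_eq_square)
    also have "\<dots> \<le> e * norm (y - t)" using y k by (intro mult_right_mono) (auto simp: field_simps)
    finally show "norm (\<psi> y - \<psi> t - (y - t) *\<^sub>R D) \<le> e * norm (y - t)" .
  qed (use e k in auto)
qed

lemma norm_iexp_minus_one_le: "norm (iexp y - 1 - \<i> * of_real y) \<le> y\<^sup>2 / 2" for y :: real
  using norm_one_minus_iexp_le[of "- y"] by (simp add: norm_minus_commute algebra_simps)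

text \<open>\<open>exp (- V t\<^sup>2 / 2)\<close> is the solution of \<open>\<psi>' = - t V \<psi>\<close> with \<open>\<psi> 0 = 1\<close>. The integrating factor
\<open>exp (V s\<^sup>2 / 2)\<close> turns an approximate solution into a function with a small derivative, and is at most
its value at \<open>t\<close>, which cancels at the end.\<close>

lemma gaussian_ode_bound:
  fixes \<psi> :: "real \<Rightarrow> complex"
  assumes d: "\<And>s. (\<psi> has_vector_derivative \<psi>' s) (at s)" and "\<psi> 0 = 1" and V: "V \<ge> 0"
    and b: "\<And>s. \<bar>s\<bar> \<le> \<bar>t\<bar> \<Longrightarrow> norm (\<psi>' s + of_real (s * V) * \<psi> s) \<le> \<epsilon>"
  shows "norm (\<psi> t - of_real (exp (- (V * t\<^sup>2 / 2)))) \<le> \<bar>t\<bar> * \<epsilon>"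
proof -
  define G where "G s = of_real (exp (V * s\<^sup>2 / 2)) * \<psi> s" for s
  define B where "B = \<epsilon> * exp (V * t\<^sup>2 / 2)"
  have dG: "(G has_vector_derivative (of_real (exp (V * s\<^sup>2 / 2)) * (\<psi>' s + of_real (s * V) * \<psi> s))) (at s)" for s
  proof -
    have "((\<lambda>s. exp (V * s\<^sup>2 / 2)) has_real_derivative (exp (V * s\<^sup>2 / 2) * (s * V))) (at s)"
      by (auto intro!: derivative_eq_intros simp: field_simps)
    then have "((\<lambda>s. complex_of_real (exp (V * s\<^sup>2 / 2))) has_vector_derivative of_real (exp (V * s\<^sup>2 / 2) * (s * V))) (at s)"
      by (intro has_vector_derivative_of_real) (simp add: has_real_derivative_iff_has_vector_derivative)
    from has_vector_derivative_mult[OF this d[of s]]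
    show ?thesis unfolding G_def[abs_def] by (simp add: algebra_simps)
  qed
  have "norm (G t - G 0) \<le> B * norm (t - 0)"
  proof (rule differentiable_bound[of "closed_segment 0 t" G "\<lambda>s x. x *\<^sub>R (of_real (exp (V * s\<^sup>2 / 2)) * (\<psi>' s + of_real (s * V) * \<psi> s))"])
    fix s assume s: "s \<in> closed_segment 0 t"
    then have st: "\<bar>s\<bar> \<le> \<bar>t\<bar>" by (auto simp: closed_segment_eq_real_ivl split: if_splits)
    show "(G has_derivative (\<lambda>x. x *\<^sub>R (of_real (exp (V * s\<^sup>2 / 2)) * (\<psi>' s + of_real (s * V) * \<psi> s)))) (at s within closed_segment 0 t)"
      using dG[of s] unfolding has_vector_derivative_def by (rule has_derivative_at_withinI)
    have "norm (of_real (exp (V * s\<^sup>2 / 2)) * (\<psi>' s + of_real (s * V) * \<psi> s)) \<le> exp (V * t\<^sup>2 / 2) * \<epsilon>"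
      unfolding norm_mult
    proof (intro mult_mono b st)
      have "s\<^sup>2 \<le> t\<^sup>2" using st by (simp add: abs_le_square_iff)
      then show "norm (complex_of_real (exp (V * s\<^sup>2 / 2))) \<le> exp (V * t\<^sup>2 / 2)"
        using V by (auto intro!: mult_left_mono)
    qed auto
    then show "onorm (\<lambda>x. x *\<^sub>R (of_real (exp (V * s\<^sup>2 / 2)) * (\<psi>' s + of_real (s * V) * \<psi> s))) \<le> B"
      by (intro onorm_le) (auto simp: B_def mult.commute intro!: mult_left_mono)
  qed auto
  then have "norm (G t - 1) \<le> B * \<bar>t\<bar>" using assms(2) by (simp add: G_def)
  moreover have "\<psi> t - of_real (exp (- (V * t\<^sup>2 / 2))) = of_real (exp (- (V * t\<^sup>2 / 2))) * (G t - 1)"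
    by (simp add: G_def right_diff_distrib exp_minus flip: of_real_mult mult.assoc)
  ultimately have "norm (\<psi> t - of_real (exp (- (V * t\<^sup>2 / 2)))) \<le> exp (- (V * t\<^sup>2 / 2)) * (B * \<bar>t\<bar>)"
    by (simp add: norm_mult mult_left_mono)
  also have "\<dots> = \<bar>t\<bar> * \<epsilon>" by (simp add: B_def exp_minus field_simps)
  finally show ?thesis .
qed

lemma real_distribution_normal_law: "v \<ge> 0 \<Longrightarrow> real_distribution (normal_law 0 v)"
proof (cases "v = 0")
  case True
  then show ?thesis
    by (simp add: normal_law_def real_distribution_def real_distribution_axioms_def prob_space_return)
next
  case False
  assume "v \<ge> 0"
  then show ?thesis using False
    by (auto simp: normal_law_def real_distribution_def real_distribution_axioms_def intro!: prob_space_normal_density)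
qed

lemma char_normal_law:
  assumes "v \<ge> 0"
  shows "char (normal_law 0 v) t = of_real (exp (- (v * t\<^sup>2 / 2)))"
proof (cases "v = 0")
  case True
  then show ?thesis by (simp add: normal_law_def char_def integral_return)
next
  case False
  define \<sigma> where "\<sigma> = sqrt v"
  have \<sigma>: "\<sigma> > 0" "\<sigma>\<^sup>2 = v" using assms False by (auto simp: \<sigma>_def)
  interpret N: prob_space "std_normal_distribution" by (rule prob_space_normal_density) simp
  have "distributed std_normal_distribution lborel (\<lambda>x. x) std_normal_density"
    by (auto simp: distributed_def distr_id2)
  from N.normal_density_affine[OF this, of \<sigma> 0] \<sigma>
  have "distributed std_normal_distribution lborel (\<lambda>x. \<sigma> * x) (normal_density 0 \<sigma>)" by simp
  then have "distr std_normal_distribution lborel (\<lambda>x. \<sigma> * x) = density lborel (normal_density 0 \<sigma>)"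
    by (simp add: distributed_def)
  then have nl: "normal_law 0 v = distr std_normal_distribution borel (\<lambda>x. \<sigma> * x)"
    using False by (simp add: normal_law_def \<sigma>_def cong: distr_cong)
  have "char (normal_law 0 v) t = char std_normal_distribution (t * \<sigma>)"
    unfolding char_def nl by (subst integral_distr) (auto simp: mult_ac)
  then show ?thesis using \<sigma> by (simp add: char_std_normal_distribution power_mult_distrib mult.commute)
qed

context toeplitz_statistic
begin

text \<open>The Stein bound says that the characteristic function of the centred statistic
approximately satisfies the differential equation of a Gaussian characteristic function.\<close>

lemma char_ode_bound:
  assumes s: "s > 0"
    and e: "\<epsilon> = \<bar>t\<bar> * (2 * sqrt (2 * K4 * (real Lm)\<^sup>2 * Gsum)) + t\<^sup>2 / 2 * (17 * s * K4 * Lm * Gsum + (h - l + 1) / s ^ 3)"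
  shows "norm (char (distr M borel (\<lambda>\<omega>. f \<omega> - mean_f)) t - of_real (exp (- (var_f * t\<^sup>2 / 2)))) \<le> \<bar>t\<bar> * \<epsilon>"
proof -
  define g where "g \<omega> = f \<omega> - mean_f" for \<omega>
  define \<psi> where "\<psi> t = expectation (\<lambda>\<omega>. iexp (t * g \<omega>))" for t
  define \<psi>' where "\<psi>' t = \<i> * expectation (\<lambda>\<omega>. of_real (g \<omega>) * iexp (t * g \<omega>))" for t
  have [measurable]: "g \<in> borel_measurable M" unfolding g_def[abs_def] by measurable
  have ig: "integrable M g" unfolding g_def[abs_def] by simp
  have ig2: "integrable M (\<lambda>\<omega>. (g \<omega>)\<^sup>2)"
    unfolding g_def power2_diff using integrable_f_square by simp
  have ie: "integrable M (\<lambda>\<omega>. iexp (t * g \<omega>))" for t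
    using integrable_mult_iexp[of "\<lambda>_. 1" "\<lambda>\<omega>. t * g \<omega>"] by simp
  have ige: "integrable M (\<lambda>\<omega>. of_real (g \<omega>) * iexp (t * g \<omega>))" for t
    using ig by (intro integrable_mult_iexp) auto
  have char: "char (distr M borel (\<lambda>\<omega>. f \<omega> - mean_f)) t = \<psi> t"
    unfolding char_def \<psi>_def g_def by (subst integral_distr) auto
  have d: "(\<psi> has_vector_derivative \<psi>' t) (at t)" for t
  proof (rule has_vector_derivative_quadraticI)
    fix x
    have "\<psi> x - \<psi> t - (x - t) *\<^sub>R \<psi>' t = expectation (\<lambda>\<omega>. iexp (x * g \<omega>) - iexp (t * g \<omega>) - of_real (x - t) * \<i> * (of_real (g \<omega>) * iexp (t * g \<omega>)))"
      unfolding \<psi>_def \<psi>'_def using ie ige by (simp add: scaleR_conv_of_real mult.assoc)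
    also have "norm \<dots> \<le> expectation (\<lambda>\<omega>. (x - t)\<^sup>2 / 2 * (g \<omega>)\<^sup>2)"
    proof (rule order_trans[OF integral_norm_bound integral_mono])
      fix \<omega>
      have "iexp (x * g \<omega>) = iexp ((x - t) * g \<omega>) * iexp (t * g \<omega>)" by (simp add: exp_add[symmetric] algebra_simps)
      then have "iexp (x * g \<omega>) - iexp (t * g \<omega>) - of_real (x - t) * \<i> * (of_real (g \<omega>) * iexp (t * g \<omega>)) =
         (iexp ((x - t) * g \<omega>) - 1 - \<i> * of_real ((x - t) * g \<omega>)) * iexp (t * g \<omega>)"
        by (simp only:) (simp add: algebra_simps)
      then have "norm (iexp (x * g \<omega>) - iexp (t * g \<omega>) - of_real (x - t) * \<i> * (of_real (g \<omega>) * iexp (t * g \<omega>))) =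
         norm (iexp ((x - t) * g \<omega>) - 1 - \<i> * of_real ((x - t) * g \<omega>))"
        by (simp only: norm_mult) simp
      also have "\<dots> \<le> ((x - t) * g \<omega>)\<^sup>2 / 2" by (rule norm_iexp_minus_one_le)
      finally show "norm (iexp (x * g \<omega>) - iexp (t * g \<omega>) - of_real (x - t) * \<i> * (of_real (g \<omega>) * iexp (t * g \<omega>))) \<le> (x - t)\<^sup>2 / 2 * (g \<omega>)\<^sup>2"
        by (simp add: power_mult_distrib)
    qed (use ie ige ig2 in auto)
    also have "\<dots> = expectation (\<lambda>\<omega>. (g \<omega>)\<^sup>2) / 2 * (x - t)\<^sup>2" by simp
    finally show "norm (\<psi> x - \<psi> t - (x - t) *\<^sub>R \<psi>' t) \<le> expectation (\<lambda>\<omega>. (g \<omega>)\<^sup>2) / 2 * (x - t)\<^sup>2" .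
  qed
  have bound: "norm (\<psi>' u + of_real (u * var_f) * \<psi> u) \<le> \<epsilon>" if u: "\<bar>u\<bar> \<le> \<bar>t\<bar>" for u
  proof -
    let ?X = "expectation (\<lambda>\<omega>. of_real (f \<omega> - mean_f) * iexp (u * f \<omega>))" and ?Y = "expectation (\<lambda>\<omega>. iexp (u * f \<omega>))"
    have ex: "iexp (u * g \<omega>) = iexp (- u * mean_f) * iexp (u * f \<omega>)" for \<omega>
      by (simp add: g_def exp_add[symmetric] algebra_simps)
    have "\<psi>' u = \<i> * iexp (- u * mean_f) * ?X"
      unfolding \<psi>'_def ex by (simp add: g_def mult.left_commute[of _ "exp _"] mult.assoc)
    moreover have "\<psi> u = iexp (- u * mean_f) * ?Y" unfolding \<psi>_def ex by simp
    ultimately have "\<psi>' u + of_real (u * var_f) * \<psi> u = \<i> * iexp (- u * mean_f) * (?X - \<i> * of_real (u * var_f) * ?Y)"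
      by (simp add: algebra_simps)
    then have "norm (\<psi>' u + of_real (u * var_f) * \<psi> u) = norm (?X - \<i> * of_real (u * var_f) * ?Y)"
      by (simp only: norm_mult) simp
    also have "\<dots> \<le> \<bar>u\<bar> * (2 * sqrt (2 * K4 * (real Lm)\<^sup>2 * Gsum)) + u\<^sup>2 / 2 * (17 * s * K4 * Lm * Gsum + (h - l + 1) / s ^ 3)"
      by (rule stein_bound[OF s])
    also have "\<dots> \<le> \<epsilon>"
    proof -
      have G0: "Gsum \<ge> 0" unfolding Gsum_def by (intro sum_nonneg) auto
      have "0 \<le> 17 * s * K4 * Lm * Gsum" using s G0 K4_nonneg by (intro mult_nonneg_nonneg) auto
      moreover have "0 \<le> (h - l + 1) / s ^ 3" using s lh by (intro divide_nonneg_pos) auto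
      moreover have "u\<^sup>2 \<le> t\<^sup>2" using u by (simp add: abs_le_square_iff)
      ultimately show ?thesis unfolding e using u G0 K4_nonneg by (intro add_mono mult_right_mono) auto
    qed
    finally show ?thesis .
  qed
  have "var_f \<ge> 0" unfolding var_f_def by (rule Bochner_Integration.integral_nonneg) simp
  moreover have "\<psi> 0 = 1" by (simp add: \<psi>_def prob_space)
  ultimately show ?thesis unfolding char using gaussian_ode_bound[OF d _ _ bound] by blast
qed

end

section \<open>Lattice sums as Riemann sums\<close>

interpretation lborel_product: product_sigma_finite "\<lambda>_ :: nat. lborel :: real measure"
  by standard

text \<open>A hyperplane is a null set: by Fubini, in the direction of a nonzero coefficient each line meets it in
one point.\<close>

lemma AE_linear_form_neq:
  fixes k :: "nat \<Rightarrow> int"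
  assumes fin: "finite D" and i: "i \<in> D" "k i \<noteq> 0"
  shows "AE y in Pi\<^sub>M D (\<lambda>_. lborel). (\<Sum>i\<in>D. of_int (k i) * y i) \<noteq> (c :: real)"
proof -
  define E where "E = D - {i}"
  have D: "D = insert i E" "i \<notin> E" "finite E" using fin i by (auto simp: E_def)
  let ?N = "{y \<in> space (Pi\<^sub>M D (\<lambda>_. lborel)). (\<Sum>i\<in>D. of_int (k i) * y i) = c}"
  have meas: "(\<lambda>y. \<Sum>i\<in>D. of_int (k i) * y i) \<in> borel_measurable (Pi\<^sub>M D (\<lambda>_. lborel :: real measure))"
    by measurable
  have N: "?N \<in> sets (Pi\<^sub>M D (\<lambda>_. lborel))" using meas by measurable
  have "emeasure (Pi\<^sub>M D (\<lambda>_. lborel)) ?N = (\<integral>\<^sup>+ y. indicator ?N y \<partial>Pi\<^sub>M (insert i E) (\<lambda>_. lborel))"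
    using N by (simp add: D(1)[symmetric])
  also have "\<dots> = (\<integral>\<^sup>+ x. (\<integral>\<^sup>+ y. indicator ?N (x(i := y)) \<partial>lborel) \<partial>Pi\<^sub>M E (\<lambda>_. lborel))"
    using N D by (intro lborel_product.product_nn_integral_insert) auto
  also have "\<dots> = (\<integral>\<^sup>+ x. 0 \<partial>Pi\<^sub>M E (\<lambda>_. lborel :: real measure))"
  proof (rule nn_integral_cong)
    fix x :: "nat \<Rightarrow> real"
    let ?y = "(c - (\<Sum>j\<in>E. of_int (k j) * x j)) / of_int (k i)"
    have "indicator ?N (x(i := y)) \<le> (indicator {?y} y :: ennreal)" for y
    proof (cases "x(i := y) \<in> ?N")
      case True
      then have "of_int (k i) * y + (\<Sum>j\<in>E. of_int (k j) * (x(i := y)) j) = c"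
        using D by simp
      moreover have "(\<Sum>j\<in>E. of_int (k j) * (x(i := y)) j) = (\<Sum>j\<in>E. of_int (k j) * x j)"
        using D by (intro sum.cong) auto
      ultimately have "y = ?y" using i by (simp add: field_simps)
      then show ?thesis by (auto simp: indicator_def)
    qed simp
    then have "(\<integral>\<^sup>+ y. indicator ?N (x(i := y)) \<partial>lborel) \<le> (\<integral>\<^sup>+ y. indicator {?y} y \<partial>lborel)"
      by (intro nn_integral_mono)
    also have "\<dots> = 0" by simp
    finally show "(\<integral>\<^sup>+ y. indicator ?N (x(i := y)) \<partial>lborel) = 0" by simp
  qed
  finally have "emeasure (Pi\<^sub>M D (\<lambda>_. lborel)) ?N = 0" by simp
  then show ?thesis using N by (intro AE_I[of _ _ ?N]) auto
qed

text \<open>The integrand is constant on the cubes of side \<open>1 / b\<close> on which \<open>\<lfloor>b y\<rfloor>\<close> is constant. Written as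
an integral over a fixed space, a lattice sum becomes accessible to dominated convergence.\<close>

lemma integral_floor_eq_sum:
  fixes g :: "(nat \<Rightarrow> int) \<Rightarrow> real"
  assumes fin: "finite D" and b: "b > 0"
  defines "I y \<equiv> (if \<forall>i\<in>D. \<lfloor>real b * y i\<rfloor> \<in> {- int b..int b} then g (\<lambda>i\<in>D. \<lfloor>real b * y i\<rfloor>) else 0)"
  shows "(\<integral>y. I y \<partial>Pi\<^sub>M D (\<lambda>_. lborel)) = (\<Sum>x\<in>D \<rightarrow>\<^sub>E {- int b..int b}. g x) / real b ^ card D"
    and "I \<in> borel_measurable (Pi\<^sub>M D (\<lambda>_. lborel))"
proof -
  let ?B = "D \<rightarrow>\<^sub>E {- int b..int b}"
  let ?J = "\<lambda>x i. indicator {of_int (x i) / real b..<(of_int (x i) + 1) / real b} :: real \<Rightarrow> real"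
  have finB: "finite ?B" using fin by (intro finite_PiE) auto
  have cell: "?J x i t = (if \<lfloor>real b * t\<rfloor> = x i then 1 else 0)" for x :: "nat \<Rightarrow> int" and i t
    using b by (auto simp: indicator_def floor_eq_iff field_simps)
  have I: "I y = (\<Sum>x\<in>?B. g x * (\<Prod>i\<in>D. ?J x i (y i)))" for y
  proof -
    define z where "z = (\<lambda>i\<in>D. \<lfloor>real b * y i\<rfloor>)"
    have pr: "(\<Prod>i\<in>D. ?J x i (y i)) = (if x = z then 1 else 0)" if x: "x \<in> ?B" for x
    proof (cases "\<forall>i\<in>D. \<lfloor>real b * y i\<rfloor> = x i")
      case True
      then have "x = z" using x unfolding z_def by (intro extensionalityI[of _ D]) (auto simp: PiE_iff)
      then show ?thesis using True unfolding cell by simp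
    next
      case False
      then obtain i where i: "i \<in> D" "\<lfloor>real b * y i\<rfloor> \<noteq> x i" by blast
      then have "(\<Prod>i\<in>D. ?J x i (y i)) = 0" using fin unfolding cell by (intro prod_zero) auto
      moreover have "x \<noteq> z" using i by (auto simp: z_def)
      ultimately show ?thesis by simp
    qed
    have "(\<Sum>x\<in>?B. g x * (\<Prod>i\<in>D. ?J x i (y i))) = (\<Sum>x\<in>?B. if x = z then g x else 0)"
      by (intro sum.cong refl) (simp add: pr)
    also have "\<dots> = (if z \<in> ?B then g z else 0)"
      using finB by (simp add: sum.delta')
    also have "\<dots> = I y" by (auto simp: I_def z_def PiE_iff)
    finally show ?thesis by simp
  qed
  have int: "integrable lborel (?J x i)" "(\<integral>t. ?J x i t \<partial>lborel) = 1 / real b" for x :: "nat \<Rightarrow> int" and i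
    using b by (auto simp: field_simps diff_divide_distrib[symmetric])
  have "(\<integral>y. I y \<partial>Pi\<^sub>M D (\<lambda>_. lborel)) = (\<Sum>x\<in>?B. g x * (\<integral>y. (\<Prod>i\<in>D. ?J x i (y i)) \<partial>Pi\<^sub>M D (\<lambda>_. lborel)))"
    unfolding I using fin int by (subst Bochner_Integration.integral_sum)
      (auto intro!: lborel_product.product_integrable_prod integrable_mult_right)
  also have "\<dots> = (\<Sum>x\<in>?B. g x * (1 / real b) ^ card D)"
    by (intro sum.cong refl arg_cong2[of _ _ _ _ "(*)"])
       (use int in \<open>subst lborel_product.product_integral_prod[OF fin], auto\<close>)
  finally show "(\<integral>y. I y \<partial>Pi\<^sub>M D (\<lambda>_. lborel)) = (\<Sum>x\<in>?B. g x) / real b ^ card D"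
    by (simp add: power_one_over sum_divide_distrib)
  show "I \<in> borel_measurable (Pi\<^sub>M D (\<lambda>_. lborel))"
    unfolding I[abs_def] by measurable
qed

lemma filterlim_nat_pos:
  fixes b :: "nat \<Rightarrow> nat"
  assumes "filterlim b at_top sequentially"
  shows "eventually (\<lambda>n. b n > 0) sequentially"
proof -
  have "eventually (\<lambda>n. 1 \<le> b n) sequentially" using assms unfolding filterlim_at_top by blast
  then show ?thesis by eventually_elim simp
qed

lemma floor_scaled_tendsto:
  fixes y :: real
  assumes "filterlim b at_top sequentially"
  shows "(\<lambda>n. of_int \<lfloor>real (b n) * y\<rfloor> / real (b n)) \<longlonglongrightarrow> y"
proof (rule tendsto_sandwich[of "\<lambda>n. y - 1 / real (b n)" _ _ "\<lambda>n. y"])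
  have inv: "(\<lambda>n. 1 / real (b n)) \<longlonglongrightarrow> 0"
    using assms by (intro tendsto_divide_0[OF tendsto_const] filterlim_at_top_imp_at_infinity
      filterlim_compose[OF filterlim_real_sequentially])
  show "(\<lambda>n. y - 1 / real (b n)) \<longlonglongrightarrow> y" using tendsto_diff[OF tendsto_const[of y] inv] by simp
  have ev: "eventually (\<lambda>n. b n > 0) sequentially" using assms by (rule filterlim_nat_pos)
  show "\<forall>\<^sub>F n in sequentially. y - 1 / real (b n) \<le> of_int \<lfloor>real (b n) * y\<rfloor> / real (b n)"
    using ev
  proof eventually_elim
    case (elim n)
    have "(real (b n) * y - 1) / real (b n) \<le> of_int \<lfloor>real (b n) * y\<rfloor> / real (b n)"
      by (intro divide_right_mono) (linarith, simp)
    then show ?case using elim by (simp add: diff_divide_distrib)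
  qed
  show "\<forall>\<^sub>F n in sequentially. of_int \<lfloor>real (b n) * y\<rfloor> / real (b n) \<le> y"
    using ev
  proof eventually_elim
    case (elim n)
    have "of_int \<lfloor>real (b n) * y\<rfloor> / real (b n) \<le> real (b n) * y / real (b n)"
      by (intro divide_right_mono) auto
    then show ?case using elim by simp
  qed
qed simp

lemma eventually_abs_le_iff:
  assumes "X \<longlonglongrightarrow> x" "\<bar>x\<bar> \<noteq> (1::real)"
  shows "eventually (\<lambda>n. \<bar>X n\<bar> \<le> 1 \<longleftrightarrow> \<bar>x\<bar> \<le> 1) sequentially"
proof (cases "\<bar>x\<bar> < 1")
  case True
  have "eventually (\<lambda>n. \<bar>X n\<bar> < 1) sequentially" by (rule order_tendstoD(2)[OF tendsto_rabs[OF assms(1)] True])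
  then show ?thesis by eventually_elim (use True in auto)
next
  case False
  then have "1 < \<bar>x\<bar>" using assms by simp
  then have "eventually (\<lambda>n. \<bar>X n\<bar> > 1) sequentially" by (rule order_tendstoD(1)[OF tendsto_rabs[OF assms(1)]])
  then show ?thesis by eventually_elim (use \<open>1 < \<bar>x\<bar>\<close> in auto)
qed

lemma abs_of_int_divide_le_1_iff:
  fixes b :: nat
  assumes "b > 0"
  shows "\<bar>real_of_int k / real b\<bar> \<le> 1 \<longleftrightarrow> \<bar>k\<bar> \<le> int b"
proof -
  have "\<bar>real_of_int k / real b\<bar> \<le> 1 \<longleftrightarrow> \<bar>real_of_int k\<bar> \<le> real b"
    using assms by (simp add: abs_divide)
  then show ?thesis by linarith
qed

text \<open>The lattice sum runs over free parameters \<open>x\<close>; the value at a position \<open>p\<close> is the linear form \<open>F x p\<close>.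
The sum is restricted to parameters for which all values stay in the box and coincide exactly as
prescribed by \<open>K\<close>. After rescaling, the parameters become points \<open>y\<close>, and both conditions stabilise for almost
every \<open>y\<close>: the box condition unless \<open>y\<close> lies on one of finitely many hyperplanes, and a coincidence
of two forms depends in the limit only on whether they are identical as linear
forms.\<close>

lemma riemann_sum_convergent:
  fixes m :: "nat \<Rightarrow> nat \<Rightarrow> int" and \<psi> :: "nat \<Rightarrow> (nat \<Rightarrow> int) \<Rightarrow> real" and K :: "nat \<Rightarrow> nat \<Rightarrow> bool"
    and D P :: "nat set"
  defines "F x p \<equiv> \<Sum>i\<in>D. m p i * x i"
  assumes fin: "finite D" "finite P" and b: "filterlim b at_top sequentially"
    and \<psi>01: "\<And>n x. 0 \<le> \<psi> n x" "\<And>n x. \<psi> n x \<le> 1"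
    and \<psi>: "\<And>X Y. (\<And>p. p \<in> P \<Longrightarrow> (\<lambda>n. of_int (X n p) / real (b n)) \<longlonglongrightarrow> Y p) \<Longrightarrow> (\<lambda>n. \<psi> n (X n)) \<longlonglongrightarrow> \<Psi> Y"
  shows "convergent (\<lambda>n. (\<Sum>x\<in>D \<rightarrow>\<^sub>E {- int (b n)..int (b n)}.
    if (\<forall>p\<in>P. \<bar>F x p\<bar> \<le> int (b n)) \<and> (\<forall>p\<in>P. \<forall>q\<in>P. F x p = F x q \<longleftrightarrow> K p q) then \<psi> n (F x) else 0) / real (b n) ^ card D)"
proof -
  let ?\<mu> = "Pi\<^sub>M D (\<lambda>_. lborel :: real measure)"
  define G where "G y p = (\<Sum>i\<in>D. of_int (m p i) * y i)" for y :: "nat \<Rightarrow> real" and p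
  \<comment> \<open>Only nonzero forms have boundary hyperplanes; the zero form always satisfies the bound.\<close>
  define nz where "nz p \<longleftrightarrow> (\<exists>i\<in>D. m p i \<noteq> 0)" for p
  define neq where "neq p q \<longleftrightarrow> (\<exists>i\<in>D. m p i \<noteq> m q i)" for p q
  define g where "g n x = (if (\<forall>p\<in>P. \<bar>F x p\<bar> \<le> int (b n)) \<and> (\<forall>p\<in>P. \<forall>q\<in>P. F x p = F x q \<longleftrightarrow> K p q)
      then \<psi> n (F x) else 0)" for n x
  define I where "I n y = (if \<forall>i\<in>D. \<lfloor>real (b n) * y i\<rfloor> \<in> {- int (b n)..int (b n)}
      then g n (\<lambda>i\<in>D. \<lfloor>real (b n) * y i\<rfloor>) else 0)" for n and y :: "nat \<Rightarrow> real"
  define J where "J y = (if (\<forall>i\<in>D. \<bar>y i\<bar> \<le> 1) \<and> (\<forall>p\<in>P. \<bar>G y p\<bar> \<le> 1) \<and> (\<forall>p\<in>P. \<forall>q\<in>P. \<not> neq p q \<longleftrightarrow> K p q)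
      then \<Psi> (G y) else 0)" for y :: "nat \<Rightarrow> real"
  have bpos: "eventually (\<lambda>n. b n > 0) sequentially" using b by (rule filterlim_nat_pos)
  have AE1: "AE y in ?\<mu>. nz p \<longrightarrow> G y p \<noteq> c" for p c
    using AE_linear_form_neq[OF fin(1), of _ "m p" c] by (cases "nz p") (auto simp: nz_def G_def)
  have AE2: "AE y in ?\<mu>. neq p q \<longrightarrow> G y p - G y q \<noteq> 0" for p q
  proof (cases "neq p q")
    case True
    then obtain i where "i \<in> D" "m p i - m q i \<noteq> 0" by (auto simp: neq_def)
    then show ?thesis using AE_linear_form_neq[OF fin(1), of i "\<lambda>i. m p i - m q i" 0]
      by (simp add: G_def sum_subtractf[symmetric] left_diff_distrib)
  qed simp
  have AE3: "AE y in ?\<mu>. y i \<noteq> c" if "i \<in> D" for i c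
    using AE_linear_form_neq[OF fin(1) that, of "\<lambda>j. if j = i then 1 else 0" c] that fin
    by (simp add: if_distrib[of "\<lambda>x. x * _"] if_distrib[of of_int] sum.delta cong: if_cong)
  have AE: "AE y in ?\<mu>. (\<forall>p\<in>P. nz p \<longrightarrow> G y p \<noteq> 1) \<and> (\<forall>p\<in>P. nz p \<longrightarrow> G y p \<noteq> -1) \<and>
      (\<forall>p\<in>P. \<forall>q\<in>P. neq p q \<longrightarrow> G y p - G y q \<noteq> 0) \<and> (\<forall>i\<in>D. y i \<noteq> 1) \<and> (\<forall>i\<in>D. y i \<noteq> -1)"
    using AE1 AE2 AE3 fin by (intro AE_conjI AE_finite_allI) auto
  have lim: "AE y in ?\<mu>. (\<lambda>n. I n y) \<longlonglongrightarrow> J y"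
    using AE
  proof eventually_elim
    case (elim y)
    let ?x = "\<lambda>n. \<lambda>i\<in>D. \<lfloor>real (b n) * y i\<rfloor>"
    have Fl: "(\<lambda>n. of_int (F (?x n) p) / real (b n)) \<longlonglongrightarrow> G y p" for p
    proof -
      have "(\<lambda>n. \<Sum>i\<in>D. of_int (m p i) * (of_int \<lfloor>real (b n) * y i\<rfloor> / real (b n))) \<longlonglongrightarrow> G y p"
        unfolding G_def by (intro tendsto_sum tendsto_mult tendsto_const floor_scaled_tendsto b)
      moreover have "(\<Sum>i\<in>D. of_int (m p i) * (of_int \<lfloor>real (b n) * y i\<rfloor> / real (b n))) = of_int (F (?x n) p) / real (b n)" for n
        by (simp add: F_def sum_divide_distrib)
      ultimately show ?thesis by simp
    qed
    have e1: "eventually (\<lambda>n. \<lfloor>real (b n) * y i\<rfloor> \<in> {- int (b n)..int (b n)} \<longleftrightarrow> \<bar>y i\<bar> \<le> 1) sequentially" if "i \<in> D" for i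
    proof -
      have "\<bar>y i\<bar> \<noteq> 1" using elim that by (auto simp: abs_if split: if_splits)
      then have "eventually (\<lambda>n. \<bar>of_int \<lfloor>real (b n) * y i\<rfloor> / real (b n)\<bar> \<le> 1 \<longleftrightarrow> \<bar>y i\<bar> \<le> 1) sequentially"
        by (intro eventually_abs_le_iff floor_scaled_tendsto b)
      then show ?thesis using bpos
      proof eventually_elim
        case (elim n)
        have "\<lfloor>real (b n) * y i\<rfloor> \<in> {- int (b n)..int (b n)} \<longleftrightarrow> \<bar>\<lfloor>real (b n) * y i\<rfloor>\<bar> \<le> int (b n)"
          by (simp add: abs_le_iff) linarith
        then show ?case using elim(1) abs_of_int_divide_le_1_iff[OF elim(2)] by blast
      qed
    qed
    have e2: "eventually (\<lambda>n. \<bar>F (?x n) p\<bar> \<le> int (b n) \<longleftrightarrow> \<bar>G y p\<bar> \<le> 1) sequentially" if "p \<in> P" for p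
    proof (cases "nz p")
      case True
      then have "\<bar>G y p\<bar> \<noteq> 1" using elim that by (auto simp: abs_if split: if_splits)
      then have "eventually (\<lambda>n. \<bar>of_int (F (?x n) p) / real (b n)\<bar> \<le> 1 \<longleftrightarrow> \<bar>G y p\<bar> \<le> 1) sequentially"
        by (intro eventually_abs_le_iff Fl)
      then show ?thesis using bpos
      proof eventually_elim
        case (elim n)
        show ?case using elim(1) abs_of_int_divide_le_1_iff[OF elim(2)] by blast
      qed
    next
      case False
      then have "F x p = 0" "G y p = 0" for x by (auto simp: F_def G_def nz_def intro!: sum.neutral)
      then show ?thesis by simp
    qed
    have e3: "eventually (\<lambda>n. F (?x n) p = F (?x n) q \<longleftrightarrow> \<not> neq p q) sequentially" if "p \<in> P" "q \<in> P" for p q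
    proof (cases "neq p q")
      case True
      then have "G y p - G y q \<noteq> 0" using elim that by blast
      then have "eventually (\<lambda>n. of_int (F (?x n) p) / real (b n) - of_int (F (?x n) q) / real (b n) \<noteq> 0) sequentially"
        by (intro tendsto_imp_eventually_ne[OF tendsto_diff[OF Fl Fl]])
      then show ?thesis by eventually_elim (use True in auto)
    next
      case False
      then have "F x p = F x q" for x by (auto simp: F_def neq_def intro!: sum.cong)
      then show ?thesis using False by simp
    qed
    have ev: "eventually (\<lambda>n. (\<forall>i\<in>D. \<lfloor>real (b n) * y i\<rfloor> \<in> {- int (b n)..int (b n)} \<longleftrightarrow> \<bar>y i\<bar> \<le> 1) \<and>
       (\<forall>p\<in>P. \<bar>F (?x n) p\<bar> \<le> int (b n) \<longleftrightarrow> \<bar>G y p\<bar> \<le> 1) \<and>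
       (\<forall>p\<in>P. \<forall>q\<in>P. F (?x n) p = F (?x n) q \<longleftrightarrow> \<not> neq p q)) sequentially"
      using fin e1 e2 e3 by (simp add: eventually_conj_iff eventually_ball_finite)
    let ?c = "(\<forall>i\<in>D. \<bar>y i\<bar> \<le> 1) \<and> (\<forall>p\<in>P. \<bar>G y p\<bar> \<le> 1) \<and> (\<forall>p\<in>P. \<forall>q\<in>P. \<not> neq p q \<longleftrightarrow> K p q)"
    have "eventually (\<lambda>n. I n y = (if ?c then \<psi> n (F (?x n)) else 0)) sequentially"
      using ev by eventually_elim (auto simp: I_def g_def)
    moreover have "(\<lambda>n. if ?c then \<psi> n (F (?x n)) else 0) \<longlonglongrightarrow> J y"
    proof (cases ?c)
      case True
      have "(\<lambda>n. \<psi> n (F (?x n))) \<longlonglongrightarrow> \<Psi> (G y)" by (rule \<psi>) (rule Fl)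
      then show ?thesis unfolding J_def if_P[OF True] .
    next
      case False
      show ?thesis unfolding J_def if_not_P[OF False] by (rule tendsto_const)
    qed
    ultimately show ?case by (simp add: tendsto_cong)
  qed
  let ?box = "D \<rightarrow>\<^sub>E {-2..2 :: real}"
  have box: "?box \<in> sets ?\<mu>" using fin by (intro sets_PiM_I_finite) auto
  have ebox: "emeasure ?\<mu> ?box < \<infinity>" using fin by (subst lborel_product.emeasure_PiM) (auto simp: power_less_top_ennreal)
  define N where "N = (SOME N. \<forall>n\<ge>N. b n > 0)"
  have N: "\<forall>n\<ge>N. b n > 0" unfolding N_def using bpos unfolding eventually_sequentially by (rule someI_ex)
  have Im: "I n \<in> borel_measurable ?\<mu>" if "n \<ge> N" for n
    unfolding I_def[abs_def] using N that by (intro integral_floor_eq_sum(2) fin) auto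
  have dom: "norm (I n y) \<le> indicator ?box y" if n: "n \<ge> N" and y: "y \<in> space ?\<mu>" for n y
  proof (cases "\<forall>i\<in>D. \<lfloor>real (b n) * y i\<rfloor> \<in> {- int (b n)..int (b n)}")
    case True
    have "y i \<in> {-2..2}" if "i \<in> D" for i
    proof -
      have bn: "real (b n) \<ge> 1" using N n by (simp add: Suc_le_eq)
      have "- real (b n) \<le> real (b n) * y i" "real (b n) * y i < real (b n) + 1"
        using True that by (auto simp: le_floor_iff floor_le_iff)
      then have "real (b n) * (-1) \<le> real (b n) * y i" "real (b n) * y i \<le> real (b n) * 2" using bn by linarith+
      then have "-1 \<le> y i" "y i \<le> 2" using bn by (simp_all only: mult_le_cancel_left_pos[of "real (b n)"])
      then show ?thesis by simp
    qed
    then have "y \<in> ?box" using y by (auto simp: space_PiM PiE_iff)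
    moreover have "norm (I n y) \<le> 1" using \<psi>01 by (auto simp: I_def g_def)
    ultimately show ?thesis by simp
  qed (auto simp: I_def)
  \<comment> \<open>The almost sure limit \<open>J\<close> is not known to be measurable, because \<open>\<Psi>\<close> is arbitrary; the
    pointwise limit is.\<close>
  define J' where "J' y = lim (\<lambda>n. I (n + N) y)" for y
  have Jm: "J' \<in> borel_measurable ?\<mu>"
    unfolding J'_def[abs_def] using Im by (intro borel_measurable_lim_metric) auto
  have "(\<lambda>n. \<integral>y. I (n + N) y \<partial>?\<mu>) \<longlonglongrightarrow> (\<integral>y. J' y \<partial>?\<mu>)"
  proof (rule integral_dominated_convergence)
    show "integrable ?\<mu> (indicator ?box :: _ \<Rightarrow> real)" using box ebox by simp
    show "AE y in ?\<mu>. (\<lambda>n. I (n + N) y) \<longlonglongrightarrow> J' y"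
      using lim unfolding J'_def
    proof eventually_elim
      case (elim y)
      have "(\<lambda>n. I (n + N) y) \<longlonglongrightarrow> J y" using elim by (rule LIMSEQ_ignore_initial_segment)
      then show ?case by (simp add: limI)
    qed
    show "AE y in ?\<mu>. norm (I (n + N) y) \<le> indicator ?box y" for n using dom[of "n + N"] by (intro AE_I2) auto
  qed (use Im Jm in auto)
  moreover have "(\<integral>y. I (n + N) y \<partial>?\<mu>) = (\<Sum>x\<in>D \<rightarrow>\<^sub>E {- int (b (n + N))..int (b (n + N))}. g (n + N) x) / real (b (n + N)) ^ card D" for n
    unfolding I_def using N by (intro integral_floor_eq_sum(1) fin) auto
  ultimately have "(\<lambda>n. (\<Sum>x\<in>D \<rightarrow>\<^sub>E {- int (b n)..int (b n)}. g n x) / real (b n) ^ card D) \<longlonglongrightarrow> (\<integral>y. J' y \<partial>?\<mu>)"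
    by (simp add: LIMSEQ_offset[of _ N])
  then show ?thesis unfolding g_def convergent_def by blast
qed

section \<open>The covariance of two closed words, summed over index assignments\<close>

definition labelled :: "(nat \<Rightarrow> bool) \<Rightarrow> (nat \<Rightarrow> int) \<Rightarrow> nat list \<Rightarrow> word" where
  "labelled fl w ps = map (\<lambda>p. (w p, fl p)) ps"

lemma filter_labelled:
  "filter (\<lambda>x. P (fst x)) (labelled fl w ps) = labelled fl w (filter (\<lambda>p. P (w p)) ps)"
  by (simp add: labelled_def filter_map o_def)

lemma idx_labelled [simp]: "idx (labelled fl w ps) = w ` set ps"
  by (auto simp: labelled_def image_image)

lemma length_labelled [simp]: "length (labelled fl w ps) = length ps"
  by (simp add: labelled_def)

lemma labelled_append: "labelled fl w (ps @ qs) = labelled fl w ps @ labelled fl w qs"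
  by (simp add: labelled_def)

text \<open>Every index occurs at most twice, or four times with two of the four letters conjugated. The mean of
such a word depends only on the coincidences among its indices, since the moments
involved, \<open>E a\<^sub>j\<close>, \<open>E a\<^sub>j\<^sup>2\<close>, \<open>E \<bar>a\<^sub>j\<bar>\<^sup>2\<close> and \<open>E \<bar>a\<^sub>j\<bar>\<^sup>4\<close>, are the same for all \<open>j\<close>.\<close>

definition mild :: "(nat \<Rightarrow> bool) \<Rightarrow> (nat \<Rightarrow> int) \<Rightarrow> nat list \<Rightarrow> bool" where
  "mild fl w ps \<longleftrightarrow> (\<forall>p\<in>set ps. let qs = filter (\<lambda>q. w q = w p) ps in
     length qs \<le> 2 \<or> length qs = 4 \<and> length (filter fl qs) = 2)"

context toeplitz_input
begin

lemma em_pair: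
  "em [(j, c), (j, d)] = (if c = d then of_real \<tau> else 1)"
proof -
  have ab: "expectation (\<lambda>\<omega>. a j \<omega> * cnj (a j \<omega>)) = 1"
    unfolding complex_norm_square[symmetric] integral_complex_of_real using abs_square[of j]
    by (simp flip: of_real_power)
  have sq: "expectation (\<lambda>\<omega>. a j \<omega> * a j \<omega>) = of_real \<tau>"
    using square[of j] by (simp add: power2_eq_square)
  have "expectation (\<lambda>\<omega>. cnj (a j \<omega> * a j \<omega>)) = cnj (expectation (\<lambda>\<omega>. a j \<omega> * a j \<omega>))"
    by (rule Bochner_Integration.integral_cnj)
  then have sq': "expectation (\<lambda>\<omega>. cnj (a j \<omega>) * cnj (a j \<omega>)) = of_real \<tau>"
    unfolding sq by simp
  show ?thesis
    using ab sq sq' by (cases c; cases d) (simp_all add: em_def A_def[abs_def] letter_def mult.commute)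
qed

lemma em_quadruple: "em [(j, True), (j, True), (j, False), (j, False)] = of_real \<kappa>"
proof -
  have "cnj z * (cnj z * (z * z)) = complex_of_real (norm z ^ 4)" for z
    unfolding norm_power4 by (simp add: mult_ac)
  then show ?thesis
    unfolding em_def A_def[abs_def] by (simp add: letter_def abs_fourth del: of_real_power)
qed

lemma em_single_index:
  assumes "length cs \<le> 2 \<or> length cs = 4 \<and> length (filter id cs) = 2"
  shows "em (map (\<lambda>c. (j, c)) cs) = em (map (\<lambda>c. (j', c)) cs)"
proof -
  consider "cs = []" | c where "cs = [c]" | c d where "cs = [c, d]" | "length cs = 4" "length (filter id cs) = 2"
    using assms by (auto simp: le_Suc_eq length_Suc_conv numeral_2_eq_2)
  then show ?thesis
  proof cases
    case 4
    have "mset cs = {#True, True, False, False#}"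
    proof (rule multiset_eqI)
      fix c
      have "count (mset cs) True = length (filter id cs)" by (induction cs) auto
      then have cnt: "count (mset cs) True = 2" using 4(2) by simp
      have "length cs = count (mset cs) True + count (mset cs) False"
        by (induction cs) auto
      then have "count (mset cs) False = 2" using cnt 4(1) by simp
      then show "count (mset cs) c = count {#True, True, False, False#} c" using cnt by (cases c) auto
    qed
    then have "em (map (\<lambda>c. (j, c)) cs) = em (map (\<lambda>c. (j, c)) [True, True, False, False])" for j
      by (intro em_mset_cong) simp
    then show ?thesis by (simp add: em_quadruple)
  qed (auto simp: em_pair)
qed

lemma em_labelled_cong:
  assumes "\<And>p q. p \<in> set ps \<Longrightarrow> q \<in> set ps \<Longrightarrow> w p = w q \<longleftrightarrow> w' p = w' q" "mild fl w ps"
  shows "em (labelled fl w ps) = em (labelled fl w' ps)"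
  using assms
proof (induction "length ps" arbitrary: ps rule: less_induct)
  case less
  show ?case
  proof (cases ps)
    case Nil
    then show ?thesis by (simp add: labelled_def)
  next
    case (Cons p rest)
    have p: "p \<in> set ps" using Cons by simp
    let ?c = "filter (\<lambda>q. w q = w p) ps" and ?r = "filter (\<lambda>q. w q \<noteq> w p) ps"
    have c': "filter (\<lambda>q. w' q = w' p) ps = ?c" "filter (\<lambda>q. w' q \<noteq> w' p) ps = ?r"
      using less.prems(1) p by (auto intro!: filter_cong)
    have split: "em (labelled fl v ps) = em (labelled fl v (filter (\<lambda>q. v q = v p) ps)) * em (labelled fl v (filter (\<lambda>q. v q \<noteq> v p) ps))" for v
      using em_filter_split[of "labelled fl v ps" "{v p}"] filter_labelled[of "\<lambda>j. j = v p"] filter_labelled[of "\<lambda>j. j \<noteq> v p"]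
      by simp
    have "em (labelled fl w ?c) = em (labelled fl w' ?c)"
    proof -
      have l: "length (map fl ?c) \<le> 2 \<or> length (map fl ?c) = 4 \<and> length (filter id (map fl ?c)) = 2"
        using less.prems(2) p by (auto simp: mild_def Let_def filter_map o_def)
      have "labelled fl w ?c = map (\<lambda>c. (w p, c)) (map fl ?c)" by (simp add: labelled_def)
      moreover have "labelled fl w' ?c = map (\<lambda>c. (w' p, c)) (map fl ?c)"
        using less.prems(1) p by (auto simp: labelled_def)
      ultimately show ?thesis using em_single_index[OF l] by simp
    qed
    moreover have "em (labelled fl w ?r) = em (labelled fl w' ?r)"
    proof (rule less.hyps)
      show "length ?r < length ps" using Cons by (simp add: less_Suc_eq_le)
      show "mild fl w ?r" unfolding mild_def Let_def
      proof
        fix q assume q: "q \<in> set ?r"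
        then have "filter (\<lambda>x. w x = w q) ?r = filter (\<lambda>x. w x = w q) ps"
          by (auto intro!: filter_cong)
        then show "length (filter (\<lambda>x. w x = w q) ?r) \<le> 2 \<or>
          length (filter (\<lambda>x. w x = w q) ?r) = 4 \<and> length (filter fl (filter (\<lambda>x. w x = w q) ?r)) = 2"
          using less.prems(2) q unfolding mild_def Let_def by (metis filter_is_subset subsetD)
      qed
    qed (use less.prems(1) in auto)
    ultimately show ?thesis using split[of w] split[of w'] c' by simp
  qed
qed

text \<open>The covariance of the monomials on the first \<open>L1\<close> and the remaining positions when index \<open>w p\<close> is put at position
\<open>p\<close>.\<close>

definition wcov :: "(nat \<Rightarrow> bool) \<Rightarrow> nat \<Rightarrow> nat \<Rightarrow> (nat \<Rightarrow> int) \<Rightarrow> complex" where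
  "wcov fl L1 L w = em (labelled fl w [0..<L]) - em (labelled fl w [0..<L1]) * em (labelled fl w [L1..<L])"

lemma upt_split: "L1 \<le> L \<Longrightarrow> [0..<L] = [0..<L1] @ [L1..<L]"
  using upt_add_eq_append[of 0 L1 "L - L1"] by simp

lemma wcov_unpaired:
  assumes "L1 \<le> L" "p < L" "\<And>q. q < L \<Longrightarrow> q \<noteq> p \<Longrightarrow> w q \<noteq> w p"
  shows "wcov fl L1 L w = 0"
proof -
  have "{i. i < L \<and> w i = w p} = {p}" using assms(2,3) by blast
  moreover have "{i. i < length [0..<L] \<and> w ([0..<L] ! i) = w p} = {i. i < L \<and> w i = w p}" by auto
  ultimately have "length (filter (\<lambda>q. w q = w p) [0..<L]) = 1" by (simp only: length_filter_conv_card) simp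
  then have 1: "length (filter (\<lambda>x. fst x = w p) (labelled fl w [0..<L])) = 1"
    using filter_labelled[of "\<lambda>j. j = w p"] by simp
  then have "length (filter (\<lambda>x. fst x = w p) (labelled fl w [0..<L1])) = 1 \<or>
      length (filter (\<lambda>x. fst x = w p) (labelled fl w [L1..<L])) = 1"
    unfolding upt_split[OF assms(1)] labelled_append by simp linarith
  then show ?thesis using em_unpaired 1 unfolding wcov_def by auto
qed

lemma wcov_no_cross:
  assumes "L1 \<le> L" "\<And>p q. p < L1 \<Longrightarrow> L1 \<le> q \<Longrightarrow> q < L \<Longrightarrow> w p \<noteq> w q"
  shows "wcov fl L1 L w = 0"
proof -
  have "idx (labelled fl w [0..<L1]) \<inter> idx (labelled fl w [L1..<L]) = {}"
    unfolding idx_labelled using assms(2) by auto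
  then show ?thesis unfolding wcov_def upt_split[OF assms(1)] labelled_append
    by (simp only: em_append_disjoint) simp
qed

lemma norm_wcov_le:
  assumes "L1 \<le> L"
  shows "norm (wcov fl L1 L w) \<le> 2 * KM L ^ 2"
proof -
  have "norm (em (labelled fl w [0..<L])) \<le> KM L ^ 2"
    using norm_em_le[of "labelled fl w [0..<L]" L] KM_ge_1[of L] self_le_power[of "KM L" 2] by simp
  moreover have "norm (em (labelled fl w [0..<L1]) * em (labelled fl w [L1..<L])) \<le> KM L ^ 2"
    unfolding norm_mult power2_eq_square using assms KM_ge_1[of L] by (intro mult_mono norm_em_le) auto
  ultimately show ?thesis unfolding wcov_def
    using norm_triangle_ineq4[of "em (labelled fl w [0..<L])" "em (labelled fl w [0..<L1]) * em (labelled fl w [L1..<L])"]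
    by linarith
qed

end

text \<open>Two words are put side by side on the positions \<open>{..<L}\<close>; the first has length \<open>L1\<close> and
the flags are \<open>fl\<close>. The weight \<open>\<psi> n\<close> is a function of the indices that converges when they
are rescaled by the bandwidth; it will be the proportion of rows from which both walks
stay inside the matrix.\<close>

locale pair_sum = toeplitz_input +
  fixes fl :: "nat \<Rightarrow> bool" and L1 L H :: nat and b :: "nat \<Rightarrow> nat"
    and \<psi> :: "nat \<Rightarrow> (nat \<Rightarrow> int) \<Rightarrow> real" and \<Psi> :: "(nat \<Rightarrow> real) \<Rightarrow> real"
  assumes L1L: "L1 \<le> L" and LH: "L = 2 * H" and b: "filterlim b at_top sequentially"
    and \<psi>01: "\<And>n x. 0 \<le> \<psi> n x" "\<And>n x. \<psi> n x \<le> 1"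
    and \<psi>: "\<And>X Y. (\<And>p. p \<in> {..<L} \<Longrightarrow> (\<lambda>n. of_int (X n p) / real (b n)) \<longlonglongrightarrow> Y p) \<Longrightarrow> (\<lambda>n. \<psi> n (X n)) \<longlonglongrightarrow> \<Psi> Y"
    and \<psi>_cong: "\<And>n x y. (\<And>p. p < L \<Longrightarrow> x p = y p) \<Longrightarrow> \<psi> n x = \<psi> n y"
begin

definition sg :: "nat \<Rightarrow> int" where "sg p = (if fl p then 1 else -1)"
definition circ :: "nat \<Rightarrow> nat" where "circ p = (if p < L1 then 0 else 1)"

definition closed :: "(nat \<Rightarrow> int) \<Rightarrow> bool" where
  "closed w \<longleftrightarrow> (\<Sum>p<L1. sg p * w p) = 0 \<and> (\<Sum>p\<in>{L1..<L}. sg p * w p) = 0"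

abbreviation box :: "nat \<Rightarrow> (nat \<Rightarrow> int) set" where
  "box n \<equiv> {..<L} \<rightarrow>\<^sub>E {- int (b n)..int (b n)}"

definition same :: "(nat \<Rightarrow> int) \<Rightarrow> (nat \<Rightarrow> int) \<Rightarrow> bool" where
  "same w w0 \<longleftrightarrow> (\<forall>p<L. \<forall>q<L. w p = w q \<longleftrightarrow> w0 p = w0 q)"

text \<open>The contribution of the index assignments with the same coincidences as \<open>w0\<close>. The \<open>H\<close> powers of the
bandwidth come from the normalisation of the matrix product, the factor \<open>b n\<close> from the square of
the scaling of the statistic.\<close>

definition block_sum :: "(nat \<Rightarrow> int) \<Rightarrow> nat \<Rightarrow> complex" where
  "block_sum w0 n = (\<Sum>w\<in>{w\<in>box n. same w w0 \<and> closed w}. of_real (\<psi> n w) * wcov fl L1 L w) *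
     of_real (real (b n) / real (b n) ^ H)"

lemma finite_box: "finite (box n)" by (intro finite_PiE) auto

lemma circ_sums:
  "{p. p \<in> {..<L} \<and> circ p = 0} = {..<L1}" "{p. p \<in> {..<L} \<and> circ p = 1} = {L1..<L}"
  "i \<noteq> 0 \<Longrightarrow> i \<noteq> 1 \<Longrightarrow> {p. p \<in> {..<L} \<and> circ p = i} = {}"
  using L1L by (auto simp: circ_def split: if_splits)

lemma closed_circ: "closed w \<longleftrightarrow> (\<forall>i. (\<Sum>p | p \<in> {..<L} \<and> circ p = i. sg p * w p) = 0)"
proof
  assume c: "closed w"
  show "\<forall>i. (\<Sum>p | p \<in> {..<L} \<and> circ p = i. sg p * w p) = 0"
  proof
    fix i :: nat
    consider "i = 0" | "i = 1" | "i \<noteq> 0" "i \<noteq> 1" by blast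
    then show "(\<Sum>p | p \<in> {..<L} \<and> circ p = i. sg p * w p) = 0"
    proof cases
      case 3
      show ?thesis unfolding circ_sums(3)[OF 3] by simp
    qed (use c in \<open>simp_all only: circ_sums closed_def\<close>)
  qed
next
  assume a: "\<forall>i. (\<Sum>p | p \<in> {..<L} \<and> circ p = i. sg p * w p) = 0"
  from a[rule_format, of 0] a[rule_format, of 1] show "closed w"
    unfolding circ_sums closed_def by blast
qed

text \<open>With at most \<open>H - 2\<close> free parameters there are \<open>O(b\<^sup>H\<^sup>-\<^sup>2)\<close> assignments, each with bounded covariance.\<close>

lemma block_sum_negligible:
  assumes D: "D \<subseteq> {..<L}" "card D + 2 \<le> H" and det: "determines {..<L} w0 circ sg D"
  shows "block_sum w0 \<longlonglongrightarrow> 0"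
proof (rule Lim_null_comparison)
  let ?C = "2 * KM L ^ 2 * 3 ^ card D"
  show "\<forall>\<^sub>F n in sequentially. norm (block_sum w0 n) \<le> ?C * (1 / real (b n))"
    using filterlim_nat_pos[OF b]
  proof eventually_elim
    case (elim n)
    let ?S = "{w\<in>box n. same w w0 \<and> closed w}"
    have "norm (\<Sum>w\<in>?S. of_real (\<psi> n w) * wcov fl L1 L w) \<le> (\<Sum>w\<in>?S. 2 * KM L ^ 2)"
    proof (rule sum_norm_le)
      fix w
      have "norm (of_real (\<psi> n w) * wcov fl L1 L w) \<le> 1 * (2 * KM L ^ 2)"
        unfolding norm_mult using \<psi>01 by (intro mult_mono norm_wcov_le L1L) auto
      then show "norm (of_real (\<psi> n w) * wcov fl L1 L w) \<le> 2 * KM L ^ 2" by simp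
    qed
    also have "\<dots> = 2 * KM L ^ 2 * real (card ?S)" by simp
    also have "real (card ?S) \<le> real (card {- int (b n)..int (b n)} ^ card D)"
    proof -
      have "?S = {u \<in> box n. (\<forall>p\<in>{..<L}. \<forall>q\<in>{..<L}. u p = u q \<longleftrightarrow> w0 p = w0 q) \<and>
            (\<forall>i. (\<Sum>p | p \<in> {..<L} \<and> circ p = i. sg p * u p) = 0)}"
        by (auto simp: same_def closed_circ)
      then show ?thesis
        using card_determined_solutions_le[OF _ _ D(1) det, of "{- int (b n)..int (b n)}"] by (simp del: card_atLeastAtMost_int)
    qed
    also have "real (card {- int (b n)..int (b n)} ^ card D) \<le> (3 * real (b n)) ^ card D"
    proof -
      have "real (card {- int (b n)..int (b n)}) \<le> 3 * real (b n)" using elim by simp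
      then show ?thesis unfolding of_nat_power by (rule power_mono) simp
    qed
    finally have X: "norm (\<Sum>w\<in>?S. of_real (\<psi> n w) * wcov fl L1 L w) \<le> 2 * KM L ^ 2 * (3 * real (b n)) ^ card D"
      by (simp add: mult_left_mono)
    have "norm (block_sum w0 n) \<le> 2 * KM L ^ 2 * (3 * real (b n)) ^ card D * (real (b n) / real (b n) ^ H)"
      unfolding block_sum_def norm_mult norm_of_real using X by (intro mult_mono) auto
    also have "\<dots> = ?C * (real (b n) ^ (card D + 1) / real (b n) ^ H)" by (simp add: power_mult_distrib)
    also have "\<dots> \<le> ?C * (1 / real (b n))"
    proof (rule mult_left_mono)
      have "real (b n) ^ (card D + 2) \<le> real (b n) ^ H" using elim D by (intro power_increasing) auto
      then show "real (b n) ^ (card D + 1) / real (b n) ^ H \<le> 1 / real (b n)"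
        using elim by (simp add: field_simps)
    qed simp
    finally show ?case .
  qed
  have "(\<lambda>n. 1 / real (b n)) \<longlonglongrightarrow> 0"
    using b by (intro tendsto_divide_0[OF tendsto_const] filterlim_at_top_imp_at_infinity
      filterlim_compose[OF filterlim_real_sequentially])
  then show "(\<lambda>n. ?C * (1 / real (b n))) \<longlonglongrightarrow> 0" by (rule tendsto_mult_right_zero)
qed

text \<open>With exactly \<open>H - 1\<close> free parameters, on which all indices depend linearly, and a covariance that is constant on the coincidence
class, the block is that constant times a Riemann sum.\<close>

lemma block_sum_leading:
  fixes m :: "nat \<Rightarrow> nat \<Rightarrow> int" and D :: "nat set"
  defines "F x p \<equiv> \<Sum>i\<in>D. m p i * x i"
  assumes D: "D \<subseteq> {..<L}" "card D + 1 = H"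
    and F1: "\<And>w p. same w w0 \<Longrightarrow> closed w \<Longrightarrow> p < L \<Longrightarrow> w p = F w p"
    and F2: "\<And>x. closed (F x)"
    and F3: "\<And>x i. i \<in> D \<Longrightarrow> F x i = x i"
    and mild: "\<And>w. same w w0 \<Longrightarrow> mild fl w [0..<L] \<and> mild fl w [0..<L1] \<and> mild fl w [L1..<L]"
  shows "convergent (block_sum w0)"
proof -
  have finD: "finite D" using D(1) finite_subset by blast
  have cov: "wcov fl L1 L w = wcov fl L1 L w0" if s: "same w w0" for w
  proof -
    have e: "w p = w q \<longleftrightarrow> w0 p = w0 q" if "p < L" "q < L" for p q using s that by (simp add: same_def)
    show ?thesis unfolding wcov_def
      using mild[OF s] e L1L by (intro arg_cong2[of _ _ _ _ "(-)"] arg_cong2[of _ _ _ _ "(*)"] em_labelled_cong) auto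
  qed
  let ?I = "\<lambda>n. {- int (b n)..int (b n)}"
  let ?ok = "\<lambda>n x. (\<forall>p\<in>{..<L}. \<bar>F x p\<bar> \<le> int (b n)) \<and> (\<forall>p\<in>{..<L}. \<forall>q\<in>{..<L}. F x p = F x q \<longleftrightarrow> w0 p = w0 q)"
  have absI: "\<bar>k\<bar> \<le> m \<longleftrightarrow> k \<in> {- m..m}" for k m :: int by auto
  have F_restrict: "F (restrict w D) p = F w p" for w p unfolding F_def by (intro sum.cong) auto
  have F_cong: "F x p = F y p" if "\<And>i. i \<in> D \<Longrightarrow> x i = y i" for x y p unfolding F_def using that by (intro sum.cong) auto
  have sum_eq: "(\<Sum>w\<in>{w\<in>box n. same w w0 \<and> closed w}. \<psi> n w) = (\<Sum>x\<in>D \<rightarrow>\<^sub>E ?I n. if ?ok n x then \<psi> n (F x) else 0)" for n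
  proof -
    have "(\<Sum>w\<in>{w\<in>box n. same w w0 \<and> closed w}. \<psi> n w) = (\<Sum>x\<in>{x\<in>D \<rightarrow>\<^sub>E ?I n. ?ok n x}. \<psi> n (F x))"
    proof (rule sum.reindex_bij_witness[of _ "\<lambda>x. restrict (F x) {..<L}" "\<lambda>w. restrict w D"])
      fix w assume w: "w \<in> {w\<in>box n. same w w0 \<and> closed w}"
      then have Fw: "F w p = w p" if "p < L" for p using F1[of w p] that by simp
      show "restrict (F (restrict w D)) {..<L} = w"
        using w Fw by (auto simp: fun_eq_iff F_restrict PiE_iff extensional_def)
      have "restrict w D \<in> D \<rightarrow>\<^sub>E ?I n" using w D by (auto simp: PiE_iff)
      moreover have "?ok n (restrict w D)"
        using w Fw by (auto simp: F_restrict same_def PiE_iff absI)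
      ultimately show "restrict w D \<in> {x\<in>D \<rightarrow>\<^sub>E ?I n. ?ok n x}" by blast
      show "\<psi> n (F (restrict w D)) = \<psi> n w" using Fw by (intro \<psi>_cong) (simp add: F_restrict)
    next
      fix x assume x: "x \<in> {x\<in>D \<rightarrow>\<^sub>E ?I n. ?ok n x}"
      let ?w = "restrict (F x) {..<L}"
      show "restrict ?w D = x"
        using x D F3[of _ x] by (auto simp: fun_eq_iff PiE_iff extensional_def)
      have "closed ?w"
      proof -
        have "(\<Sum>p<L1. sg p * ?w p) = (\<Sum>p<L1. sg p * F x p)" "(\<Sum>p\<in>{L1..<L}. sg p * ?w p) = (\<Sum>p\<in>{L1..<L}. sg p * F x p)"
          using L1L by (auto intro!: sum.cong)
        then show ?thesis using F2[of x] unfolding closed_def by simp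
      qed
      moreover have "same ?w w0" using x by (simp add: same_def)
      moreover have "?w \<in> box n" using x by (auto simp: PiE_iff absI)
      ultimately show "?w \<in> {w\<in>box n. same w w0 \<and> closed w}" by blast
    qed
    also have "\<dots> = (\<Sum>x\<in>D \<rightarrow>\<^sub>E ?I n. if ?ok n x then \<psi> n (F x) else 0)"
      using finD by (intro sum.mono_neutral_cong_left finite_PiE) auto
    finally show ?thesis .
  qed
  have conv: "convergent (\<lambda>n. (\<Sum>x\<in>D \<rightarrow>\<^sub>E ?I n. if ?ok n x then \<psi> n (F x) else 0) / real (b n) ^ card D)"
    unfolding F_def by (rule riemann_sum_convergent[where \<Psi> = \<Psi>]) (use finD b \<psi>01 \<psi> in auto)
  then obtain v where v: "(\<lambda>n. (\<Sum>x\<in>D \<rightarrow>\<^sub>E ?I n. if ?ok n x then \<psi> n (F x) else 0) / real (b n) ^ card D) \<longlonglongrightarrow> v"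
    by (auto simp: convergent_def)
  have ev: "\<forall>\<^sub>F n in sequentially. block_sum w0 n = of_real ((\<Sum>x\<in>D \<rightarrow>\<^sub>E ?I n. if ?ok n x then \<psi> n (F x) else 0) / real (b n) ^ card D) * wcov fl L1 L w0"
    using filterlim_nat_pos[OF b]
  proof eventually_elim
    case (elim n)
    have "(\<Sum>w\<in>{w\<in>box n. same w w0 \<and> closed w}. of_real (\<psi> n w) * wcov fl L1 L w) =
        (\<Sum>w\<in>{w\<in>box n. same w w0 \<and> closed w}. of_real (\<psi> n w) * wcov fl L1 L w0)"
      using cov by (intro sum.cong) auto
    also have "\<dots> = of_real (\<Sum>w\<in>{w\<in>box n. same w w0 \<and> closed w}. \<psi> n w) * wcov fl L1 L w0"
      by (simp add: sum_distrib_right)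
    also have "\<dots> = of_real (\<Sum>x\<in>D \<rightarrow>\<^sub>E ?I n. if ?ok n x then \<psi> n (F x) else 0) * wcov fl L1 L w0"
      unfolding sum_eq ..
    finally have 1: "(\<Sum>w\<in>{w\<in>box n. same w w0 \<and> closed w}. of_real (\<psi> n w) * wcov fl L1 L w) = \<dots>" .
    have 2: "real (b n) / real (b n) ^ H = 1 / real (b n) ^ card D"
      using elim D(2)[symmetric] by simp
    show ?case unfolding block_sum_def 1 2 by simp
  qed
  have "(\<lambda>n. of_real ((\<Sum>x\<in>D \<rightarrow>\<^sub>E ?I n. if ?ok n x then \<psi> n (F x) else 0) / real (b n) ^ card D) * wcov fl L1 L w0) \<longlonglongrightarrow> of_real v * wcov fl L1 L w0"
    by (intro tendsto_intros v)
  then have "block_sum w0 \<longlonglongrightarrow> of_real v * wcov fl L1 L w0" using ev by (simp add: tendsto_cong)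
  then show ?thesis by (rule convergentI)
qed

lemma same_wcov_0:
  assumes "\<And>w. same w w0 \<Longrightarrow> wcov fl L1 L w = 0"
  shows "convergent (block_sum w0)"
proof -
  have "block_sum w0 = (\<lambda>_. 0)" unfolding block_sum_def using assms by (auto simp: fun_eq_iff)
  then show ?thesis by (simp add: convergent_const)
qed

text \<open>For classes of size at most four, a vanishing signed count means as many conjugated as
unconjugated letters, hence \<open>0 + 0\<close>, \<open>1 + 1\<close> or \<open>2 + 2\<close>.\<close>

lemma mild_upt:
  assumes "\<And>p. p < L \<Longrightarrow> card {q. q < L \<and> w q = w p} \<le> k" "d \<le> L"
    and k: "k = 2 \<or> k = 4 \<and> (\<forall>p<L. (\<Sum>q | q \<in> {c..<d} \<and> w q = w p. sg q) = 0)"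
  shows "mild fl w [c..<d]"
  unfolding mild_def Let_def
proof
  fix p assume "p \<in> set [c..<d]"
  then have p: "p < L" using assms(2) by simp
  let ?qs = "filter (\<lambda>q. w q = w p) [c..<d]"
  have dis: "distinct ?qs" and set: "set ?qs = {q. q \<in> {c..<d} \<and> w q = w p}" by auto
  have "length ?qs = card {q. q \<in> {c..<d} \<and> w q = w p}" using distinct_card[OF dis] set by simp
  also have "\<dots> \<le> card {q. q < L \<and> w q = w p}" using assms(2) by (intro card_mono) auto
  finally have len: "length ?qs \<le> k" using assms(1)[OF p] by simp
  show "length ?qs \<le> 2 \<or> length ?qs = 4 \<and> length (filter fl ?qs) = 2"
  proof (cases "k = 2")
    case False
    then have k4: "k = 4" and "(\<Sum>q | q \<in> {c..<d} \<and> w q = w p. sg q) = 0" using k p by auto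
    then have "sum_list (map sg ?qs) = 0" using sum_list_distinct_conv_sum_set[OF dis, of sg] set by simp
    moreover have sl: "sum_list (map sg xs) = 2 * int (length (filter fl xs)) - int (length xs)" for xs
      by (induction xs) (auto simp: sg_def)
    ultimately have "2 * length (filter fl ?qs) = length ?qs" using sl[of ?qs] by linarith
    then show ?thesis using len k4 by presburger
  qed (use len in simp)
qed

end

text \<open>The patterns for which neither centring nor independence makes the covariance vanish.\<close>

locale linked_pattern = pair_sum +
  fixes w0 :: "nat \<Rightarrow> int" and p0 q0 :: nat
  assumes p0: "p0 < L1" and q0: "L1 \<le> q0" "q0 < L" and w0_eq: "w0 p0 = w0 q0"
    and partner: "\<And>p. p < L \<Longrightarrow> \<exists>q<L. q \<noteq> p \<and> w0 q = w0 p"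
begin

text \<open>Each class is represented by its least element, except that \<open>p0\<close> represents its own class.\<close>

definition rep :: "nat \<Rightarrow> nat" where
  "rep p = (if w0 p = w0 p0 then p0 else LEAST q. w0 q = w0 p)"

definition reps :: "nat set" where "reps = rep ` {..<L}"

definition cls :: "nat \<Rightarrow> nat set" where "cls r = {p. p < L \<and> rep p = r}"

text \<open>The signed count of a class in a set of positions: its coefficient in the constraint that the
  signed sum over these positions vanishes.\<close>

definition cf :: "nat set \<Rightarrow> nat \<Rightarrow> int" where "cf S r = (\<Sum>p | p \<in> S \<and> rep p = r. sg p)"

lemma p0L: "p0 < L" using p0 L1L by simp

lemma w0_rep: "w0 (rep p) = w0 p"
  unfolding rep_def using LeastI[of "\<lambda>q. w0 q = w0 p" p] by simp

lemma rep_eq_iff: "rep p = rep q \<longleftrightarrow> w0 p = w0 q"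
  using w0_rep[of p] w0_rep[of q] by (auto simp: rep_def)

lemma repL: "p < L \<Longrightarrow> rep p < L"
  unfolding rep_def using p0L Least_le[of "\<lambda>q. w0 q = w0 p" p] by auto

lemma rep_in: "p < L \<Longrightarrow> rep p \<in> reps" by (simp add: reps_def)

lemma rep_id: "r \<in> reps \<Longrightarrow> rep r = r"
  unfolding reps_def by (auto simp: rep_eq_iff w0_rep)

lemma rep_p0: "rep p0 = p0" by (simp add: rep_def)

lemma reps: "reps \<subseteq> {..<L}" "finite reps" "p0 \<in> reps"
  using repL rep_in[OF p0L] by (auto simp: reps_def rep_p0)

lemma card_cls_ge: "2 \<le> card (cls r)" if "r \<in> reps"
proof -
  have "r < L" using that reps by auto
  then obtain q where q: "q < L" "q \<noteq> r" "w0 q = w0 r" using partner by blast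
  then have "rep q = r" using rep_eq_iff[of q r] rep_id[OF that] by simp
  then show ?thesis using q \<open>r < L\<close> rep_id[OF that]
    by (intro card_ge_two_partner[of _ r q]) (auto simp: cls_def)
qed

lemma sum_card_cls: "(\<Sum>r\<in>reps. card (cls r)) = L"
  using sum.group[of "{..<L}" reps rep "\<lambda>_. 1::nat"] reps(2) rep_in by (auto simp: cls_def)

lemma card_cls_le: "card (cls r) + 2 * (card reps - 1) \<le> L" if "r \<in> reps"
proof -
  have "(\<Sum>r\<in>reps - {r}. 2) \<le> (\<Sum>r\<in>reps - {r}. card (cls r))" using card_cls_ge by (intro sum_mono) auto
  then show ?thesis using sum_card_cls sum.remove[OF reps(2) that, of "\<lambda>r. card (cls r)"] that reps(2) by simp
qed

lemma card_reps: "2 * card reps \<le> L" "card reps \<ge> 1"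
  using sum_mono[of reps "\<lambda>_. 2" "\<lambda>r. card (cls r)"] card_cls_ge sum_card_cls reps
  by (auto simp: Suc_le_eq card_gt_0_iff)

lemma sum_by_classes:
  assumes z: "\<And>p. p < L \<Longrightarrow> z p = z (rep p)" and S: "S \<subseteq> {..<L}"
  shows "(\<Sum>p\<in>S. sg p * z p) = (\<Sum>r\<in>reps. cf S r * z r)"
proof -
  have "(\<Sum>p\<in>S. sg p * z p) = (\<Sum>r\<in>reps. \<Sum>p | p \<in> S \<and> rep p = r. sg p * z p)"
    using S finite_subset[OF S] rep_in reps(2) by (intro sum.group[symmetric]) auto
  also have "\<dots> = (\<Sum>r\<in>reps. cf S r * z r)"
    unfolding cf_def sum_distrib_right using z S by (intro sum.cong) auto
  finally show ?thesis .
qed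

lemma segments: "{..<L1} \<subseteq> {..<L}" "{L1..<L} \<subseteq> {..<L}" using L1L by auto

lemma closed_by_classes:
  assumes "\<And>p. p < L \<Longrightarrow> z p = z (rep p)"
  shows "closed z \<longleftrightarrow> (\<Sum>r\<in>reps. cf {..<L1} r * z r) = 0 \<and> (\<Sum>r\<in>reps. cf {L1..<L} r * z r) = 0"
  unfolding closed_def using sum_by_classes[of z, OF _ segments(1)] sum_by_classes[of z, OF _ segments(2)] assms by simp

lemma determines_by_classes:
  assumes *: "\<And>z r. (\<And>r. r \<in> D \<Longrightarrow> z r = 0) \<Longrightarrow> (\<Sum>r\<in>reps. cf {..<L1} r * z r) = 0 \<Longrightarrow>
    (\<Sum>r\<in>reps. cf {L1..<L} r * z r) = 0 \<Longrightarrow> r \<in> reps \<Longrightarrow> z r = 0"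
  shows "determines {..<L} w0 circ sg D"
proof (rule determinesI)
  fix z :: "nat \<Rightarrow> int"
  assume z: "\<And>p q. p \<in> {..<L} \<Longrightarrow> q \<in> {..<L} \<Longrightarrow> w0 p = w0 q \<Longrightarrow> z p = z q"
    and s: "\<And>i. (\<Sum>p | p \<in> {..<L} \<and> circ p = i. sg p * z p) = 0" and d: "\<And>p. p \<in> D \<Longrightarrow> z p = 0"
  have zr: "z p = z (rep p)" if "p < L" for p using z[of p "rep p"] repL[OF that] that w0_rep by auto
  have "closed z" unfolding closed_circ using s by blast
  then have "z r = 0" if "r \<in> reps" for r using *[of z] d that closed_by_classes[of z] zr by blast
  then show "\<forall>p\<in>{..<L}. z p = 0" using zr rep_in by auto
qed

lemma same_rep: "w p = w (rep p)" if "same w w0" "p < L"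
  using that repL[OF that(2)] w0_rep unfolding same_def by metis

lemma class_same: "{q. q < L \<and> w q = w p} = cls (rep p)" if "same w w0" "p < L"
  using that unfolding same_def cls_def rep_eq_iff by auto

lemma remove_rep:
  fixes g :: "nat \<Rightarrow> int"
  shows "r \<in> reps \<Longrightarrow> (\<Sum>r\<in>reps. g r) = g r + (\<Sum>r\<in>reps - {r}. g r)"
  by (rule sum.remove[OF reps(2)])

text \<open>With only \<open>H - 1\<close> classes, a class with nonzero signed count in one of the words is determined
  by the others, and too few free parameters are left. Otherwise the constraints are void and all
  classes are free parameters; a class then has at most four elements and is balanced in each word, so that the
  covariance depends on the coincidences only.\<close>

lemma convergent_one_class_less:
  assumes c: "card reps + 1 = H"
  shows "convergent (block_sum w0)"
proof (cases "\<exists>S\<in>{{..<L1}, {L1..<L}}. \<exists>r1\<in>reps. cf S r1 \<noteq> 0")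
  case True
  then obtain S r1 where S: "S = {..<L1} \<or> S = {L1..<L}" and r1: "r1 \<in> reps" "cf S r1 \<noteq> 0" by blast
  have "determines {..<L} w0 circ sg (reps - {r1})"
  proof (rule determines_by_classes)
    fix z :: "nat \<Rightarrow> int" and r
    assume d: "\<And>r. r \<in> reps - {r1} \<Longrightarrow> z r = 0" and s: "(\<Sum>r\<in>reps. cf {..<L1} r * z r) = 0" "(\<Sum>r\<in>reps. cf {L1..<L} r * z r) = 0"
      and r: "r \<in> reps"
    have "(\<Sum>r\<in>reps. cf S r * z r) = 0" using S s by auto
    moreover have "(\<Sum>r\<in>reps - {r1}. cf S r * z r) = 0" using d by (intro sum.neutral) auto
    ultimately have "z r1 = 0" using r1 remove_rep[OF r1(1), of "\<lambda>r. cf S r * z r"] by simp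
    then show "z r = 0" using d r by (cases "r = r1") auto
  qed
  moreover have "card (reps - {r1}) + 2 \<le> H" using c r1 reps(2) card_reps by simp
  ultimately show ?thesis using block_sum_negligible[of "reps - {r1}"] reps(1) convergentI by blast
next
  case False
  then have cf0: "cf {..<L1} r = 0" "cf {L1..<L} r = 0" if "r \<in> reps" for r using that by auto
  define m :: "nat \<Rightarrow> nat \<Rightarrow> int" where "m p i = (if i = rep p then 1 else 0)" for p i
  have F: "(\<Sum>i\<in>reps. m p i * x i) = x (rep p)" if "p < L" for x p
    using rep_in[OF that] reps(2) by (simp add: m_def if_distrib[of "\<lambda>x. x * _"] sum.delta cong: if_cong)
  have closedF: "closed (\<lambda>p. \<Sum>i\<in>reps. m p i * x i)" for x
  proof -
    have FF: "(\<Sum>i\<in>reps. m p i * x i) = (\<Sum>i\<in>reps. m (rep p) i * x i)" if "p < L" for p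
      using F[OF that] F[OF repL[OF that]] rep_id[OF rep_in[OF that]] by simp
    show ?thesis by (rule closed_by_classes[THEN iffD2]) (use FF cf0 in auto)
  qed
  have c0: "cf {0..<L} r = 0" "cf {0..<L1} r = 0" "cf {L1..<L} r = 0" if "r \<in> reps" for r
  proof -
    show 1: "cf {0..<L1} r = 0" "cf {L1..<L} r = 0" using cf0[OF that] by (simp_all add: atLeast0LessThan)
    have "{p. p \<in> {0..<L} \<and> rep p = r} = {p. p \<in> {0..<L1} \<and> rep p = r} \<union> {p. p \<in> {L1..<L} \<and> rep p = r}"
      using L1L by auto
    moreover have "sum sg ({p. p \<in> {0..<L1} \<and> rep p = r} \<union> {p. p \<in> {L1..<L} \<and> rep p = r}) =
        sum sg {p. p \<in> {0..<L1} \<and> rep p = r} + sum sg {p. p \<in> {L1..<L} \<and> rep p = r}"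
      by (rule sum.union_disjoint) auto
    ultimately have "cf {0..<L} r = cf {0..<L1} r + cf {L1..<L} r" unfolding cf_def by (simp only:)
    then show "cf {0..<L} r = 0" using 1 by simp
  qed
  have mild: "mild fl w [0..<L] \<and> mild fl w [0..<L1] \<and> mild fl w [L1..<L]" if w: "same w w0" for w
  proof -
    have card4: "card {q. q < L \<and> w q = w p} \<le> 4" if "p < L" for p
      unfolding class_same[OF w that] using card_cls_le[OF rep_in[OF that]] c LH card_reps by linarith
    have z: "(\<Sum>q | q \<in> S \<and> w q = w p. sg q) = cf S (rep p)" if "p < L" "S \<subseteq> {..<L}" for p S
    proof -
      have "{q. q \<in> S \<and> w q = w p} = {q. q \<in> S \<and> rep q = rep p}"
        using class_same[OF w that(1)] that(2) by (auto simp: cls_def)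
      then show ?thesis by (simp add: cf_def)
    qed
    have "{0..<L} \<subseteq> {..<L}" "{0..<L1} \<subseteq> {..<L}" "{L1..<L} \<subseteq> {..<L}" using L1L by auto
    then have "\<forall>p<L. (\<Sum>q | q \<in> {0..<L} \<and> w q = w p. sg q) = 0"
      "\<forall>p<L. (\<Sum>q | q \<in> {0..<L1} \<and> w q = w p. sg q) = 0"
      "\<forall>p<L. (\<Sum>q | q \<in> {L1..<L} \<and> w q = w p. sg q) = 0"
      using z c0 rep_in by presburger+
    then show ?thesis using L1L by (intro conjI mild_upt[where k = 4] card4) blast+
  qed
  show ?thesis
  proof (rule block_sum_leading[where D = reps and m = m])
    show "w p = (\<Sum>i\<in>reps. m p i * w i)" if "same w w0" "p < L" for w p
      using same_rep[OF that] F[OF that(2)] by simp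
    show "(\<Sum>ia\<in>reps. m i ia * x ia) = x i" if "i \<in> reps" for x i
      using F[of i x] rep_id[OF that] reps that by auto
  qed (use reps c closedF mild in auto)
qed

text \<open>If all classes are pairs, one constraint is solved for the value of the pair \<open>p0\<close>, \<open>q0\<close> that
  joins the two words. Eliminating this value from the other constraint leaves either a nontrivial
  equation, which costs a second parameter, or a void one.\<close>

lemma convergent_all_pairs:
  assumes c: "card reps = H"
  shows "convergent (block_sum w0)"
proof -
  let ?S1 = "{..<L1}" and ?S2 = "{L1..<L}"
  have card2: "card (cls r) = 2" if "r \<in> reps" for r
    using card_cls_le[OF that] card_cls_ge[OF that] c LH card_reps by linarith
  have clsp0: "cls p0 = {p0, q0}"
  proof -
    have "{p0, q0} \<subseteq> cls p0" using p0L q0 w0_eq rep_eq_iff[of p0 q0] by (auto simp: cls_def rep_p0)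
    moreover have "card {p0, q0} = 2" using p0 q0 by auto
    moreover have "finite (cls p0)" by (auto simp: cls_def)
    ultimately show ?thesis using card2[OF reps(3)] by (metis card_subset_eq)
  qed
  have cfp0: "cf ?S1 p0 = sg p0" "cf ?S2 p0 = sg q0"
  proof -
    have "{p. p \<in> ?S1 \<and> rep p = p0} = cls p0 \<inter> ?S1" "{p. p \<in> ?S2 \<and> rep p = p0} = cls p0 \<inter> ?S2"
      using L1L by (auto simp: cls_def)
    then have "{p. p \<in> ?S1 \<and> rep p = p0} = {p0}" "{p. p \<in> ?S2 \<and> rep p = p0} = {q0}"
      unfolding clsp0 using p0 q0 by auto
    then show "cf ?S1 p0 = sg p0" "cf ?S2 p0 = sg q0" by (simp_all add: cf_def)
  qed
  have sq: "sg p * sg p = 1" for p by (simp add: sg_def)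
  \<comment> \<open>The sign with which the second constraint is added to the first to cancel the
    contribution of \<open>p0\<close>, \<open>q0\<close>; \<open>cm\<close> is the combined constraint.\<close>
  define \<eta> where "\<eta> = - (sg p0 * sg q0)"
  define cm where "cm r = cf ?S1 r + \<eta> * cf ?S2 r" for r
  have \<eta>: "\<eta> * \<eta> = 1" using sq[of p0] sq[of q0] by (simp add: \<eta>_def mult.left_commute mult.assoc)
  have cm0: "cm p0 = 0" using sq[of q0] by (simp add: cm_def cfp0 \<eta>_def mult.assoc)
  have cm_sum: "(\<Sum>r\<in>reps. cm r * z r) = (\<Sum>r\<in>reps. cf ?S1 r * z r) + \<eta> * (\<Sum>r\<in>reps. cf ?S2 r * z r)" for z
    by (simp add: cm_def sum.distrib sum_distrib_left algebra_simps)
  show ?thesis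
  proof (cases "\<exists>r1\<in>reps. cm r1 \<noteq> 0")
    case True
    then obtain r1 where r1: "r1 \<in> reps" "cm r1 \<noteq> 0" by blast
    have r1p0: "r1 \<noteq> p0" using r1 cm0 by auto
    have "determines {..<L} w0 circ sg (reps - {p0, r1})"
    proof (rule determines_by_classes)
      fix z :: "nat \<Rightarrow> int" and r
      assume d: "\<And>r. r \<in> reps - {p0, r1} \<Longrightarrow> z r = 0" and s: "(\<Sum>r\<in>reps. cf ?S1 r * z r) = 0" "(\<Sum>r\<in>reps. cf ?S2 r * z r) = 0"
        and r: "r \<in> reps"
      have "(\<Sum>r\<in>reps. cm r * z r) = 0" using s by (simp add: cm_sum)
      moreover have "(\<Sum>r\<in>reps - {r1}. cm r * z r) = 0"
      proof (rule sum.neutral, rule ballI)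
        fix r assume "r \<in> reps - {r1}"
        then show "cm r * z r = 0" using d[of r] cm0 by (cases "r = p0") auto
      qed
      ultimately have z1: "z r1 = 0" using r1 remove_rep[OF r1(1), of "\<lambda>r. cm r * z r"] by simp
      have "(\<Sum>r\<in>reps - {p0}. cf ?S1 r * z r) = 0"
      proof (rule sum.neutral, rule ballI)
        fix r assume "r \<in> reps - {p0}"
        then show "cf ?S1 r * z r = 0" using d[of r] z1 by (cases "r = r1") auto
      qed
      then have "sg p0 * z p0 = 0" using s cfp0 remove_rep[OF reps(3), of "\<lambda>r. cf ?S1 r * z r"] by simp
      then have "z p0 = 0" using sq[of p0] by auto
      then show "z r = 0" using d[of r] z1 r by (cases "r = r1"; cases "r = p0") auto
    qed
    moreover have "card (reps - {p0, r1}) + 2 \<le> H"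
    proof -
      have "card {p0, r1} \<le> card reps" using reps r1 by (intro card_mono) auto
      then show ?thesis using c reps r1 r1p0 by (subst card_Diff_subset) auto
    qed
    ultimately show ?thesis using block_sum_negligible[of "reps - {p0, r1}"] reps(1) convergentI by blast
  next
    case False
    then have cm: "cm r = 0" if "r \<in> reps" for r using that by blast
    define D where "D = reps - {p0}"
    have finD: "finite D" using reps by (simp add: D_def)
    have RD: "(\<Sum>r\<in>reps. g r) = g p0 + (\<Sum>r\<in>D. g r)" for g :: "nat \<Rightarrow> int"
      unfolding D_def by (rule remove_rep[OF reps(3)])
    \<comment> \<open>The first constraint solved for the value of the class of \<open>p0\<close>; all other classes are free.\<close>
    define m :: "nat \<Rightarrow> nat \<Rightarrow> int" where
      "m p i = (if rep p = p0 then - (sg p0 * cf ?S1 i) else if i = rep p then 1 else 0)" for p i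
    have F: "(\<Sum>i\<in>D. m p i * x i) = x (rep p)" if "p < L" "rep p \<noteq> p0" for x p
      using rep_in[OF that(1)] that finD by (simp add: m_def D_def if_distrib[of "\<lambda>x. x * _"] sum.delta cong: if_cong)
    have F0: "(\<Sum>i\<in>D. m p i * x i) = - sg p0 * (\<Sum>i\<in>D. cf ?S1 i * x i)" if "rep p = p0" for x p
      using that by (simp add: m_def sum_distrib_left sum_negf mult.assoc)
    have closedF: "closed (\<lambda>p. \<Sum>i\<in>D. m p i * x i)" for x
    proof -
      let ?z = "\<lambda>p. \<Sum>i\<in>D. m p i * x i"
      have FF: "?z p = ?z (rep p)" if "p < L" for p
        unfolding m_def rep_id[OF rep_in[OF that]] ..
      have "?z r = x r" if "r \<in> D" for r
        using F[of r x] rep_id[of r] that reps by (auto simp: D_def)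
      then have "(\<Sum>r\<in>reps. cf ?S1 r * ?z r) = sg p0 * ?z p0 + (\<Sum>r\<in>D. cf ?S1 r * x r)"
        unfolding RD cfp0 by simp
      also have "\<dots> = 0" using F0[OF rep_p0, of x] sq[of p0] by (simp add: mult.assoc[symmetric])
      finally have s1: "(\<Sum>r\<in>reps. cf ?S1 r * ?z r) = 0" .
      have "(\<Sum>r\<in>reps. cm r * ?z r) = 0" using cm by (intro sum.neutral) auto
      then have "\<eta> * (\<Sum>r\<in>reps. cf ?S2 r * ?z r) = 0" using s1 cm_sum[of ?z] by simp
      then have s2: "(\<Sum>r\<in>reps. cf ?S2 r * ?z r) = 0" using \<eta> by auto
      show ?thesis by (rule closed_by_classes[THEN iffD2]) (use FF s1 s2 in auto)
    qed
    have mild: "mild fl w [0..<L] \<and> mild fl w [0..<L1] \<and> mild fl w [L1..<L]" if w: "same w w0" for w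
    proof -
      have c2: "card {q. q < L \<and> w q = w p} \<le> 2" if "p < L" for p
        unfolding class_same[OF w that] using card2[OF rep_in[OF that]] by simp
      show ?thesis using L1L by (intro conjI mild_upt[where k = 2] c2) auto
    qed
    show ?thesis
    proof (rule block_sum_leading[where D = D and m = m])
      show "D \<subseteq> {..<L}" "card D + 1 = H" using reps c card_reps by (auto simp: D_def)
      show "w p = (\<Sum>i\<in>D. m p i * w i)" if w: "same w w0" and cl: "closed w" and p: "p < L" for w p
      proof (cases "rep p = p0")
        case False
        then show ?thesis using same_rep[OF w p] F[OF p] by simp
      next
        case True
        have "(\<Sum>r\<in>reps. cf ?S1 r * w r) = 0"
          using cl closed_by_classes[of w, OF same_rep[OF w]] by blast
        then have "sg p0 * w p0 = - (\<Sum>r\<in>D. cf ?S1 r * w r)" unfolding RD cfp0 by simp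
        then have "sg p0 * (sg p0 * w p0) = - sg p0 * (\<Sum>r\<in>D. cf ?S1 r * w r)" by simp
        then have "w p0 = - sg p0 * (\<Sum>r\<in>D. cf ?S1 r * w r)" using sq[of p0] by (simp add: mult.assoc[symmetric])
        then show ?thesis using same_rep[OF w p] F0[OF True] True by simp
      qed
      show "(\<Sum>ia\<in>D. m i ia * x ia) = x i" if "i \<in> D" for x i
        using F[of i x] rep_id[of i] reps that by (auto simp: D_def)
    qed (use closedF mild in auto)
  qed
qed

lemma linked_block_sum_convergent: "convergent (block_sum w0)"
proof -
  consider "card reps + 2 \<le> H" | "card reps + 1 = H" | "card reps = H" using card_reps LH by linarith
  then show ?thesis
  proof cases
    case 1
    have "determines {..<L} w0 circ sg reps" by (rule determines_by_classes) blast
    then show ?thesis using block_sum_negligible[OF reps(1) 1] convergentI by blast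
  qed (fact convergent_one_class_less convergent_all_pairs)+
qed

end

context pair_sum
begin

text \<open>The covariance vanishes on patterns with an unpaired index, because the entries are centred, and on
  patterns without a common index of the two words, by independence; the others are linked.\<close>

lemma block_sum_convergent: "convergent (block_sum w0)"
proof -
  consider p where "p < L" "\<And>q. q < L \<Longrightarrow> q \<noteq> p \<Longrightarrow> w0 q \<noteq> w0 p"
    | "\<And>p q. p < L1 \<Longrightarrow> L1 \<le> q \<Longrightarrow> q < L \<Longrightarrow> w0 p \<noteq> w0 q"
    | p0 q0 where "p0 < L1" "L1 \<le> q0" "q0 < L" "w0 p0 = w0 q0"
        "\<And>p. p < L \<Longrightarrow> \<exists>q<L. q \<noteq> p \<and> w0 q = w0 p"
    by blast
  then show ?thesis
  proof cases
    case (1 p)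
    show ?thesis
    proof (rule same_wcov_0)
      fix w assume "same w w0"
      then show "wcov fl L1 L w = 0" using 1 by (intro wcov_unpaired[OF L1L 1(1)]) (auto simp: same_def)
    qed
  next
    case 2
    show ?thesis
    proof (rule same_wcov_0)
      fix w assume "same w w0"
      then show "wcov fl L1 L w = 0" using 2 L1L by (intro wcov_no_cross[OF L1L]) (auto simp: same_def)
    qed
  next
    case (3 p0 q0)
    interpret linked_pattern M a \<kappa> \<tau> CM fl L1 L H b \<psi> \<Psi> w0 p0 q0
      using 3 by unfold_locales
    show ?thesis by (rule linked_block_sum_convergent)
  qed
qed

text \<open>The coincidence pattern of an assignment is recorded by its kernel; there are finitely many.\<close>

lemma total_convergent:
  "convergent (\<lambda>n. (\<Sum>w\<in>{w\<in>box n. closed w}. of_real (\<psi> n w) * wcov fl L1 L w) *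
     of_real (real (b n) / real (b n) ^ H))"
proof -
  define ker where "ker w = {(p,q). p < L \<and> q < L \<and> w p = w q}" for w :: "nat \<Rightarrow> int"
  have ker_same: "ker w = ker w0 \<longleftrightarrow> same w w0" for w w0 by (auto simp: ker_def same_def set_eq_iff)
  let ?Ks = "Pow ({..<L} \<times> {..<L})"
  let ?g = "\<lambda>n w. of_real (\<psi> n w) * wcov fl L1 L w"
  have "(\<Sum>w\<in>{w\<in>box n. closed w}. ?g n w) * of_real (real (b n) / real (b n) ^ H) =
     (\<Sum>K\<in>?Ks. (\<Sum>w\<in>{w\<in>box n. ker w = K \<and> closed w}. ?g n w) * of_real (real (b n) / real (b n) ^ H))" for n
  proof -
    have "(\<Sum>w\<in>{w\<in>box n. closed w}. ?g n w) = (\<Sum>K\<in>?Ks. \<Sum>w\<in>{w\<in>{w\<in>box n. closed w}. ker w = K}. ?g n w)"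
      by (rule sum.group[symmetric]) (auto simp: finite_box ker_def)
    also have "\<dots> = (\<Sum>K\<in>?Ks. \<Sum>w\<in>{w\<in>box n. ker w = K \<and> closed w}. ?g n w)"
      by (intro sum.cong) auto
    finally show ?thesis by (simp only: sum_distrib_right)
  qed
  moreover have "convergent (\<lambda>n. (\<Sum>w\<in>{w\<in>box n. ker w = K \<and> closed w}. ?g n w) * of_real (real (b n) / real (b n) ^ H))" for K
  proof (cases "\<exists>w0. ker w0 = K")
    case True
    then obtain w0 where "ker w0 = K" by blast
    then have "(\<lambda>n. (\<Sum>w\<in>{w\<in>box n. ker w = K \<and> closed w}. ?g n w) * of_real (real (b n) / real (b n) ^ H)) = block_sum w0"
      unfolding block_sum_def ker_same[symmetric] by auto
    then show ?thesis using block_sum_convergent by simp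
  next
    case False
    then have "{w\<in>box n. ker w = K \<and> closed w} = {}" for n by blast
    then show ?thesis by (simp only: sum.empty) (simp add: convergent_const)
  qed
  ultimately show ?thesis by (simp add: convergent_sum)
qed

end

section \<open>The trace as a sum over walks\<close>

text \<open>In the product of the matrices, a factor \<open>T\<close> contributes \<open>a\<^sub>i\<^sub>-\<^sub>k\<close> when the row index changes from \<open>i\<close> to \<open>k\<close>, and \<open>T\<^sup>*\<close>
contributes the conjugate of \<open>a\<^sub>k\<^sub>-\<^sub>i\<close>. Hence a letter with index \<open>x\<close> moves the walk by \<open>x\<close> if it is conjugated
and by \<open>- x\<close> otherwise.\<close>

definition step :: "int \<times> bool \<Rightarrow> int" where
  "step x = (if snd x then fst x else - fst x)"

definition total :: "word \<Rightarrow> int" where "total u = (\<Sum>x\<leftarrow>u. step x)"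

fun stays :: "nat \<Rightarrow> int \<Rightarrow> word \<Rightarrow> bool" where
  "stays n i [] \<longleftrightarrow> 0 \<le> i \<and> i < int n"
| "stays n i (x # u) \<longleftrightarrow> 0 \<le> i \<and> i < int n \<and> stays n (i + step x) u"

text \<open>The matrix has finite size, so a word contributes once for each row from which its walk does not leave
the rows \<open>0\<close> to \<open>n - 1\<close>.\<close>

definition starts :: "nat \<Rightarrow> word \<Rightarrow> nat" where
  "starts n u = card {i. stays n i u}"

definition words :: "nat \<Rightarrow> bool list \<Rightarrow> word set" where
  "words h fs = {u. map snd u = fs \<and> idx u \<subseteq> {- int h..int h}}"

fun band_prod :: "nat \<Rightarrow> nat \<Rightarrow> (int \<Rightarrow> complex) \<Rightarrow> bool list \<Rightarrow> complex mat" where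
  "band_prod n h c [] = 1\<^sub>m n"
| "band_prod n h c (f # fs) =
    (if f then mat_adjoint (toeplitz_band n h c) else toeplitz_band n h c) * band_prod n h c fs"

lemma words_Nil [simp]: "words h [] = {[]}" by (auto simp: words_def)

lemma words_Cons: "words h (f # fs) = (\<lambda>(x, u). (x, f) # u) ` ({- int h..int h} \<times> words h fs)"
proof (intro equalityI subsetI)
  fix u assume u: "u \<in> words h (f # fs)"
  then obtain y v where "u = y # v" "snd y = f" "map snd v = fs" by (auto simp: words_def)
  moreover from this u have "fst y \<in> {- int h..int h}" "v \<in> words h fs" by (auto simp: words_def)
  ultimately show "u \<in> (\<lambda>(x, u). (x, f) # u) ` ({- int h..int h} \<times> words h fs)"
    by (intro image_eqI[of _ _ "(fst y, v)"]) (auto simp: prod_eq_iff)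
next
  fix u assume "u \<in> (\<lambda>(x, u). (x, f) # u) ` ({- int h..int h} \<times> words h fs)"
  then obtain x v where "u = (x, f) # v" "x \<in> {- int h..int h}" "v \<in> words h fs" by auto
  then show "u \<in> words h (f # fs)" by (simp add: words_def)
qed

lemma finite_words: "finite (words h fs)"
  by (induction fs) (auto simp: words_Cons)

lemma sum_words_Cons:
  "(\<Sum>u\<in>words h (f # fs). g u) = (\<Sum>x\<in>{- int h..int h}. \<Sum>u\<in>words h fs. g ((x, f) # u))"
  unfolding words_Cons sum.cartesian_product
  by (subst sum.reindex) (auto simp: inj_on_def split_beta)

lemma length_words: "u \<in> words h fs \<Longrightarrow> length u = length fs"
  by (auto simp: words_def dest: arg_cong[of _ _ length])

lemma stays_start: "stays n i u \<Longrightarrow> 0 \<le> i \<and> i < int n"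
  by (cases u) auto

lemma band_factor_carrier [simp]:
  "(if f then mat_adjoint (toeplitz_band n h c) else toeplitz_band n h c) \<in> carrier_mat n n"
  by simp

lemma band_prod_carrier [simp]: "band_prod n h c fs \<in> carrier_mat n n"
  by (induction fs) (auto intro!: mult_carrier_mat[of _ n n])

lemma band_factor_index:
  assumes "i < n" "j < n"
  shows "(if f then mat_adjoint (toeplitz_band n h c) else toeplitz_band n h c) $$ (i, j) =
    (if \<bar>int i - int j\<bar> \<le> int h then letter c (if f then int j - int i else int i - int j, f) else 0)"
  using assms by (simp add: mat_adjoint_index toeplitz_band_def letter_def abs_minus_commute)

lemma band_prod_index:
  assumes "i < n" "j < n"
  shows "band_prod n h c fs $$ (i, j) =
    (\<Sum>u\<in>words h fs. if stays n (int i) u \<and> int i + total u = int j then monom_of c u else 0)"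
  using assms
proof (induction fs arbitrary: i)
  case Nil
  then show ?case by (auto simp: total_def)
next
  case (Cons f fs)
  let ?T = "if f then mat_adjoint (toeplitz_band n h c) else toeplitz_band n h c"
  let ?r = "\<lambda>k :: int. \<Sum>u\<in>words h fs. if stays n k u \<and> k + total u = int j then monom_of c u else 0"
  let ?x = "\<lambda>k. if f then int k - int i else int i - int k"
  have dim: "dim_row ?T = n" "dim_col ?T = n" using band_factor_carrier[of f n h c] by blast+
  have dimp: "dim_row (band_prod n h c fs) = n" "dim_col (band_prod n h c fs) = n"
    using band_prod_carrier[of n h c fs] by blast+
  have "band_prod n h c (f # fs) $$ (i, j) = (\<Sum>k<n. ?T $$ (i, k) * band_prod n h c fs $$ (k, j))"
    using Cons.prems dim dimp by (simp add: scalar_prod_def atLeast0LessThan del: if_split)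
  also have "\<dots> = (\<Sum>k<n. if \<bar>int i - int k\<bar> \<le> int h then letter c (?x k, f) * ?r (int k) else 0)"
  proof (rule sum.cong[OF refl])
    fix k assume "k \<in> {..<n}"
    then have k: "k < n" by simp
    show "?T $$ (i, k) * band_prod n h c fs $$ (k, j) =
        (if \<bar>int i - int k\<bar> \<le> int h then letter c (?x k, f) * ?r (int k) else 0)"
      unfolding band_factor_index[OF Cons.prems(1) k] Cons.IH[OF k Cons.prems(2)] by simp
  qed
  also have "\<dots> = (\<Sum>k\<in>{k. k < n \<and> \<bar>int i - int k\<bar> \<le> int h}. letter c (?x k, f) * ?r (int k))"
    by (intro sum.mono_neutral_cong_right) auto
  also have "\<dots> = (\<Sum>x\<in>{x\<in>{- int h..int h}. 0 \<le> int i + step (x, f) \<and> int i + step (x, f) < int n}.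
      letter c (x, f) * ?r (int i + step (x, f)))"
    by (rule sum.reindex_bij_witness[of _ "\<lambda>x. nat (int i + step (x, f))" ?x])
       (auto simp: step_def split: if_splits)
  also have "\<dots> = (\<Sum>x\<in>{- int h..int h}. letter c (x, f) * ?r (int i + step (x, f)))"
  proof (rule sum.mono_neutral_left)
    show "\<forall>x\<in>{- int h..int h} - {x\<in>{- int h..int h}. 0 \<le> int i + step (x, f) \<and> int i + step (x, f) < int n}.
      letter c (x, f) * ?r (int i + step (x, f)) = 0"
    proof
      fix x assume "x \<in> {- int h..int h} - {x\<in>{- int h..int h}. 0 \<le> int i + step (x, f) \<and> int i + step (x, f) < int n}"
      then have "\<not> stays n (int i + step (x, f)) u" for u using stays_start[of n "int i + step (x, f)" u] by auto
      then show "letter c (x, f) * ?r (int i + step (x, f)) = 0" by simp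
    qed
  qed auto
  also have "\<dots> = (\<Sum>x\<in>{- int h..int h}. \<Sum>u\<in>words h fs.
      if stays n (int i) ((x, f) # u) \<and> int i + total ((x, f) # u) = int j then monom_of c ((x, f) # u) else 0)"
    using Cons.prems by (auto simp: sum_distrib_left total_def add.assoc intro!: sum.cong)
  finally show ?case unfolding sum_words_Cons .
qed

lemma trace_band_prod:
  "(\<Sum>i<n. band_prod n h c fs $$ (i, i)) = (\<Sum>u\<in>{u\<in>words h fs. total u = 0}. of_nat (starts n u) * monom_of c u)"
proof -
  have "(\<Sum>i<n. band_prod n h c fs $$ (i, i)) =
      (\<Sum>i<n. \<Sum>u\<in>words h fs. if stays n (int i) u \<and> total u = 0 then monom_of c u else 0)"
    by (intro sum.cong refl) (simp add: band_prod_index)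
  also have "\<dots> = (\<Sum>u\<in>words h fs. \<Sum>i<n. if stays n (int i) u \<and> total u = 0 then monom_of c u else 0)"
    by (rule sum.swap)
  also have "\<dots> = (\<Sum>u\<in>words h fs. if total u = 0 then of_nat (starts n u) * monom_of c u else 0)"
  proof (intro sum.cong refl)
    fix u
    have "card {i. i < n \<and> stays n (int i) u} = starts n u"
    proof -
      have "i \<in> int ` {i. i < n \<and> stays n (int i) u}" if "stays n i u" for i
        using stays_start[OF that] that by (intro image_eqI[of _ _ "nat i"]) auto
      then have "{i. stays n i u} = int ` {i. i < n \<and> stays n (int i) u}" by auto
      then show ?thesis unfolding starts_def by (simp add: card_image)
    qed
    moreover have "{i\<in>{..<n}. stays n (int i) u} = {i. i < n \<and> stays n (int i) u}" by auto
    ultimately show "(\<Sum>i<n. if stays n (int i) u \<and> total u = 0 then monom_of c u else 0) =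
        (if total u = 0 then of_nat (starts n u) * monom_of c u else 0)"
      by (simp add: sum.If_cases Int_def)
  qed
  also have "\<dots> = (\<Sum>u\<in>{u\<in>words h fs. total u = 0}. of_nat (starts n u) * monom_of c u)"
    by (intro sum.mono_neutral_cong_right) (auto simp: finite_words)
  finally show ?thesis .
qed

lemma band_prod_append: "band_prod n h c (fs @ gs) = band_prod n h c fs * band_prod n h c gs"
proof (induction fs)
  case Nil
  show ?case using left_mult_one_mat[OF band_prod_carrier[of n h c gs]] by simp
next
  case (Cons f fs)
  show ?case unfolding append_Cons band_prod.simps Cons
    by (rule assoc_mult_mat[symmetric, of _ n n _ n _ n]) (simp_all del: if_split)
qed

lemma band_prod_singleton:
  "band_prod n h c [f] = (if f then mat_adjoint (toeplitz_band n h c) else toeplitz_band n h c)"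
  unfolding band_prod.simps by (rule right_mult_one_mat) (rule band_factor_carrier)

lemma band_prod_replicate:
  "band_prod n h c (replicate k f) = (if f then mat_adjoint (toeplitz_band n h c) else toeplitz_band n h c) ^\<^sub>m k"
proof (induction k)
  case 0
  then show ?case by (cases f) (simp_all add: toeplitz_band_def)
next
  case (Suc k)
  have "band_prod n h c (replicate (Suc k) f) = band_prod n h c (replicate k f @ [f])"
    by (simp only: replicate_append_same replicate_Suc)
  then show ?case unfolding band_prod_append Suc band_prod_singleton by simp
qed

text \<open>The factors of \<open>((T\<^sup>*)\<^sup>s T\<^sup>s)\<^sup>k\<close>, with \<open>True\<close> for an adjoint.\<close>

definition flags :: "nat \<Rightarrow> nat \<Rightarrow> bool list" where
  "flags s k = concat (replicate k (replicate s True @ replicate s False))"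

lemma length_flags [simp]: "length (flags s k) = 2 * s * k"
  by (induction k) (auto simp: flags_def)

lemma band_prod_flags:
  "band_prod n h c (flags s k) = (mat_adjoint (toeplitz_band n h c) ^\<^sub>m s * toeplitz_band n h c ^\<^sub>m s) ^\<^sub>m k"
proof (induction k)
  case 0
  then show ?case by (simp add: flags_def toeplitz_band_def)
next
  case (Suc k)
  have "flags s (Suc k) = flags s k @ replicate s True @ replicate s False"
    unfolding flags_def by (metis concat.simps concat_append append_Nil2 replicate_Suc replicate_append_same)
  then show ?case by (simp add: band_prod_append Suc band_prod_replicate)
qed

lemma pow_smult_mat:
  fixes A :: "complex mat"
  assumes "A \<in> carrier_mat n n"
  shows "(x \<cdot>\<^sub>m A) ^\<^sub>m k = x ^ k \<cdot>\<^sub>m A ^\<^sub>m k"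
proof (induction k)
  case 0
  then show ?case using assms by (intro eq_matI) auto
next
  case (Suc k)
  have "x ^ k \<cdot>\<^sub>m A ^\<^sub>m k * (x \<cdot>\<^sub>m A) = x \<cdot>\<^sub>m (x ^ k \<cdot>\<^sub>m A ^\<^sub>m k * A)"
    using assms by (intro mult_smult_distrib[of _ n n _ n]) auto
  also have "x ^ k \<cdot>\<^sub>m A ^\<^sub>m k * A = x ^ k \<cdot>\<^sub>m (A ^\<^sub>m k * A)"
    using assms by (intro mult_smult_assoc_mat[of _ n n _ n]) auto
  also have "x \<cdot>\<^sub>m (x ^ k \<cdot>\<^sub>m (A ^\<^sub>m k * A)) = x ^ Suc k \<cdot>\<^sub>m (A ^\<^sub>m k * A)"
    by (rule eq_matI) auto
  finally show ?case using Suc by simp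
qed

text \<open>The trace as a sum over closed words: only words with \<open>total u = 0\<close> return to the
row in which they started.\<close>

lemma trace_poly_W:
  "mat_trace (poly_mat Q (W_mat s n h c)) =
    (\<Sum>k\<le>degree Q. of_real (coeff Q k) * (1 / of_nat h ^ s) ^ k *
      (\<Sum>u\<in>{u\<in>words h (flags s k). total u = 0}. of_nat (starts n u) * monom_of c u))"
proof -
  let ?B = "mat_adjoint (toeplitz_band n h c) ^\<^sub>m s * toeplitz_band n h c ^\<^sub>m s"
  have B: "?B \<in> carrier_mat n n" by (intro mult_carrier_mat[of _ n n]) auto
  have dim: "dim_row (W_mat s n h c) = n" using W_mat_carrier by blast
  have pow: "W_mat s n h c ^\<^sub>m k = (1 / of_nat h ^ s) ^ k \<cdot>\<^sub>m band_prod n h c (flags s k)" for k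
    unfolding W_mat_def band_prod_flags by (rule pow_smult_mat[OF B])
  have "mat_trace (poly_mat Q (W_mat s n h c)) =
      (\<Sum>i<n. \<Sum>k\<le>degree Q. of_real (coeff Q k) * (W_mat s n h c ^\<^sub>m k) $$ (i, i))"
    by (simp add: mat_trace_def poly_mat_def dim)
  also have "\<dots> = (\<Sum>i<n. \<Sum>k\<le>degree Q. of_real (coeff Q k) * (1 / of_nat h ^ s) ^ k * band_prod n h c (flags s k) $$ (i, i))"
  proof (intro sum.cong refl)
    fix i k assume "i \<in> {..<n}"
    then have "i < dim_row (band_prod n h c (flags s k))" "i < dim_col (band_prod n h c (flags s k))"
      unfolding carrier_matD[OF band_prod_carrier] by auto
    then show "of_real (coeff Q k) * (W_mat s n h c ^\<^sub>m k) $$ (i, i) =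
        of_real (coeff Q k) * (1 / of_nat h ^ s) ^ k * band_prod n h c (flags s k) $$ (i, i)"
      unfolding pow by simp
  qed
  also have "\<dots> = (\<Sum>k\<le>degree Q. of_real (coeff Q k) * (1 / of_nat h ^ s) ^ k * (\<Sum>i<n. band_prod n h c (flags s k) $$ (i, i)))"
    unfolding sum_distrib_left by (rule sum.swap)
  finally show ?thesis unfolding trace_band_prod .
qed

text \<open>The largest and the smallest partial sum of the steps, including the empty one. They determine
\<open>starts\<close>, by \<open>starts_eq\<close>, and are continuous functions of the steps, which makes the limit of
the rescaled number of starting rows explicit.\<close>

fun highest :: "int list \<Rightarrow> int" where
  "highest [] = 0" | "highest (x # xs) = max 0 (x + highest xs)"

fun lowest :: "int list \<Rightarrow> int" where
  "lowest [] = 0" | "lowest (x # xs) = min 0 (x + lowest xs)"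

lemma highest_nonneg: "highest xs \<ge> 0" by (cases xs) auto
lemma lowest_nonpos: "lowest xs \<le> 0" by (cases xs) auto

lemma stays_iff: "stays n i u \<longleftrightarrow> 0 \<le> i + lowest (map step u) \<and> i + highest (map step u) < int n"
proof (induction u arbitrary: i)
  case (Cons x u)
  show ?case unfolding stays.simps Cons.IH
    using highest_nonneg[of "map step u"] lowest_nonpos[of "map step u"] by (auto simp: max_def min_def)
qed simp

lemma starts_eq: "real (starts n u) = max 0 (real n - of_int (highest (map step u)) + of_int (lowest (map step u)))"
proof -
  have "{i. stays n i u} = {- lowest (map step u)..<int n - highest (map step u)}"
    unfolding stays_iff by auto
  then have "starts n u = nat (int n - highest (map step u) + lowest (map step u))"
    by (simp add: starts_def)
  then show ?thesis by (simp add: max_def)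
qed

lemma starts_le: "starts n u \<le> n"
proof -
  have "real (starts n u) \<le> real n"
    unfolding starts_eq using highest_nonneg[of "map step u"] lowest_nonpos[of "map step u"] by simp
  then show ?thesis by simp
qed

lemma extremes_tendsto:
  assumes "\<And>p. p \<in> set ps \<Longrightarrow> (\<lambda>n. of_int (g n p) / real n) \<longlonglongrightarrow> G p"
  shows "(\<lambda>n. of_int (highest (map (g n) ps)) / real n) \<longlonglongrightarrow> foldr (\<lambda>p z. max 0 (G p + z)) ps 0"
    and "(\<lambda>n. of_int (lowest (map (g n) ps)) / real n) \<longlonglongrightarrow> foldr (\<lambda>p z. min 0 (G p + z)) ps 0"
proof -
  have "(\<lambda>n. of_int (highest (map (g n) ps)) / real n) \<longlonglongrightarrow> foldr (\<lambda>p z. max 0 (G p + z)) ps 0 \<and>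
    (\<lambda>n. of_int (lowest (map (g n) ps)) / real n) \<longlonglongrightarrow> foldr (\<lambda>p z. min 0 (G p + z)) ps 0"
    using assms
proof (induction ps)
  case (Cons p ps)
  have IH: "(\<lambda>n. of_int (highest (map (g n) ps)) / real n) \<longlonglongrightarrow> foldr (\<lambda>p z. max 0 (G p + z)) ps 0"
    "(\<lambda>n. of_int (lowest (map (g n) ps)) / real n) \<longlonglongrightarrow> foldr (\<lambda>p z. min 0 (G p + z)) ps 0"
    using Cons by auto
  have h: "of_int (highest (map (g n) (p # ps))) / real n =
      max 0 (of_int (g n p) / real n + of_int (highest (map (g n) ps)) / real n)" for n
    by (auto simp: max_def add_divide_distrib[symmetric] divide_le_0_iff zero_le_divide_iff)
  have l: "of_int (lowest (map (g n) (p # ps))) / real n =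
      min 0 (of_int (g n p) / real n + of_int (lowest (map (g n) ps)) / real n)" for n
    by (auto simp: min_def add_divide_distrib[symmetric] divide_le_0_iff zero_le_divide_iff)
  have p: "(\<lambda>n. of_int (g n p) / real n) \<longlonglongrightarrow> G p" using Cons.prems by simp
  show ?case unfolding h l foldr.simps o_def using IH p by (intro conjI tendsto_intros)
qed simp
  then show "(\<lambda>n. of_int (highest (map (g n) ps)) / real n) \<longlonglongrightarrow> foldr (\<lambda>p z. max 0 (G p + z)) ps 0"
    "(\<lambda>n. of_int (lowest (map (g n) ps)) / real n) \<longlonglongrightarrow> foldr (\<lambda>p z. min 0 (G p + z)) ps 0" by auto
qed

section \<open>Connected quadruples of closed words\<close>

lemma sum_segment:
  fixes F :: "'b \<Rightarrow> int"
  assumes "U = xs @ ys @ zs" "m = length xs" "m' = length xs + length ys"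
  shows "(\<Sum>p\<in>{m..<m'}. F (U ! p)) = (\<Sum>y\<leftarrow>ys. F y)"
proof -
  have "(\<Sum>p\<in>{m..<m'}. F (U ! p)) = (\<Sum>p\<in>{0..<length ys}. F (U ! (p + m)))"
    using sum.shift_bounds_nat_ivl[of "\<lambda>p. F (U ! p)" 0 m "length ys"] assms by (simp add: add.commute)
  also have "\<dots> = (\<Sum>p\<in>{0..<length ys}. F (ys ! p))"
    using assms by (intro sum.cong) (auto simp: nth_append)
  also have "\<dots> = (\<Sum>y\<leftarrow>ys. F y)" by (simp add: sum_list_sum_nth)
  finally show ?thesis .
qed

lemma nth_segment:
  assumes "U = xs @ ys @ zs" "m = length xs" "m' = length xs + length ys" "y \<in> set ys"
  shows "\<exists>p\<in>{m..<m'}. U ! p = y"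
proof -
  obtain i where "i < length ys" "ys ! i = y" using assms(4) by (auto simp: in_set_conv_nth)
  then show ?thesis using assms by (intro bexI[of _ "i + length xs"]) (auto simp: nth_append)
qed

text \<open>The letters of the four words become the positions of a system of four circuits: the flags give the
signs, closedness of a word is the constraint of its circuit, and \<open>good\<close> says that every
index is paired and that the circuits are connected. The counting bound then saves three
parameters.\<close>

lemma card_good_le:
  fixes h :: nat and f1 f2 f3 f4 :: "bool list"
  assumes ev: "even (length f1)" "even (length f2)" "even (length f3)" "even (length f4)"
  defines "L \<equiv> length f1 + length f2 + length f3 + length f4"
  shows "card {(u1,u2,u3,u4). u1 \<in> words h f1 \<and> u2 \<in> words h f2 \<and> u3 \<in> words h f3 \<and> u4 \<in> words h f4 \<and>
      total u1 = 0 \<and> total u2 = 0 \<and> total u3 = 0 \<and> total u4 = 0 \<and> good u1 u2 u3 u4} * (2 * h + 1) ^ 3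
    \<le> 2 ^ (L * L) * (2 * h + 1) ^ (L div 2)"
    (is "card ?Q * _ \<le> _")
proof (cases "?Q = {}")
  case True
  then show ?thesis by (simp only: card.empty)
next
  case False
  define N1 where "N1 = length f1"
  define N2 where "N2 = N1 + length f2"
  define N3 where "N3 = N2 + length f3"
  have L: "L = N3 + length f4" by (simp add: L_def N1_def N2_def N3_def)
  have ne: "f1 \<noteq> []" "f2 \<noteq> []" "f3 \<noteq> []" "f4 \<noteq> []"
  proof -
    obtain u1 u2 u3 u4 where u: "u1 \<in> words h f1" "u2 \<in> words h f2" "u3 \<in> words h f3" "u4 \<in> words h f4"
      and g: "good u1 u2 u3 u4" using False by blast
    from g have "u1 \<noteq> []" "u2 \<noteq> []" "u3 \<noteq> []" "u4 \<noteq> []" unfolding good_def by auto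
    then show "f1 \<noteq> []" "f2 \<noteq> []" "f3 \<noteq> []" "f4 \<noteq> []" using u by (auto simp: words_def)
  qed
  have lt: "0 < N1" "N1 < N2" "N2 < N3" "N3 < L"
    using ne by (simp_all add: N1_def N2_def N3_def L)
  define fl where "fl = f1 @ f2 @ f3 @ f4"
  define circ where "circ p = (if p < N1 then 0 else if p < N2 then 1 else if p < N3 then 2 else 3 :: nat)" for p
  define sg where "sg p = (if fl ! p then 1 else - 1 :: int)" for p
  have seg: "{p \<in> {..<L}. circ p = 0} = {0..<N1}" "{p \<in> {..<L}. circ p = 1} = {N1..<N2}"
    "{p \<in> {..<L}. circ p = 2} = {N2..<N3}" "{p \<in> {..<L}. circ p = 3} = {N3..<L}"
    "i > 3 \<Longrightarrow> {p \<in> {..<L}. circ p = i} = {}" for i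
    using lt by (auto simp: circ_def split: if_splits)
  have circ_cases: "i = 0 \<or> i = 1 \<or> i = 2 \<or> i = 3 \<or> i > 3" for i :: nat by linarith
  have evc: "even (card {p \<in> {..<L}. circ p = i})" for i
    using circ_cases[of i] ev by (elim disjE) (simp_all only: seg card.empty card_atLeastLessThan, auto simp: N1_def N2_def N3_def L)
  have "circ ` {..<L} = {0,1,2,3}"
  proof
    show "circ ` {..<L} \<subseteq> {0,1,2,3}" by (auto simp: circ_def)
    have "circ 0 = 0" "circ N1 = 1" "circ N2 = 2" "circ N3 = 3" using lt by (auto simp: circ_def)
    moreover have "0 < L" "N1 < L" "N2 < L" "N3 < L" using lt by auto
    ultimately show "{0,1,2,3} \<subseteq> circ ` {..<L}" by (metis empty_subsetI imageI insert_subset lessThan_iff)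
  qed
  then have card4: "card (circ ` {..<L}) = Suc 3" by simp
  let ?I = "{- int h..int h}"
  let ?G = "{u \<in> {..<L} \<rightarrow>\<^sub>E ?I. (\<forall>i. (\<Sum>p | p \<in> {..<L} \<and> circ p = i. sg p * u p) = 0) \<and>
            (\<forall>p\<in>{..<L}. \<exists>q\<in>{..<L}. q \<noteq> p \<and> u q = u p) \<and>
            (\<forall>S. (\<exists>p\<in>{..<L}. circ p \<in> S) \<longrightarrow> (\<exists>p\<in>{..<L}. circ p \<notin> S) \<longrightarrow>
               (\<exists>p\<in>{..<L}. \<exists>q\<in>{..<L}. u p = u q \<and> circ p \<in> S \<and> circ q \<notin> S))}"
  define enc where "enc q = (case q of (u1,u2,u3,u4) \<Rightarrow> \<lambda>p\<in>{..<L}. fst ((u1 @ u2 @ u3 @ u4) ! p))" for q :: "word \<times> word \<times> word \<times> word"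
  have inj: "inj_on enc ?Q"
  proof (rule inj_onI)
    fix q q' assume q: "q \<in> ?Q" "q' \<in> ?Q" and eq: "enc q = enc q'"
    obtain u1 u2 u3 u4 where u: "q = (u1,u2,u3,u4)" "map snd u1 = f1" "map snd u2 = f2" "map snd u3 = f3" "map snd u4 = f4"
      using q(1) by (auto simp: words_def)
    obtain v1 v2 v3 v4 where v: "q' = (v1,v2,v3,v4)" "map snd v1 = f1" "map snd v2 = f2" "map snd v3 = f3" "map snd v4 = f4"
      using q(2) by (auto simp: words_def)
    let ?U = "u1 @ u2 @ u3 @ u4" and ?V = "v1 @ v2 @ v3 @ v4"
    have len: "length u1 = length f1" "length u2 = length f2" "length u3 = length f3" "length u4 = length f4"
      "length v1 = length f1" "length v2 = length f2" "length v3 = length f3" "length v4 = length f4"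
      using u(2-5) v(2-5) by (metis length_map)+
    have "map snd ?U = map snd ?V" using u v by simp
    moreover have "map fst ?U = map fst ?V"
    proof (rule nth_equalityI)
      fix p assume p: "p < length (map fst ?U)"
      then have "p < L" using len by (simp add: L_def)
      then show "map fst ?U ! p = map fst ?V ! p"
        using fun_cong[OF eq, of p] p len by (simp add: enc_def u(1) v(1) del: map_append)
    qed (use len in simp)
    ultimately have "?U = ?V" by (metis zip_map_fst_snd)
    then show "q = q'" using len u(1) v(1) by simp
  qed
  have img: "enc ` ?Q \<subseteq> ?G"
  proof (rule image_subsetI)
    fix q assume "q \<in> ?Q"
    then obtain u1 u2 u3 u4 where q: "q = (u1,u2,u3,u4)" and w: "u1 \<in> words h f1" "u2 \<in> words h f2" "u3 \<in> words h f3" "u4 \<in> words h f4"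
      and t: "total u1 = 0" "total u2 = 0" "total u3 = 0" "total u4 = 0" and g: "good u1 u2 u3 u4" by blast
    define U where "U = u1 @ u2 @ u3 @ u4"
    have len: "length u1 = N1" "N2 = N1 + length u2" "N3 = N2 + length u3" "L = N3 + length u4" "length U = L"
      using w length_words by (auto simp: N1_def N2_def N3_def L U_def)
    have sU: "map snd U = fl" using w by (simp add: U_def fl_def words_def)
    let ?u = "enc q"
    have u: "?u p = fst (U ! p)" if "p < L" for p using that by (simp add: enc_def q U_def)
    have sgu: "sg p * ?u p = step (U ! p)" if "p < L" for p
    proof -
      have "snd (U ! p) = fl ! p" using sU len that by (metis nth_map)
      then show ?thesis using u[OF that] by (simp add: sg_def step_def)
    qed
    have segU: "U = [] @ u1 @ (u2 @ u3 @ u4)" "U = u1 @ u2 @ (u3 @ u4)" "U = (u1 @ u2) @ u3 @ u4" "U = (u1 @ u2 @ u3) @ u4 @ []"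
      by (simp_all add: U_def)
    have box: "?u \<in> {..<L} \<rightarrow>\<^sub>E ?I"
    proof -
      have "idx u1 \<subseteq> ?I" "idx u2 \<subseteq> ?I" "idx u3 \<subseteq> ?I" "idx u4 \<subseteq> ?I" using w by (simp_all add: words_def)
      then have "idx U \<subseteq> ?I" unfolding U_def set_append image_Un by (intro Un_least)
      then have "fst (U ! p) \<in> ?I" if "p < L" for p using that len by (intro subsetD[OF \<open>idx U \<subseteq> ?I\<close> imageI[OF nth_mem]]) simp
      then have "?u p \<in> ?I" if "p < L" for p using that unfolding u[OF that] .
      moreover have "?u \<in> extensional {..<L}" unfolding enc_def q by (simp add: extensional_def)
      ultimately show ?thesis unfolding PiE_iff by blast
    qed
    have zero: "(\<Sum>p | p \<in> {..<L} \<and> circ p = i. sg p * ?u p) = 0" for i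
    proof -
      have "(\<Sum>p | p \<in> {..<L} \<and> circ p = i. sg p * ?u p) = (\<Sum>p | p \<in> {..<L} \<and> circ p = i. step (U ! p))"
        by (intro sum.cong refl sgu) auto
      moreover have "(\<Sum>p\<in>{0..<N1}. step (U ! p)) = 0"
        using sum_segment[OF segU(1), of 0 N1 step] t len by (simp add: total_def)
      moreover have "(\<Sum>p\<in>{N1..<N2}. step (U ! p)) = 0"
        using sum_segment[OF segU(2), of N1 N2 step] t len by (simp add: total_def)
      moreover have "(\<Sum>p\<in>{N2..<N3}. step (U ! p)) = 0"
        using sum_segment[OF segU(3), of N2 N3 step] t len by (simp add: total_def)
      moreover have "(\<Sum>p\<in>{N3..<L}. step (U ! p)) = 0"
        using sum_segment[OF segU(4), of N3 L step] t len by (simp add: total_def)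
      ultimately show ?thesis using circ_cases[of i] by (elim disjE) (simp_all only: seg sum.empty)
    qed
    have paired: "\<exists>q\<in>{..<L}. q \<noteq> p \<and> ?u q = ?u p" if p: "p \<in> {..<L}" for p
    proof -
      let ?P = "{i. i < L \<and> fst (U ! i) = fst (U ! p)}"
      have "length (filter (\<lambda>x. fst x = fst (U ! p)) U) \<noteq> 1" using g unfolding good_def U_def by blast
      then have "card ?P \<noteq> 1" using len by (simp add: length_filter_conv_card)
      have "p \<in> ?P" using p by simp
      have "\<exists>q\<in>?P. q \<noteq> p"
      proof (rule ccontr)
        assume "\<not> ?thesis"
        then have "?P = {p}" using \<open>p \<in> ?P\<close> by blast
        then show False using \<open>card ?P \<noteq> 1\<close> by (simp only: card.insert finite.emptyI) simp
      qed
      then obtain q where "q \<in> ?P" "q \<noteq> p" by blast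
      then show ?thesis using p u by (intro bexI[of _ q]) auto
    qed
    have posI: "\<exists>p<L. circ p = k \<and> ?u p = j"
      if s: "U = xs @ ys @ zs" "m = length xs" "m' = length xs + length ys" and j: "j \<in> idx ys"
        and c: "\<And>p. p \<in> {m..<m'} \<Longrightarrow> p < L \<and> circ p = k" for xs ys zs m m' k j
    proof -
      obtain y where "y \<in> set ys" "fst y = j" using j by blast
      moreover obtain p where "p \<in> {m..<m'}" "U ! p = y" using nth_segment[OF s \<open>y \<in> set ys\<close>] by blast
      ultimately show ?thesis using c[of p] u[of p] by blast
    qed
    have pos: "\<exists>p<L. circ p = 0 \<and> ?u p = j" if "j \<in> idx u1" for j
      by (rule posI[OF segU(1) _ _ that, of 0 N1]) (use len lt in \<open>auto simp: circ_def\<close>)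
    have pos1: "\<exists>p<L. circ p = 1 \<and> ?u p = j" if "j \<in> idx u2" for j
      by (rule posI[OF segU(2) _ _ that, of N1 N2]) (use len lt in \<open>auto simp: circ_def\<close>)
    have pos2: "\<exists>p<L. circ p = 2 \<and> ?u p = j" if "j \<in> idx u3" for j
      by (rule posI[OF segU(3) _ _ that, of N2 N3]) (use len lt in \<open>auto simp: circ_def\<close>)
    have pos3: "\<exists>p<L. circ p = 3 \<and> ?u p = j" if "j \<in> idx u4" for j
      by (rule posI[OF segU(4) _ _ that, of N3 L]) (use len lt in \<open>auto simp: circ_def\<close>)
    \<comment> \<open>\<open>lk i k\<close> means that the circuits \<open>i\<close> and \<open>k\<close> have a common index. The links in a good quadruple
      form a connected graph on the four circuits.\<close>
    define lk where "lk i k \<longleftrightarrow> (\<exists>p<L. \<exists>q<L. ?u p = ?u q \<and> circ p = i \<and> circ q = k)" for i k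
    have lk: "lk 0 1" "lk 2 3" "lk 0 2 \<or> lk 0 3 \<or> lk 1 2 \<or> lk 1 3"
    proof -
      have lkI: "lk i k" if "\<exists>p<L. circ p = i \<and> ?u p = j" "\<exists>p<L. circ p = k \<and> ?u p = j" for i k j
      proof -
        from that(1) obtain p where p: "p < L" "circ p = i" "?u p = j" by blast
        from that(2) obtain r where r: "r < L" "circ r = k" "?u r = j" by blast
        have "?u p = ?u r" using p r by (simp only:)
        then show ?thesis unfolding lk_def using p r by blast
      qed
      obtain j where "j \<in> idx u1" "j \<in> idx u2" using g unfolding good_def by blast
      then show "lk 0 1" by (intro lkI[of 0 j 1] pos pos1)
      obtain j where "j \<in> idx u3" "j \<in> idx u4" using g unfolding good_def by blast
      then show "lk 2 3" by (intro lkI[of 2 j 3] pos2 pos3)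
      obtain j where "j \<in> idx u1 \<or> j \<in> idx u2" "j \<in> idx u3 \<or> j \<in> idx u4" using g unfolding good_def by blast
      then show "lk 0 2 \<or> lk 0 3 \<or> lk 1 2 \<or> lk 1 3"
        using lkI[of 0 j 2, OF pos pos2] lkI[of 0 j 3, OF pos pos3] lkI[of 1 j 2, OF pos1 pos2] lkI[of 1 j 3, OF pos1 pos3]
        by blast
    qed
    have conn: "\<exists>p\<in>{..<L}. \<exists>q\<in>{..<L}. ?u p = ?u q \<and> circ p \<in> S \<and> circ q \<notin> S"
      if "\<exists>p\<in>{..<L}. circ p \<in> S" "\<exists>p\<in>{..<L}. circ p \<notin> S" for S
    proof (rule ccontr)
      assume "\<not> ?thesis"
      then have no: "i \<in> S \<longleftrightarrow> k \<in> S" if "lk i k" for i k using that unfolding lk_def by (metis lessThan_iff)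
      have "0 \<in> S \<longleftrightarrow> 1 \<in> S" "2 \<in> S \<longleftrightarrow> 3 \<in> S" "0 \<in> S \<longleftrightarrow> 2 \<in> S"
        using no[OF lk(1)] no[OF lk(2)] lk(3) no by metis+
      moreover have "circ p \<in> {0,1,2,3}" for p by (simp add: circ_def)
      ultimately have "circ p \<in> S \<longleftrightarrow> 0 \<in> S" for p by (metis insertE singletonD)
      then show False using that by blast
    qed
    show "enc q \<in> ?G" using box zero paired conn by blast
  qed
  have finG: "finite ?G"
    by (rule finite_subset[of _ "{..<L} \<rightarrow>\<^sub>E ?I"]) (auto intro: finite_PiE)
  have "card ?Q \<le> card ?G" by (rule card_inj_on_le[OF inj img finG])
  moreover have "card ?G * card ?I ^ 3 \<le> 2 ^ (card {..<L} * card {..<L}) * card ?I ^ (card {..<L} div 2)"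
    by (rule card_connected_solutions_le) (use card4 evc in \<open>auto simp: sg_def\<close>)
  moreover have "card ?I = 2 * h + 1" by simp
  ultimately show ?thesis by (simp only: card_lessThan) (meson le_trans mult_le_mono1)
qed

section \<open>The normalised trace as a polynomial statistic\<close>

definition closed_words :: "nat \<Rightarrow> nat \<Rightarrow> nat \<Rightarrow> word set" where
  "closed_words s h k = {u \<in> words h (flags s k). total u = 0}"

definition all_words :: "nat \<Rightarrow> nat \<Rightarrow> nat \<Rightarrow> word set" where
  "all_words s h p = (\<Union>k\<le>p. closed_words s h k)"

text \<open>A word in the \<open>k\<close>-th power of the matrix has length \<open>2 * s * k\<close>, so the degree \<open>k\<close> can be recovered from the
length. Division by \<open>n\<close> is compensated by \<open>starts\<close>, which is at most \<open>n\<close>.\<close>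

definition word_coeff :: "real poly \<Rightarrow> nat \<Rightarrow> nat \<Rightarrow> nat \<Rightarrow> word \<Rightarrow> real" where
  "word_coeff Q s n h u = sqrt (real h) / real n * coeff Q (length u div (2 * s)) *
     (1 / real h ^ s) ^ (length u div (2 * s)) * real (starts n u)"

lemma finite_closed_words: "finite (closed_words s h k)"
  by (simp add: closed_words_def finite_words)

lemma length_closed_words: "u \<in> closed_words s h k \<Longrightarrow> length u = 2 * s * k"
  using length_words[of u h "flags s k"] by (simp add: closed_words_def)

lemma sum_all_words:
  assumes "s \<ge> 1"
  shows "(\<Sum>u\<in>all_words s h p. g u) = (\<Sum>k\<le>p. \<Sum>u\<in>closed_words s h k. g u)"
  unfolding all_words_def
proof (rule sum.UNION_disjoint)
  show "\<forall>i\<in>{..p}. \<forall>j\<in>{..p}. i \<noteq> j \<longrightarrow> closed_words s h i \<inter> closed_words s h j = {}"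
  proof (intro ballI impI)
    fix i j :: nat assume "i \<noteq> j"
    show "closed_words s h i \<inter> closed_words s h j = {}"
    proof (rule equals0I)
      fix u assume "u \<in> closed_words s h i \<inter> closed_words s h j"
      then have "2 * s * i = 2 * s * j" using length_closed_words by (metis IntD1 IntD2)
      then show False using assms \<open>i \<noteq> j\<close> by simp
    qed
  qed
qed (auto simp: finite_closed_words)

lemma word_coeff_closed:
  assumes "s \<ge> 1" "u \<in> closed_words s h k"
  shows "word_coeff Q s n h u = sqrt (real h) / real n * coeff Q k * (1 / real h ^ s) ^ k * real (starts n u)"
  using length_closed_words[OF assms(2)] assms(1) by (simp add: word_coeff_def)

lemma sum_word_coeff:
  assumes "s \<ge> 1"
  shows "(\<Sum>u\<in>all_words s h (degree Q). of_real (word_coeff Q s n h u) * monom_of c u) =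
    of_real (sqrt (real h) / real n) * mat_trace (poly_mat Q (W_mat s n h c))"
proof -
  have "(\<Sum>u\<in>all_words s h (degree Q). of_real (word_coeff Q s n h u) * monom_of c u) =
      (\<Sum>k\<le>degree Q. \<Sum>u\<in>closed_words s h k. of_real (sqrt (real h) / real n) *
        (of_real (coeff Q k) * (1 / of_nat h ^ s) ^ k * (of_nat (starts n u) * monom_of c u)))"
    unfolding sum_all_words[OF assms] by (intro sum.cong refl) (simp add: word_coeff_closed[OF assms])
  then show ?thesis
    unfolding trace_poly_W closed_words_def[symmetric] sum_distrib_left .
qed

lemma labelled_recover:
  assumes "length U = L" "\<And>p. p < L \<Longrightarrow> w p = fst (U ! p)" "map snd U = fs"
  shows "labelled (\<lambda>p. fs ! p) w [0..<L] = U"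
proof -
  have "(w p, fs ! p) = U ! p" if "p < L" for p
    using assms that by (auto simp: prod_eq_iff)
  then show ?thesis unfolding labelled_def using assms(1) by (intro nth_equalityI) auto
qed

lemma total_labelled:
  "total (labelled fl w [c..<d]) = (\<Sum>p\<in>{c..<d}. (if fl p then 1 else - 1) * w p)"
proof -
  have "total (labelled fl w [c..<d]) = sum_list (map (\<lambda>p. (if fl p then 1 else - 1) * w p) [c..<d])"
    unfolding total_def labelled_def by (auto simp: step_def o_def intro!: arg_cong[of _ _ sum_list])
  then show ?thesis by (simp add: interv_sum_list_conv_sum_set_nat)
qed

locale toeplitz_clt = toeplitz_input +
  fixes s :: nat and Q :: "real poly" and bw :: "nat \<Rightarrow> nat" and \<beta> :: real
  assumes s1: "s \<ge> 1" and bw: "\<And>n. n \<ge> 2 \<Longrightarrow> 0 < bw n \<and> bw n < n"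
    and bw_lim: "filterlim bw at_top sequentially" and \<beta>: "(\<lambda>n. real (bw n) / real n) \<longlonglongrightarrow> \<beta>"
begin

abbreviation Wn where "Wn n \<equiv> all_words s (bw n) (degree Q)"
abbreviation Cn where "Cn n \<equiv> word_coeff Q s n (bw n)"

definition Ln :: nat where "Ln = 2 * s * degree Q"

lemma statistic: "toeplitz_statistic M a \<kappa> \<tau> CM (Wn n) (Cn n) (- int (bw n)) (int (bw n)) Ln"
proof
  show "finite (Wn n)" by (simp add: all_words_def finite_closed_words)
  show "idx u \<subseteq> {- int (bw n)..int (bw n)}" if "u \<in> Wn n" for u
    using that by (auto simp: all_words_def closed_words_def words_def)
  show "length u \<le> Ln" if "u \<in> Wn n" for u
    using that length_closed_words by (fastforce simp: all_words_def Ln_def)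
  show "(\<Sum>u\<in>Wn n. of_real (Cn n u) * monom_of c u) \<in> \<real>" for c
    unfolding sum_word_coeff[OF s1] by (intro Reals_mult Reals_of_real trace_poly_W_real)
qed simp

abbreviation fn where "fn n \<equiv> toeplitz_statistic.f a (Wn n) (Cn n)"
abbreviation var_fn where "var_fn n \<equiv> toeplitz_statistic.var_f M a (Wn n) (Cn n)"
abbreviation mean_fn where "mean_fn n \<equiv> toeplitz_statistic.mean_f M a (Wn n) (Cn n)"
abbreviation Gn where "Gn n \<equiv> toeplitz_statistic.Gsum (Wn n) (Cn n)"

lemma fn_eq: "fn n \<omega> = sqrt (real (bw n)) / real n * Re (mat_trace (poly_mat Q (W_mat s n (bw n) (\<lambda>j. a j \<omega>))))"
  unfolding toeplitz_statistic.f_def[OF statistic] toeplitz_statistic.F_def[OF statistic] sum_word_coeff[OF s1]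
  by (simp only: Re_complex_of_real Im_complex_of_real times_complex.simps mult_zero_left diff_zero)

definition qmax :: real where "qmax = (\<Sum>k\<le>degree Q. \<bar>coeff Q k\<bar>)"

lemma abs_Cn_le:
  assumes "n \<ge> 2" "u \<in> closed_words s (bw n) k" "k \<le> degree Q"
  shows "\<bar>Cn n u\<bar> \<le> qmax * (sqrt (real (bw n)) / real (bw n) ^ (s * k))"
proof -
  have q: "\<bar>coeff Q k\<bar> \<le> qmax" unfolding qmax_def using assms(3) by (intro member_le_sum) auto
  have st: "real (starts n u) / real n \<le> 1" using starts_le[of n u] assms(1) by simp
  have "\<bar>Cn n u\<bar> = \<bar>coeff Q k\<bar> * (sqrt (real (bw n)) / real (bw n) ^ (s * k)) * (real (starts n u) / real n)"
  proof -
    have e: "(1 / real (bw n) ^ s) ^ k = 1 / real (bw n) ^ (s * k)" by (simp add: power_divide power_mult)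
    show ?thesis unfolding word_coeff_closed[OF s1 assms(2)] e by (simp add: abs_mult mult_ac)
  qed
  also have "\<dots> \<le> qmax * (sqrt (real (bw n)) / real (bw n) ^ (s * k)) * 1"
    using q st by (intro mult_mono) auto
  finally show ?thesis by simp
qed

text \<open>For words of degrees adding up to \<open>t\<close> the product of the four coefficients is \<open>O(b\<^sup>2\<^sup>-\<^sup>s\<^sup>t)\<close>, by
\<open>abs_Cn_le\<close>, and the number of good quadruples is \<open>O(b\<^sup>s\<^sup>t\<^sup>-\<^sup>3)\<close>, by \<open>card_good_le\<close>, where \<open>b\<close> is the bandwidth.\<close>

lemma Gn_le: "\<exists>K\<ge>0. \<forall>n\<ge>2. Gn n \<le> K / real (bw n)"
proof -
  let ?p = "degree Q"
  let ?Ks = "{..?p} \<times> {..?p} \<times> {..?p} \<times> {..?p}"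
  define K where "K = (\<Sum>(k1,k2,k3,k4)\<in>?Ks. qmax ^ 4 * 2 ^ ((2 * s * (k1 + k2 + k3 + k4)) * (2 * s * (k1 + k2 + k3 + k4))) * 3 ^ (s * (k1 + k2 + k3 + k4)))"
  have qmax0: "qmax \<ge> 0" by (simp add: qmax_def sum_nonneg)
  have K0: "K \<ge> 0" unfolding K_def by (intro sum_nonneg) (auto simp: qmax0)
  have "Gn n \<le> K / real (bw n)" if n: "n \<ge> 2" for n
  proof -
    let ?h = "bw n"
    have h: "?h > 0" using bw[OF n] by simp
    interpret S: toeplitz_statistic M a \<kappa> \<tau> CM "Wn n" "Cn n" "- int ?h" "int ?h" Ln by (rule statistic)
    define c where "c q = (case q of (u1,u2,u3,u4) \<Rightarrow> if good u1 u2 u3 u4 then \<bar>Cn n u1\<bar> * \<bar>Cn n u2\<bar> * \<bar>Cn n u3\<bar> * \<bar>Cn n u4\<bar> else 0)" for q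
    define key where "key q = (case q of (u1 :: word,u2 :: word,u3 :: word,u4 :: word) \<Rightarrow> (length u1 div (2 * s), length u2 div (2 * s), length u3 div (2 * s), length u4 div (2 * s)))" for q
    have key1: "length u div (2 * s) = k" if "u \<in> closed_words s ?h k" for u k
      using length_closed_words[OF that] s1 by simp
    have inW: "u \<in> closed_words s ?h (length u div (2 * s)) \<and> length u div (2 * s) \<le> ?p" if "u \<in> Wn n" for u
      using that key1 by (auto simp: all_words_def)
    let ?W4 = "Wn n \<times> Wn n \<times> Wn n \<times> Wn n"
    have "Gn n = (\<Sum>q\<in>?W4. c q)" unfolding S.Gsum_def c_def ..
    also have "\<dots> = (\<Sum>k\<in>?Ks. \<Sum>q\<in>{q\<in>?W4. key q = k}. c q)"
      by (rule sum.group[symmetric]) (use S.finite_W inW in \<open>auto simp: key_def\<close>)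
    also have "\<dots> \<le> (\<Sum>(k1,k2,k3,k4)\<in>?Ks. qmax ^ 4 * 2 ^ ((2 * s * (k1 + k2 + k3 + k4)) * (2 * s * (k1 + k2 + k3 + k4))) * 3 ^ (s * (k1 + k2 + k3 + k4)) / real ?h)"
    proof (rule sum_mono)
      fix k assume "k \<in> ?Ks"
      then obtain k1 k2 k3 k4 where k: "k = (k1,k2,k3,k4)" "k1 \<le> ?p" "k2 \<le> ?p" "k3 \<le> ?p" "k4 \<le> ?p" by (cases k) auto
      define t where "t = k1 + k2 + k3 + k4"
      let ?Q = "{(u1,u2,u3,u4). u1 \<in> words ?h (flags s k1) \<and> u2 \<in> words ?h (flags s k2) \<and> u3 \<in> words ?h (flags s k3) \<and> u4 \<in> words ?h (flags s k4) \<and>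
        total u1 = 0 \<and> total u2 = 0 \<and> total u3 = 0 \<and> total u4 = 0 \<and> good u1 u2 u3 u4}"
      have finQ: "finite ?Q"
        by (rule finite_subset[of _ "words ?h (flags s k1) \<times> words ?h (flags s k2) \<times> words ?h (flags s k3) \<times> words ?h (flags s k4)"])
           (auto simp: finite_words)
      define B where "B = qmax ^ 4 * (real ?h ^ 2 / real ?h ^ (s * t))"
      have cB: "c q \<le> B" if q: "q \<in> {q\<in>?W4. key q = k}" "q \<in> ?Q" for q
      proof -
        obtain u1 u2 u3 u4 where u: "q = (u1,u2,u3,u4)" by (cases q)
        have m: "u1 \<in> closed_words s ?h k1" "u2 \<in> closed_words s ?h k2" "u3 \<in> closed_words s ?h k3" "u4 \<in> closed_words s ?h k4"
          using q u by (auto simp: closed_words_def)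
        let ?r = "\<lambda>k. qmax * (sqrt (real ?h) / real ?h ^ (s * k))"
        have "c q = \<bar>Cn n u1\<bar> * \<bar>Cn n u2\<bar> * \<bar>Cn n u3\<bar> * \<bar>Cn n u4\<bar>" using q u by (auto simp: c_def)
        also have "\<dots> \<le> ?r k1 * ?r k2 * ?r k3 * ?r k4"
          using m k qmax0 by (intro mult_mono abs_Cn_le[OF n] mult_nonneg_nonneg) auto
        also have "\<dots> = qmax ^ 4 * ((sqrt (real ?h)) ^ 4 / (real ?h ^ (s * k1) * real ?h ^ (s * k2) * real ?h ^ (s * k3) * real ?h ^ (s * k4)))"
          by (simp add: eval_nat_numeral mult_ac)
        also have "(sqrt (real ?h)) ^ 4 = real ?h ^ 2"
          using power_mult[of "sqrt (real ?h)" 2 2] by simp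
        also have "real ?h ^ (s * k1) * real ?h ^ (s * k2) * real ?h ^ (s * k3) * real ?h ^ (s * k4) = real ?h ^ (s * t)"
          by (simp add: t_def power_add[symmetric] algebra_simps)
        finally show ?thesis by (simp add: B_def)
      qed
      have "(\<Sum>q\<in>{q\<in>?W4. key q = k}. c q) \<le> (\<Sum>q\<in>?Q. B)"
      proof -
        have fin: "finite {q\<in>?W4. key q = k}" using S.finite_W by auto
        have "(\<Sum>q\<in>{q\<in>?W4. key q = k}. c q) = (\<Sum>q\<in>{q\<in>?W4. key q = k} \<inter> ?Q. c q)"
        proof (rule sum.mono_neutral_right[OF fin])
          show "\<forall>q\<in>{q\<in>?W4. key q = k} - {q\<in>?W4. key q = k} \<inter> ?Q. c q = 0"
          proof
            fix q assume q: "q \<in> {q\<in>?W4. key q = k} - {q\<in>?W4. key q = k} \<inter> ?Q"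
            obtain u1 u2 u3 u4 where u: "q = (u1,u2,u3,u4)" by (cases q)
            have "u1 \<in> closed_words s ?h k1" "u2 \<in> closed_words s ?h k2" "u3 \<in> closed_words s ?h k3" "u4 \<in> closed_words s ?h k4"
              using q u inW[of u1] inW[of u2] inW[of u3] inW[of u4] k(1) by (auto simp: key_def)
            then have "\<not> good u1 u2 u3 u4" using q u by (auto simp: closed_words_def)
            then show "c q = 0" by (simp add: c_def u)
          qed
        qed auto
        also have "\<dots> \<le> (\<Sum>q\<in>{q\<in>?W4. key q = k} \<inter> ?Q. B)" using cB by (intro sum_mono) blast
        also have "\<dots> \<le> (\<Sum>q\<in>?Q. B)" using finQ qmax0 by (intro sum_mono2) (auto simp: B_def)
        finally show ?thesis .
      qed
      also have "\<dots> = real (card ?Q) * B" by simp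
      also have "\<dots> \<le> 2 ^ ((2 * s * t) * (2 * s * t)) * (3 * real ?h) ^ (s * t) / real ?h ^ 3 * B"
      proof (rule mult_right_mono)
        have L: "length (flags s k1) + length (flags s k2) + length (flags s k3) + length (flags s k4) = 2 * s * t"
          by (simp add: t_def algebra_simps)
        have "card ?Q * (2 * ?h + 1) ^ 3 \<le> 2 ^ ((2 * s * t) * (2 * s * t)) * (2 * ?h + 1) ^ (2 * s * t div 2)"
          using card_good_le[of "flags s k1" "flags s k2" "flags s k3" "flags s k4" ?h] unfolding L by simp
        moreover have "2 * s * t div 2 = s * t" by simp
        ultimately have "real (card ?Q) * real (2 * ?h + 1) ^ 3 \<le> 2 ^ ((2 * s * t) * (2 * s * t)) * real (2 * ?h + 1) ^ (s * t)"
          unfolding of_nat_le_iff[where ?'a = real, symmetric] by (simp only: of_nat_mult of_nat_numeral of_nat_power)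
        moreover have "real (card ?Q) * real ?h ^ 3 \<le> real (card ?Q) * real (2 * ?h + 1) ^ 3"
          by (intro mult_left_mono power_mono) auto
        moreover have "(2::real) ^ ((2 * s * t) * (2 * s * t)) * real (2 * ?h + 1) ^ (s * t) \<le> 2 ^ ((2 * s * t) * (2 * s * t)) * (3 * real ?h) ^ (s * t)"
          using h by (intro mult_left_mono power_mono) auto
        ultimately have "real (card ?Q) * real ?h ^ 3 \<le> 2 ^ ((2 * s * t) * (2 * s * t)) * (3 * real ?h) ^ (s * t)" by linarith
        then show "real (card ?Q) \<le> 2 ^ ((2 * s * t) * (2 * s * t)) * (3 * real ?h) ^ (s * t) / real ?h ^ 3"
          using h by (simp add: pos_le_divide_eq)
      qed (simp add: B_def qmax0)
      also have "\<dots> = qmax ^ 4 * 2 ^ ((2 * s * t) * (2 * s * t)) * 3 ^ (s * t) / real ?h"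
        using h by (simp add: B_def power_mult_distrib eval_nat_numeral)
      finally show "(\<Sum>q\<in>{q\<in>?W4. key q = k}. c q) \<le> (case k of (k1,k2,k3,k4) \<Rightarrow>
          qmax ^ 4 * 2 ^ ((2 * s * (k1 + k2 + k3 + k4)) * (2 * s * (k1 + k2 + k3 + k4))) * 3 ^ (s * (k1 + k2 + k3 + k4)) / real ?h)"
        by (simp only: k(1) prod.case t_def)
    qed
    also have "\<dots> = K / real ?h" by (simp add: K_def sum_divide_distrib split_beta)
    finally show ?thesis .
  qed
  then show ?thesis using K0 by blast
qed

end

section \<open>Convergence of the variance and of the distribution\<close>

context toeplitz_clt
begin

definition pair_flag :: "nat \<Rightarrow> nat \<Rightarrow> nat \<Rightarrow> bool" where
  "pair_flag k1 k2 p = (flags s k1 @ flags s k2) ! p"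

text \<open>The weight \<open>\<psi>\<close> of two words: the product of the proportions of rows from which their walks
stay inside the matrix. Its limit is \<open>start_limit\<close>, where the extremes of the walk have become
extremes of the rescaled steps times \<open>\<beta>\<close>, the limit of the bandwidth over the size.\<close>

definition start_fraction :: "nat \<Rightarrow> nat \<Rightarrow> nat \<Rightarrow> (nat \<Rightarrow> int) \<Rightarrow> real" where
  "start_fraction k1 k2 n w =
     (real (starts n (labelled (pair_flag k1 k2) w [0..<2 * s * k1])) / real n) *
     (real (starts n (labelled (pair_flag k1 k2) w [2 * s * k1..<2 * (s * (k1 + k2))])) / real n)"

definition start_limit :: "(nat \<Rightarrow> bool) \<Rightarrow> (nat \<Rightarrow> real) \<Rightarrow> nat list \<Rightarrow> real" where
  "start_limit fl Y ps = max 0 (1 - foldr (\<lambda>p z. max 0 ((if fl p then 1 else -1) * Y p * \<beta> + z)) ps 0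
     + foldr (\<lambda>p z. min 0 ((if fl p then 1 else -1) * Y p * \<beta> + z)) ps 0)"

lemma start_fraction_tendsto:
  assumes "\<And>p. p \<in> set ps \<Longrightarrow> (\<lambda>n. of_int (X n p) / real (bw n)) \<longlonglongrightarrow> Y p"
  shows "(\<lambda>n. real (starts n (labelled fl (X n) ps)) / real n) \<longlonglongrightarrow> start_limit fl Y ps"
proof -
  let ?g = "\<lambda>n p. step (X n p, fl p)"
  let ?G = "\<lambda>p. (if fl p then 1 else -1) * Y p * \<beta>"
  have g: "(\<lambda>n. of_int (?g n p) / real n) \<longlonglongrightarrow> ?G p" if p: "p \<in> set ps" for p
  proof -
    have "(\<lambda>n. (if fl p then 1 else -1) * (of_int (X n p) / real (bw n)) * (real (bw n) / real n)) \<longlonglongrightarrow> ?G p"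
      by (intro tendsto_mult tendsto_const assms[OF p] \<beta>)
    moreover have "eventually (\<lambda>n. (if fl p then 1 else -1) * (of_int (X n p) / real (bw n)) * (real (bw n) / real n) =
        of_int (?g n p) / real n) sequentially"
      using filterlim_nat_pos[OF bw_lim] by eventually_elim (simp add: step_def)
    ultimately show ?thesis by (rule Lim_transform_eventually)
  qed
  have m: "map step (labelled fl (X n) ps) = map (?g n) ps" for n by (simp add: labelled_def)
  have "(\<lambda>n. max 0 (1 - of_int (highest (map (?g n) ps)) / real n + of_int (lowest (map (?g n) ps)) / real n)) \<longlonglongrightarrow> start_limit fl Y ps"
    unfolding start_limit_def by (intro tendsto_intros extremes_tendsto g)
  moreover have "eventually (\<lambda>n. max 0 (1 - of_int (highest (map (?g n) ps)) / real n + of_int (lowest (map (?g n) ps)) / real n) =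
      real (starts n (labelled fl (X n) ps)) / real n) sequentially"
    using eventually_gt_at_top[of 0]
  proof eventually_elim
    case (elim n)
    have "max 0 (real n - of_int (highest (map (?g n) ps)) + of_int (lowest (map (?g n) ps))) / real n =
        max 0 ((real n - of_int (highest (map (?g n) ps)) + of_int (lowest (map (?g n) ps))) / real n)"
      by (auto simp: max_def divide_le_0_iff zero_le_divide_iff)
    also have "(real n - of_int (highest (map (?g n) ps)) + of_int (lowest (map (?g n) ps))) / real n =
        1 - of_int (highest (map (?g n) ps)) / real n + of_int (lowest (map (?g n) ps)) / real n"
      using elim by (simp add: field_simps)
    finally show ?case unfolding starts_eq m by simp
  qed
  ultimately show ?thesis by (simp add: tendsto_cong)
qed

lemma start_fraction_bounds: "0 \<le> start_fraction k1 k2 n w" "start_fraction k1 k2 n w \<le> 1"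
proof -
  have 1: "real (starts n u) / real n \<le> 1" for u
    using starts_le[of n u] by (cases "n = 0") auto
  show "0 \<le> start_fraction k1 k2 n w" by (simp add: start_fraction_def)
  show "start_fraction k1 k2 n w \<le> 1"
    unfolding start_fraction_def by (rule mult_le_one) (auto intro: 1)
qed

lemma pair_sum_flags:
  "pair_sum M a \<kappa> \<tau> CM (2 * s * k1) (2 * (s * (k1 + k2))) (s * (k1 + k2)) bw (start_fraction k1 k2)
     (\<lambda>Y. start_limit (pair_flag k1 k2) Y [0..<2 * s * k1] *
          start_limit (pair_flag k1 k2) Y [2 * s * k1..<2 * (s * (k1 + k2))])"
proof
  show "2 * s * k1 \<le> 2 * (s * (k1 + k2))" by (simp add: algebra_simps)
  show "filterlim bw at_top sequentially" by (rule bw_lim)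
  show "0 \<le> start_fraction k1 k2 n x" "start_fraction k1 k2 n x \<le> 1" for n x
    by (rule start_fraction_bounds)+
  show "(\<lambda>n. start_fraction k1 k2 n (X n)) \<longlonglongrightarrow> start_limit (pair_flag k1 k2) Y [0..<2 * s * k1] *
          start_limit (pair_flag k1 k2) Y [2 * s * k1..<2 * (s * (k1 + k2))]"
    if "\<And>p. p \<in> {..<2 * (s * (k1 + k2))} \<Longrightarrow> (\<lambda>n. of_int (X n p) / real (bw n)) \<longlonglongrightarrow> Y p" for X Y
    unfolding start_fraction_def using that
    by (intro tendsto_mult start_fraction_tendsto) (auto simp: algebra_simps)
  show "start_fraction k1 k2 n x = start_fraction k1 k2 n y"
    if "\<And>p. p < 2 * (s * (k1 + k2)) \<Longrightarrow> x p = y p" for n x y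
  proof -
    have "labelled (pair_flag k1 k2) x [0..<2 * s * k1] = labelled (pair_flag k1 k2) y [0..<2 * s * k1]"
      "labelled (pair_flag k1 k2) x [2 * s * k1..<2 * (s * (k1 + k2))] = labelled (pair_flag k1 k2) y [2 * s * k1..<2 * (s * (k1 + k2))]"
      using that by (auto simp: labelled_def algebra_simps)
    then show ?thesis by (simp add: start_fraction_def)
  qed
qed simp

text \<open>A pair of words with prescribed flags is the same as an assignment of indices to positions.\<close>

lemma pair_block_eq:
  fixes n k1 k2 :: nat
  assumes n: "n \<ge> 2"
  defines "L1 \<equiv> 2 * s * k1" and "L \<equiv> 2 * (s * (k1 + k2))" and "H \<equiv> s * (k1 + k2)" and "fl \<equiv> pair_flag k1 k2"
  shows "(\<Sum>u\<in>closed_words s (bw n) k1. \<Sum>v\<in>closed_words s (bw n) k2.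
      of_real (Cn n u * Cn n v) * (em (u @ v) - em u * em v)) =
    of_real (coeff Q k1 * coeff Q k2) *
     ((\<Sum>w\<in>{w\<in>{..<L} \<rightarrow>\<^sub>E {- int (bw n)..int (bw n)}. pair_sum.closed fl L1 L w}.
        of_real (start_fraction k1 k2 n w) * wcov fl L1 L w) * of_real (real (bw n) / real (bw n) ^ H))"
proof -
  let ?h = "bw n"
  interpret P: pair_sum M a \<kappa> \<tau> CM fl L1 L H bw "start_fraction k1 k2"
    "\<lambda>Y. start_limit (pair_flag k1 k2) Y [0..<2 * s * k1] *
          start_limit (pair_flag k1 k2) Y [2 * s * k1..<2 * (s * (k1 + k2))]"
    unfolding fl_def L1_def L_def H_def by (rule pair_sum_flags)
  let ?fs = "flags s k1 @ flags s k2"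
  have L: "L = L1 + 2 * s * k2" by (simp add: L_def L1_def algebra_simps)
  have h: "?h > 0" using bw[OF n] by simp
  have fl: "fl = (\<lambda>p. ?fs ! p)" by (simp add: fl_def pair_flag_def fun_eq_iff)
  have mapfl: "map fl [0..<L1] = flags s k1" "map fl [L1..<L] = flags s k2"
  proof -
    have "map fl [0..<L] = ?fs" unfolding fl L using map_nth[of ?fs] by (simp add: L1_def)
    then have "map fl [0..<L1] @ map fl [L1..<L] = ?fs" unfolding upt_split[OF P.L1L] by simp
    then show "map fl [0..<L1] = flags s k1" "map fl [L1..<L] = flags s k2" by (simp_all add: append_eq_append_conv L1_def)
  qed
  have closed: "P.closed w \<longleftrightarrow> total (labelled fl w [0..<L1]) = 0 \<and> total (labelled fl w [L1..<L]) = 0" for w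
    unfolding P.closed_def total_labelled P.sg_def by (simp add: atLeast0LessThan)
  let ?enc = "\<lambda>(u :: word, v). \<lambda>p\<in>{..<L}. fst ((u @ v) ! p)"
  let ?dec = "\<lambda>w. (labelled fl w [0..<L1], labelled fl w [L1..<L])"
  have "(\<Sum>(u,v)\<in>closed_words s ?h k1 \<times> closed_words s ?h k2. of_real (Cn n u * Cn n v) * (em (u @ v) - em u * em v)) =
     (\<Sum>w\<in>{w\<in>P.box n. P.closed w}. of_real (coeff Q k1 * coeff Q k2 * (real ?h / real ?h ^ H) * start_fraction k1 k2 n w) * wcov fl L1 L w)"
  proof (rule sum.reindex_bij_witness[of _ ?dec ?enc])
    fix q assume q: "q \<in> closed_words s ?h k1 \<times> closed_words s ?h k2"
    then obtain u v where uv: "q = (u,v)" "u \<in> closed_words s ?h k1" "v \<in> closed_words s ?h k2" by blast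
    have len: "length u = L1" "length (u @ v) = L"
      using length_closed_words[OF uv(2)] length_closed_words[OF uv(3)] by (simp_all add: L L1_def)
    have "labelled fl (?enc q) [0..<L] = u @ v"
      unfolding fl by (rule labelled_recover) (use len uv in \<open>auto simp: closed_words_def words_def\<close>)
    then have "labelled fl (?enc q) [0..<L1] @ labelled fl (?enc q) [L1..<L] = u @ v"
      by (simp only: upt_split[OF P.L1L] labelled_append)
    then have dec: "labelled fl (?enc q) [0..<L1] = u" "labelled fl (?enc q) [L1..<L] = v"
      using len by (simp_all add: append_eq_append_conv)
    then show "?dec (?enc q) = q" by (simp add: uv)
    have "?enc q \<in> P.box n"
    proof -
      have "idx (u @ v) \<subseteq> {- int ?h..int ?h}" using uv by (simp add: closed_words_def words_def image_Un)
      then have "fst ((u @ v) ! p) \<in> {- int ?h..int ?h}" if "p < L" for p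
        using that len by (intro subsetD[OF _ imageI[OF nth_mem]]) auto
      then show ?thesis by (simp add: uv)
    qed
    moreover have "P.closed (?enc q)" unfolding closed dec using uv by (simp add: closed_words_def)
    ultimately show "?enc q \<in> {w\<in>P.box n. P.closed w}" by blast
    have "labelled fl (?enc q) [0..<L] = u @ v" unfolding upt_split[OF P.L1L] labelled_append dec ..
    then have cov: "wcov fl L1 L (?enc q) = em (u @ v) - em u * em v" unfolding wcov_def dec by simp
    have st: "start_fraction k1 k2 n (?enc q) = (real (starts n u) / real n) * (real (starts n v) / real n)"
      using dec unfolding start_fraction_def fl_def L1_def L_def by simp
    have e: "(1 / real ?h ^ s) ^ k = 1 / real ?h ^ (s * k)" for k by (simp add: power_divide power_mult)
    have "Cn n u * Cn n v = coeff Q k1 * coeff Q k2 * (sqrt (real ?h) * sqrt (real ?h) / (real ?h ^ (s * k1) * real ?h ^ (s * k2))) *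
        ((real (starts n u) / real n) * (real (starts n v) / real n))"
      unfolding word_coeff_closed[OF s1 uv(2)] word_coeff_closed[OF s1 uv(3)] e
      by (simp add: divide_inverse mult_ac del: real_sqrt_mult_self)
    also have "sqrt (real ?h) * sqrt (real ?h) = real ?h" by simp
    also have "real ?h ^ (s * k1) * real ?h ^ (s * k2) = real ?h ^ H" by (simp add: H_def power_add[symmetric] algebra_simps)
    finally have cc: "Cn n u * Cn n v = coeff Q k1 * coeff Q k2 * (real ?h / real ?h ^ H) *
        ((real (starts n u) / real n) * (real (starts n v) / real n))" .
    show "of_real (coeff Q k1 * coeff Q k2 * (real ?h / real ?h ^ H) * start_fraction k1 k2 n (?enc q)) * wcov fl L1 L (?enc q) =
        (case q of (u, v) \<Rightarrow> of_real (Cn n u * Cn n v) * (em (u @ v) - em u * em v))"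
      unfolding cov st cc[symmetric] unfolding uv(1) prod.case ..
  next
    fix w assume w: "w \<in> {w\<in>P.box n. P.closed w}"
    have "labelled fl w [0..<L1] @ labelled fl w [L1..<L] = labelled fl w [0..<L]"
      by (simp only: upt_split[OF P.L1L] labelled_append)
    then have "?enc (?dec w) p = w p" for p
      using w by (auto simp: labelled_def PiE_iff extensional_def)
    then show "?enc (?dec w) = w" by (rule ext)
    have "w ` {..<L} \<subseteq> {- int ?h..int ?h}" using w by (auto simp: PiE_iff)
    then have "w ` {0..<L1} \<subseteq> {- int ?h..int ?h}" "w ` {L1..<L} \<subseteq> {- int ?h..int ?h}"
      using P.L1L by (auto simp: image_subset_iff)
    moreover have "map snd (labelled fl w [0..<L1]) = flags s k1" "map snd (labelled fl w [L1..<L]) = flags s k2"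
      using mapfl by (simp_all add: labelled_def o_def)
    ultimately show "?dec w \<in> closed_words s ?h k1 \<times> closed_words s ?h k2"
      using w closed[of w] by (simp add: closed_words_def words_def)
  qed
  then show ?thesis
    by (simp add: sum.cartesian_product sum_distrib_left sum_distrib_right mult_ac)
qed

lemma variance_expansion:
  assumes n: "n \<ge> 2"
  shows "complex_of_real (var_fn n) = (\<Sum>k1\<le>degree Q. \<Sum>k2\<le>degree Q.
    \<Sum>u\<in>closed_words s (bw n) k1. \<Sum>v\<in>closed_words s (bw n) k2.
      of_real (Cn n u * Cn n v) * (em (u @ v) - em u * em v))"
proof -
  interpret S: toeplitz_statistic M a \<kappa> \<tau> CM "Wn n" "Cn n" "- int (bw n)" "int (bw n)" Ln by (rule statistic)
  have "complex_of_real (expectation (\<lambda>\<omega>. (S.f \<omega>)\<^sup>2)) = (\<Sum>u\<in>Wn n. \<Sum>v\<in>Wn n. of_real (Cn n u * Cn n v) * em (u @ v))"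
  proof -
    have sq: "complex_of_real ((S.f \<omega>)\<^sup>2) = (\<Sum>u\<in>Wn n. \<Sum>v\<in>Wn n. of_real (Cn n u * Cn n v) * A (u @ v) \<omega>)" for \<omega>
      unfolding power2_eq_square of_real_mult S.f_eq sum_product by (intro sum.cong refl) (simp add: A_append)
    have "complex_of_real (expectation (\<lambda>\<omega>. (S.f \<omega>)\<^sup>2)) = expectation (\<lambda>\<omega>. complex_of_real ((S.f \<omega>)\<^sup>2))"
      by (rule integral_complex_of_real[symmetric])
    also have "\<dots> = (\<Sum>u\<in>Wn n. \<Sum>v\<in>Wn n. of_real (Cn n u * Cn n v) * em (u @ v))"
      unfolding sq em_def by (subst Bochner_Integration.integral_sum; (intro sum.cong refl)?) (auto intro!: Bochner_Integration.integrable_sum)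
    finally show ?thesis .
  qed
  moreover have "complex_of_real (S.mean_f\<^sup>2) = (\<Sum>u\<in>Wn n. \<Sum>v\<in>Wn n. of_real (Cn n u * Cn n v) * (em u * em v))"
    unfolding power2_eq_square of_real_mult S.mean_f_eq sum_product by (intro sum.cong refl) simp
  moreover have "S.var_f = expectation (\<lambda>\<omega>. (S.f \<omega>)\<^sup>2) - S.mean_f\<^sup>2"
    unfolding S.var_f_def S.mean_f_def by (rule variance_eq[OF S.integrable_f S.integrable_f_square])
  ultimately have "complex_of_real (var_fn n) = (\<Sum>u\<in>Wn n. \<Sum>v\<in>Wn n. of_real (Cn n u * Cn n v) * (em (u @ v) - em u * em v))"
    by (simp add: sum_subtractf right_diff_distrib del: of_real_mult)
  also have "\<dots> = (\<Sum>k1\<le>degree Q. \<Sum>u\<in>closed_words s (bw n) k1. \<Sum>k2\<le>degree Q. \<Sum>v\<in>closed_words s (bw n) k2.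
      of_real (Cn n u * Cn n v) * (em (u @ v) - em u * em v))"
    unfolding sum_all_words[OF s1] ..
  also have "\<dots> = (\<Sum>k1\<le>degree Q. \<Sum>k2\<le>degree Q. \<Sum>u\<in>closed_words s (bw n) k1. \<Sum>v\<in>closed_words s (bw n) k2.
      of_real (Cn n u * Cn n v) * (em (u @ v) - em u * em v))"
    by (rule sum.cong[OF refl]) (rule sum.swap)
  finally show ?thesis .
qed

lemma variance_convergent: "\<exists>v\<ge>0. var_fn \<longlonglongrightarrow> v"
proof -
  define T where "T k1 k2 n = (\<Sum>w\<in>{w\<in>{..<2 * (s * (k1 + k2))} \<rightarrow>\<^sub>E {- int (bw n)..int (bw n)}.
       pair_sum.closed (pair_flag k1 k2) (2 * s * k1) (2 * (s * (k1 + k2))) w}.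
        of_real (start_fraction k1 k2 n w) * wcov (pair_flag k1 k2) (2 * s * k1) (2 * (s * (k1 + k2))) w) *
        complex_of_real (real (bw n) / real (bw n) ^ (s * (k1 + k2)))" for k1 k2 n
  have "convergent (T k1 k2)" for k1 k2
    unfolding T_def[abs_def] by (rule pair_sum.total_convergent[OF pair_sum_flags])
  then have "convergent (\<lambda>n. \<Sum>k1\<le>degree Q. \<Sum>k2\<le>degree Q. of_real (coeff Q k1 * coeff Q k2) * T k1 k2 n)"
    by (intro convergent_sum convergent_mult convergent_const)
  then obtain z where z: "(\<lambda>n. \<Sum>k1\<le>degree Q. \<Sum>k2\<le>degree Q. of_real (coeff Q k1 * coeff Q k2) * T k1 k2 n) \<longlonglongrightarrow> z"
    by (auto simp: convergent_def)
  have ev: "eventually (\<lambda>n. complex_of_real (var_fn n) = (\<Sum>k1\<le>degree Q. \<Sum>k2\<le>degree Q. of_real (coeff Q k1 * coeff Q k2) * T k1 k2 n)) sequentially"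
    using eventually_ge_at_top[of 2]
    by eventually_elim (simp only: variance_expansion pair_block_eq T_def)
  have "(\<lambda>n. complex_of_real (var_fn n)) \<longlonglongrightarrow> z" using z ev by (simp add: tendsto_cong)
  then have lim: "var_fn \<longlonglongrightarrow> Re z" using tendsto_Re by fastforce
  moreover have "var_fn n \<ge> 0" for n
    unfolding toeplitz_statistic.var_f_def[OF statistic] by (rule Bochner_Integration.integral_nonneg) simp
  ultimately have "Re z \<ge> 0" by (intro LIMSEQ_le_const[OF lim]) auto
  then show ?thesis using lim by blast
qed

text \<open>With bandwidth \<open>b\<close> the error terms are \<open>O(1 / b)\<close> under the square root and, for the scale \<open>s = \<surd>b\<close>,
\<open>O(b\<^sup>1\<^sup>/\<^sup>2 / b)\<close> and \<open>O(b / b\<^sup>3\<^sup>/\<^sup>2)\<close> in the third-order term. So the characteristic function approaches that of a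
centred Gaussian with the variance of the statistic, and this variance converges.\<close>

lemma clt:
  "\<exists>v\<ge>0. weak_conv_m (\<lambda>n. distr M borel (\<lambda>\<omega>. fn n \<omega> - mean_fn n)) (normal_law 0 v)"
proof -
  obtain v where v: "v \<ge> 0" "var_fn \<longlonglongrightarrow> v" using variance_convergent by blast
  obtain K where K: "K \<ge> 0" "\<And>n. n \<ge> 2 \<Longrightarrow> Gn n \<le> K / real (bw n)" using Gn_le by blast
  define K4 where "K4 = KM (4 * Ln) ^ 6"
  have K40: "K4 \<ge> 0" unfolding K4_def using KM_ge_1[of "4 * Ln"] by simp
  have meas: "fn n \<in> borel_measurable M" for n by (rule toeplitz_statistic.measurable_f[OF statistic])
  have rd: "real_distribution (distr M borel (\<lambda>\<omega>. fn n \<omega> - mean_fn n))" for n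
    using meas[of n] by (intro real_distribution_distr) simp
  have "weak_conv_m (\<lambda>n. distr M borel (\<lambda>\<omega>. fn n \<omega> - mean_fn n)) (normal_law 0 v)"
  proof (rule levy_continuity[OF rd real_distribution_normal_law[OF v(1)]])
    fix t
    let ?ch = "\<lambda>n. char (distr M borel (\<lambda>\<omega>. fn n \<omega> - mean_fn n)) t"
    define E where "E n = \<bar>t\<bar> * (2 * sqrt (2 * K4 * (real Ln)\<^sup>2 * (K / real (bw n)))) +
      t\<^sup>2 / 2 * (17 * K4 * Ln * K * (1 / sqrt (real (bw n))) + 3 * (1 / sqrt (real (bw n))))" for n
    have inv: "(\<lambda>n. 1 / real (bw n)) \<longlonglongrightarrow> 0"
      using bw_lim by (intro tendsto_divide_0[OF tendsto_const] filterlim_at_top_imp_at_infinity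
        filterlim_compose[OF filterlim_real_sequentially])
    have "(\<lambda>n. sqrt (1 / real (bw n))) \<longlonglongrightarrow> sqrt 0" by (rule tendsto_real_sqrt[OF inv])
    then have inv2: "(\<lambda>n. 1 / sqrt (real (bw n))) \<longlonglongrightarrow> 0" by (simp add: real_sqrt_divide)
    have "(\<lambda>n. \<bar>t\<bar> * (2 * sqrt (2 * K4 * (real Ln)\<^sup>2 * (K * (1 / real (bw n))))) +
      t\<^sup>2 / 2 * (17 * K4 * Ln * K * (1 / sqrt (real (bw n))) + 3 * (1 / sqrt (real (bw n))))) \<longlonglongrightarrow>
      \<bar>t\<bar> * (2 * sqrt (2 * K4 * (real Ln)\<^sup>2 * (K * 0))) + t\<^sup>2 / 2 * (17 * K4 * Ln * K * 0 + 3 * 0)"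
      by (intro tendsto_intros inv inv2)
    then have E0: "E \<longlonglongrightarrow> 0" unfolding E_def[abs_def] by simp
    have bound: "norm (?ch n - of_real (exp (- (var_fn n * t\<^sup>2 / 2)))) \<le> \<bar>t\<bar> * E n" if n: "n \<ge> 2" for n
    proof -
      let ?h = "bw n"
      interpret S: toeplitz_statistic M a \<kappa> \<tau> CM "Wn n" "Cn n" "- int ?h" "int ?h" Ln by (rule statistic)
      have h: "real ?h \<ge> 1" using bw[OF n] by simp
      have K4: "S.K4 = K4" unfolding S.K4_def K4_def ..
      define r where "r = sqrt (real ?h)"
      have r: "r > 0" "r\<^sup>2 = real ?h" using h by (auto simp: r_def)
      have "norm (?ch n - of_real (exp (- (var_fn n * t\<^sup>2 / 2)))) \<le> \<bar>t\<bar> *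
         (\<bar>t\<bar> * (2 * sqrt (2 * K4 * (real Ln)\<^sup>2 * Gn n)) + t\<^sup>2 / 2 * (17 * r * K4 * Ln * Gn n + (int ?h - (- int ?h) + 1) / r ^ 3))"
        using S.char_ode_bound[OF r(1) refl, of t] unfolding K4 by simp
      also have "\<dots> \<le> \<bar>t\<bar> * E n"
      proof -
        have a1: "sqrt (2 * K4 * (real Ln)\<^sup>2 * Gn n) \<le> sqrt (2 * K4 * (real Ln)\<^sup>2 * (K / real ?h))"
          using K(2)[OF n] K40 by (intro real_sqrt_le_mono mult_left_mono) auto
        have "17 * r * K4 * Ln * Gn n \<le> 17 * r * K4 * Ln * (K / real ?h)"
          using K(2)[OF n] K40 r by (intro mult_left_mono) auto
        also have "\<dots> = 17 * K4 * Ln * K * (1 / r)"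
          unfolding r(2)[symmetric] using r(1) by (simp add: power2_eq_square)
        finally have a2: "17 * r * K4 * Ln * Gn n \<le> 17 * K4 * Ln * K * (1 / r)" .
        have "real_of_int (int ?h - (- int ?h) + 1) / r ^ 3 \<le> 3 * r\<^sup>2 / r ^ 3"
          using h r by (intro divide_right_mono) auto
        also have "\<dots> = 3 * (1 / r)" using r(1) by (simp add: eval_nat_numeral)
        finally have a3: "real_of_int (int ?h - (- int ?h) + 1) / r ^ 3 \<le> 3 * (1 / r)" .
        show ?thesis unfolding E_def using a1 a2 a3 unfolding r_def[symmetric]
          by (intro mult_left_mono add_mono) auto
      qed
      finally show ?thesis .
    qed
    have "(\<lambda>n. ?ch n - of_real (exp (- (var_fn n * t\<^sup>2 / 2)))) \<longlonglongrightarrow> 0"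
    proof (rule Lim_null_comparison)
      show "\<forall>\<^sub>F n in sequentially. norm (?ch n - of_real (exp (- (var_fn n * t\<^sup>2 / 2)))) \<le> \<bar>t\<bar> * E n"
        using eventually_ge_at_top[of 2] by eventually_elim (rule bound)
      show "(\<lambda>n. \<bar>t\<bar> * E n) \<longlonglongrightarrow> 0" using tendsto_mult[OF tendsto_const E0] by simp
    qed
    moreover have "(\<lambda>n. complex_of_real (exp (- (var_fn n * t\<^sup>2 / 2)))) \<longlonglongrightarrow> of_real (exp (- (v * t\<^sup>2 / 2)))"
      by (intro tendsto_intros v(2)) auto
    ultimately have "?ch \<longlonglongrightarrow> 0 + of_real (exp (- (v * t\<^sup>2 / 2)))"
      using tendsto_add by fastforce
    then show "?ch \<longlonglongrightarrow> char (normal_law 0 v) t" by (simp add: char_normal_law[OF v(1)])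
  qed
  then show ?thesis using v(1) by blast
qed

end

section \<open>Real and complex matrices\<close>

text \<open>Lower moments are bounded through \<open>x\<^sup>k \<le> 1 + x\<^sup>3\<close>.\<close>

lemma (in prob_space) moments_from_third:
  fixes a :: "int \<Rightarrow> 'a \<Rightarrow> complex"
  assumes meas: "\<And>j. a j \<in> borel_measurable M"
    and int: "\<And>j k. k \<ge> 3 \<Longrightarrow> integrable M (\<lambda>\<omega>. cmod (a j \<omega>) ^ k)"
    and bdd: "\<And>k. k \<ge> 3 \<Longrightarrow> bdd_above (range (\<lambda>j. expectation (\<lambda>\<omega>. cmod (a j \<omega>) ^ k)))"
  shows "\<exists>CM. \<forall>j k. integrable M (\<lambda>\<omega>. cmod (a j \<omega>) ^ k) \<and> expectation (\<lambda>\<omega>. cmod (a j \<omega>) ^ k) \<le> CM k"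
proof -
  have "\<exists>B. \<forall>j. integrable M (\<lambda>\<omega>. cmod (a j \<omega>) ^ k) \<and> expectation (\<lambda>\<omega>. cmod (a j \<omega>) ^ k) \<le> B" for k
  proof (cases "k \<ge> 3")
    case True
    then show ?thesis using int[OF True] bdd[OF True] unfolding bdd_above_def by blast
  next
    case False
    note [measurable] = meas
    obtain B where B: "\<And>j. expectation (\<lambda>\<omega>. cmod (a j \<omega>) ^ 3) \<le> B"
      using bdd[of 3] unfolding bdd_above_def by auto
    have le: "x ^ k \<le> 1 + x ^ 3" if "x \<ge> 0" for x :: real
    proof (cases "x \<le> 1")
      case True
      then have "x ^ k \<le> 1" using that by (simp add: power_le_one)
      then show ?thesis using that by (simp add: add_increasing2)
    next
      case F: False
      then have "x ^ k \<le> x ^ 3" using False by (intro power_increasing) auto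
      then show ?thesis by simp
    qed
    have i3: "integrable M (\<lambda>\<omega>. 1 + cmod (a j \<omega>) ^ 3)" for j using int[of 3 j] by simp
    have ik: "integrable M (\<lambda>\<omega>. cmod (a j \<omega>) ^ k)" for j
    proof (rule Bochner_Integration.integrable_bound[OF i3[of j]])
      show "AE \<omega> in M. norm (cmod (a j \<omega>) ^ k) \<le> norm (1 + cmod (a j \<omega>) ^ 3)"
      proof (rule AE_I2)
        fix \<omega>
        have "cmod (a j \<omega>) ^ k \<le> 1 + cmod (a j \<omega>) ^ 3" by (rule le) simp
        then show "norm (cmod (a j \<omega>) ^ k) \<le> norm (1 + cmod (a j \<omega>) ^ 3)" by simp
      qed
    qed measurable
    have "expectation (\<lambda>\<omega>. cmod (a j \<omega>) ^ k) \<le> 1 + B" for j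
    proof -
      have "expectation (\<lambda>\<omega>. cmod (a j \<omega>) ^ k) \<le> expectation (\<lambda>\<omega>. 1 + cmod (a j \<omega>) ^ 3)"
        by (intro integral_mono ik i3 le) simp
      also have "\<dots> \<le> 1 + B" using int[of 3 j] B[of j] by (simp add: prob_space)
      finally show ?thesis .
    qed
    then show ?thesis using ik by blast
  qed
  then show ?thesis by metis
qed

text \<open>The entries are real on the sample space only. Passing to their real parts makes them real everywhere and their
independence a consequence of that of the real parts; all moments are unchanged.\<close>

lemma (in prob_space) toeplitz_input_real:
  assumes "real_toeplitz_input a \<kappa>"
  shows "\<exists>CM. toeplitz_input M (\<lambda>j \<omega>. of_real (Re (a j \<omega>))) \<kappa> 1 CM"
proof -
  define a' where "a' j \<omega> = complex_of_real (Re (a j \<omega>))" for j \<omega>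
  have eq: "a' j \<omega> = a j \<omega>" if "\<omega> \<in> space M" for j \<omega>
    using assms that unfolding real_toeplitz_input_def a'_def by (simp add: of_real_Re)
  have indepRe: "indep_vars (\<lambda>_. borel) (\<lambda>j \<omega>. Re (a j \<omega>)) UNIV"
    using assms unfolding real_toeplitz_input_def by blast
  have "indep_vars (\<lambda>_. borel) (\<lambda>j \<omega>. complex_of_real (Re (a j \<omega>))) UNIV"
    by (rule indep_vars_compose2[OF indepRe]) simp
  then have indep: "indep_vars (\<lambda>_. borel) a' UNIV" unfolding a'_def[abs_def] .
  then have meas: "a' j \<in> borel_measurable M" for j by (auto simp: indep_vars_def)
  have cong: "expectation (\<lambda>\<omega>. g (a' j \<omega>)) = expectation (\<lambda>\<omega>. g (a j \<omega>))" for j and g :: "complex \<Rightarrow> 'b :: {banach, second_countable_topology}"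
    using eq by (intro Bochner_Integration.integral_cong) auto
  have icong: "integrable M (\<lambda>\<omega>. cmod (a' j \<omega>) ^ k) \<longleftrightarrow> integrable M (\<lambda>\<omega>. cmod (a j \<omega>) ^ k)" for j k
    using eq by (intro Bochner_Integration.integrable_cong) auto
  have "\<exists>CM. \<forall>j k. integrable M (\<lambda>\<omega>. cmod (a' j \<omega>) ^ k) \<and> expectation (\<lambda>\<omega>. cmod (a' j \<omega>) ^ k) \<le> CM k"
  proof (rule moments_from_third[OF meas])
    fix k :: nat assume "k \<ge> 3"
    then show "integrable M (\<lambda>\<omega>. cmod (a' j \<omega>) ^ k)" for j
      unfolding icong using assms by (simp add: real_toeplitz_input_def)
    show "bdd_above (range (\<lambda>j. expectation (\<lambda>\<omega>. cmod (a' j \<omega>) ^ k)))"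
      unfolding cong[of "\<lambda>z. cmod z ^ k"] using assms \<open>k \<ge> 3\<close> by (simp add: real_toeplitz_input_def)
  qed
  then obtain CM where CM: "\<And>j k. integrable M (\<lambda>\<omega>. cmod (a' j \<omega>) ^ k)" "\<And>j k. expectation (\<lambda>\<omega>. cmod (a' j \<omega>) ^ k) \<le> CM k"
    by blast
  have "toeplitz_input M a' \<kappa> 1 CM"
  proof
    show "expectation (a' j) = 0" for j
      using cong[of "\<lambda>z. z" j] assms by (simp add: real_toeplitz_input_def)
    show sq: "expectation (\<lambda>\<omega>. (cmod (a' j \<omega>))\<^sup>2) = 1" for j
      using cong[of "\<lambda>z. (cmod z)\<^sup>2" j] assms by (simp add: real_toeplitz_input_def)
    show "expectation (\<lambda>\<omega>. (a' j \<omega>)\<^sup>2) = complex_of_real 1" for j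
    proof -
      have "(a' j \<omega>)\<^sup>2 = complex_of_real ((cmod (a' j \<omega>))\<^sup>2)" for \<omega> by (simp add: a'_def)
      then have "expectation (\<lambda>\<omega>. (a' j \<omega>)\<^sup>2) = complex_of_real (expectation (\<lambda>\<omega>. (cmod (a' j \<omega>))\<^sup>2))"
        by (simp only: integral_complex_of_real)
      then show ?thesis by (simp only: sq)
    qed
    show "expectation (\<lambda>\<omega>. cmod (a' j \<omega>) ^ 4) = \<kappa>" for j
      using cong[of "\<lambda>z. cmod z ^ 4" j] assms by (simp add: real_toeplitz_input_def)
  qed (use indep CM in auto)
  then show ?thesis unfolding a'_def[abs_def] by blast
qed

text \<open>Real and imaginary parts are grouped in pairs, and each entry is a function of its pair.\<close>

lemma (in prob_space) toeplitz_input_complex: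
  assumes "complex_toeplitz_input a \<kappa>"
  shows "\<exists>CM. toeplitz_input M a \<kappa> 0 CM"
proof -
  let ?X = "\<lambda>(j, im) \<omega>. if im then Im (a j \<omega>) else Re (a j \<omega>)"
  have X: "indep_vars (\<lambda>_. borel) ?X UNIV" using assms unfolding complex_toeplitz_input_def by blast
  let ?K = "\<lambda>j :: int. {(j, False), (j, True)}"
  have "indep_vars (\<lambda>j. Pi\<^sub>M (?K j) (\<lambda>_. borel)) (\<lambda>j \<omega>. restrict (\<lambda>i. ?X i \<omega>) (?K j)) UNIV"
    by (rule indep_vars_restrict[OF X]) (auto simp: disjoint_family_on_def)
  then have "indep_vars (\<lambda>_. borel) (\<lambda>j \<omega>. (\<lambda>c. complex_of_real (c (j, False)) + \<i> * complex_of_real (c (j, True))) (restrict (\<lambda>i. ?X i \<omega>) (?K j))) UNIV"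
  proof (rule indep_vars_compose2)
    fix j :: int
    have [measurable]: "(\<lambda>c. c (j, False)) \<in> borel_measurable (Pi\<^sub>M (?K j) (\<lambda>_. borel :: real measure))"
      "(\<lambda>c. c (j, True)) \<in> borel_measurable (Pi\<^sub>M (?K j) (\<lambda>_. borel :: real measure))"
      by (intro measurable_component_singleton; simp)+
    show "(\<lambda>c. complex_of_real (c (j, False)) + \<i> * complex_of_real (c (j, True))) \<in> Pi\<^sub>M (?K j) (\<lambda>_. borel) \<rightarrow>\<^sub>M borel"
      by measurable
  qed
  then have indep: "indep_vars (\<lambda>_. borel) a UNIV" by (simp flip: complex_eq)
  then have meas: "a j \<in> borel_measurable M" for j by (auto simp: indep_vars_def)
  have "\<exists>CM. \<forall>j k. integrable M (\<lambda>\<omega>. cmod (a j \<omega>) ^ k) \<and> expectation (\<lambda>\<omega>. cmod (a j \<omega>) ^ k) \<le> CM k"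
    by (rule moments_from_third[OF meas]) (use assms in \<open>auto simp: complex_toeplitz_input_def\<close>)
  then obtain CM where CM: "\<And>j k. integrable M (\<lambda>\<omega>. cmod (a j \<omega>) ^ k)" "\<And>j k. expectation (\<lambda>\<omega>. cmod (a j \<omega>) ^ k) \<le> CM k"
    by blast
  have "toeplitz_input M a \<kappa> 0 CM"
    by standard (use indep CM assms in \<open>auto simp: complex_toeplitz_input_def\<close>)
  then show ?thesis by blast
qed

lemma weak_conv_toeplitz_input:
  fixes M :: "'a measure"
  assumes "toeplitz_input M a \<kappa> \<tau> CM" and "s \<ge> 1"
    and "\<And>n. n \<ge> 2 \<Longrightarrow> 0 < bw n \<and> bw n < n"
    and "filterlim bw at_top sequentially" and "(\<lambda>n. real (bw n) / real n) \<longlonglongrightarrow> b"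
  shows "\<exists>v\<ge>0. weak_conv_m
    (\<lambda>n. distr M borel (\<lambda>\<omega>. sqrt (real (bw n)) / real n *
       (Re (mat_trace (poly_mat Q (W_mat s n (bw n) (\<lambda>j. a j \<omega>)))) -
        (\<integral>\<omega>'. Re (mat_trace (poly_mat Q (W_mat s n (bw n) (\<lambda>j. a j \<omega>')))) \<partial>M))))
    (normal_law 0 v)"
proof -
  interpret toeplitz_clt M a \<kappa> \<tau> CM s Q bw b
    using assms by (intro toeplitz_clt.intro toeplitz_clt_axioms.intro) auto
  have "fn n \<omega> - mean_fn n = sqrt (real (bw n)) / real n *
       (Re (mat_trace (poly_mat Q (W_mat s n (bw n) (\<lambda>j. a j \<omega>)))) -
        (\<integral>\<omega>'. Re (mat_trace (poly_mat Q (W_mat s n (bw n) (\<lambda>j. a j \<omega>')))) \<partial>M))" for n \<omega>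
    unfolding toeplitz_statistic.mean_f_def[OF statistic] fn_eq[abs_def]
    by (simp add: right_diff_distrib)
  then show ?thesis using clt by simp
qed

theorem theorem6p8:
  fixes M :: "'a measure"
    and a :: "int \<Rightarrow> 'a \<Rightarrow> complex" and \<kappa> :: real
    and bw :: "nat \<Rightarrow> nat" and b :: real
    and s :: nat and Q :: "real poly"
  assumes "prob_space M"
    and "s \<ge> 1"
    and "prob_space.real_toeplitz_input M a \<kappa> \<or> prob_space.complex_toeplitz_input M a \<kappa>"
    and "\<And>n. n \<ge> 2 \<Longrightarrow> 0 < bw n \<and> bw n < n"
    and "filterlim bw at_top sequentially"
    and "b \<in> {0..1}" and "(\<lambda>n. real (bw n) / real n) \<longlonglongrightarrow> b"
    and "degree Q \<ge> 1"
  shows "\<exists>v\<ge>0. weak_conv_m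
    (\<lambda>n. distr M borel (\<lambda>\<omega>. sqrt (real (bw n)) / real n *
       (Re (mat_trace (poly_mat Q (W_mat s n (bw n) (\<lambda>j. a j \<omega>)))) -
        (\<integral>\<omega>'. Re (mat_trace (poly_mat Q (W_mat s n (bw n) (\<lambda>j. a j \<omega>')))) \<partial>M))))
    (normal_law 0 v)"
  using assms(3)
proof
  assume c: "prob_space.complex_toeplitz_input M a \<kappa>"
  obtain CM where "toeplitz_input M a \<kappa> 0 CM"
    using prob_space.toeplitz_input_complex[OF assms(1) c] by blast
  then show ?thesis by (rule weak_conv_toeplitz_input[OF _ assms(2,4,5,7)])
next
  assume r: "prob_space.real_toeplitz_input M a \<kappa>"
  let ?a = "\<lambda>j \<omega>. complex_of_real (Re (a j \<omega>))"
  obtain CM where CM: "toeplitz_input M ?a \<kappa> 1 CM"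
    using prob_space.toeplitz_input_real[OF assms(1) r] by blast
  have eq: "?a j \<omega> = a j \<omega>" if "\<omega> \<in> space M" for j \<omega>
    using r that unfolding prob_space.real_toeplitz_input_def[OF assms(1)] by (simp add: of_real_Re)
  let ?X = "\<lambda>n a \<omega>. Re (mat_trace (poly_mat Q (W_mat s n (bw n) (\<lambda>j. a j \<omega>))))"
  have X: "?X n ?a \<omega> = ?X n a \<omega>" if "\<omega> \<in> space M" for n \<omega>
    using eq[OF that] by simp
  have "(\<integral>\<omega>'. ?X n ?a \<omega>' \<partial>M) = (\<integral>\<omega>'. ?X n a \<omega>' \<partial>M)" for n
    by (rule Bochner_Integration.integral_cong[OF refl]) (rule X)
  then have d: "distr M borel (\<lambda>\<omega>. sqrt (real (bw n)) / real n * (?X n ?a \<omega> - (\<integral>\<omega>'. ?X n ?a \<omega>' \<partial>M))) =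
      distr M borel (\<lambda>\<omega>. sqrt (real (bw n)) / real n * (?X n a \<omega> - (\<integral>\<omega>'. ?X n a \<omega>' \<partial>M)))" for n
    using X by (intro distr_cong refl) simp
  show ?thesis using weak_conv_toeplitz_input[OF CM assms(2,4,5,7), of Q] unfolding d .
qed

end
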